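(* Let $\mathbb K$ be an algebraically closed field of characteristic zero, let $n\geq 2$, and let $g(z_1,\ldots,z_n)\in\mathbb K[z_1,\ldots,z_n]_d$ be a reduced irreducible homogeneous polynomial of degree $d$ such that the hypersurface $Y^*=V(g)\subset\mathbb P^{n-1}_{\mathbf z}$ is not a cone; equivalently its dual variety $Y=\overline{\nabla_g(V(g))}\subset\mathbb P^{n-1}_{\mathbf z'}$ is non-degenerate. On $\mathbb P^{2n+1}$ with homogeneous coordinates $(u:v:x_1:\cdots:x_n:y_1:\cdots:y_n)$ let $$f(u,v,\mathbf x,\mathbf y)=g(ux_1-vy_1,\ldots,ux_n-vy_n)\in\mathbb K[u,v,\mathbf x,\mathbf y]_{2d},\qquad X=V(f)\subset\mathbb P^{2n+1}.$$ Let $Z_{Y^*}=\overline{\nabla_g(\mathbb P^{n-1}_{\mathbf z})}\subseteq\mathbb P^{n-1}_{\mathbf z'}$. Then: (i) $Z_X=\overline{\nabla_f(\mathbb P^{2n+1})}$ equals the cone $S(L',\mathbb P^1\times Z_{Y^*})=\{(u':v':\alpha\mathbf z':\beta\mathbf z')\;:\;(u',v')\in\mathbb K^2,\ (\alpha:\beta)\in\mathbb P^1,\ [\mathbf z']\in Z_{Y^*}\}^{-}\subset(\mathbb P^{2n+1})^*$, i.e. the cone with vertex the line $L'=V(x'_1,\ldots,x'_n,y'_1,\ldots,y'_n)$ over the Segre embedding of $\mathbb P^1\times Z_{Y^*}$ in $V(u',v')=\mathbb P^{2n-1}$ given by $((\alpha:\beta),\mathbf z')\mapsto(0:0:\alpha\mathbf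 z':\beta\mathbf z')$; (ii) $X^*=\mathbb P^1\times\widetilde Y\subset(\mathbb P^{2n+1})^*$, Segre embedded via $((\alpha:\beta),(w_0:w_1:\cdots:w_n))\mapsto(u':v':\mathbf x':\mathbf y')=(\beta w_0:\alpha w_0:\alpha w_1:\cdots:\alpha w_n:\beta w_1:\cdots:\beta w_n)$ (so that its image lies in the Segre variety $\mathbb P^1\times\mathbb P^n$ defined by $\operatorname{rk}\begin{pmatrix}v'&x'_1&\cdots&x'_n\\ u'&y'_1&\cdots&y'_n\end{pmatrix}=1$); (iii) $\operatorname{codim}(X^*,Z_X)=\operatorname{codim}(Y,Z_{Y^*})+1$. In particular, if $g$ has non-vanishing hessian determinant, then $Z_{Y^*}=\mathbb P^{n-1}_{\mathbf z'}$ and $\operatorname{codim}(X^*,Z_X)=\operatorname{codim}(Y,\mathbb P^{n-1})+1$.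
   Context: For a homogeneous polynomial $h$ in variables $t_0,\ldots,t_M$, the polar map is $\nabla_h:\mathbb P^M\dashrightarrow(\mathbb P^M)^*$, $p\mapsto(\partial h/\partial t_0(p):\cdots:\partial h/\partial t_M(p))$; the polar image of $V(h)$ is $\overline{\nabla_h(\mathbb P^M)}$ and the dual variety of $V(h)$ is $\overline{\nabla_h(V(h))}$. Here $\mathbb P^{n-1}_{\mathbf z'}$ with coordinates $(z'_1:\cdots:z'_n)$ is the dual of $\mathbb P^{n-1}_{\mathbf z}$; $(u':v':x'_1:\cdots:x'_n:y'_1:\cdots:y'_n)$ are the coordinates on $(\mathbb P^{2n+1})^*$ dual to those of $\mathbb P^{2n+1}$. $\mathbb P^n_{\mathbf z'}$ has coordinates $(z'_0:z'_1:\cdots:z'_n)$, containing $\mathbb P^{n-1}_{\mathbf z'}$ as the hyperplane $z'_0=0$, and $\widetilde Y\subset\mathbb P^n_{\mathbf z'}$ is the cone over $Y$ with vertex $(1:0:\cdots:0)$. $Z_X=\overline{\nabla_f(\mathbb P^{2n+1})}$ and $X^*=\overline{\nabla_f(X)}$. *)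

theory Defs
  imports "HOL-Library.Poly_Mapping" "HOL-Computational_Algebra.Polynomial"
    "HOL-Computational_Algebra.Factorial_Ring" "HOL-Analysis.Determinants"
begin

type_synonym ('v, 'k) mpoly = "('v \<Rightarrow>\<^sub>0 nat) \<Rightarrow>\<^sub>0 'k"

definition mpeval :: "('v, 'k::comm_ring_1) mpoly \<Rightarrow> ('v \<Rightarrow> 'k) \<Rightarrow> 'k" where
  "mpeval p x = (\<Sum>m\<in>Poly_Mapping.keys p. Poly_Mapping.lookup p m *
       (\<Prod>v\<in>Poly_Mapping.keys m. x v ^ Poly_Mapping.lookup m v))"

definition mpvar :: "'v \<Rightarrow> ('v, 'k::comm_ring_1) mpoly" where
  "mpvar v = Poly_Mapping.single (Poly_Mapping.single v 1) 1"

definition mpconst :: "'k::comm_ring_1 \<Rightarrow> ('v, 'k) mpoly" where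
  "mpconst c = Poly_Mapping.single 0 c"

definition mpsubst :: "('v, 'k::comm_ring_1) mpoly \<Rightarrow> ('v \<Rightarrow> ('w, 'k) mpoly) \<Rightarrow> ('w, 'k) mpoly" where
  "mpsubst p q = (\<Sum>m\<in>Poly_Mapping.keys p. mpconst (Poly_Mapping.lookup p m) *
       (\<Prod>v\<in>Poly_Mapping.keys m. q v ^ Poly_Mapping.lookup m v))"

definition mpderiv :: "'v \<Rightarrow> ('v, 'k::comm_ring_1) mpoly \<Rightarrow> ('v, 'k) mpoly" where
  "mpderiv v p = (\<Sum>m\<in>Poly_Mapping.keys p.
       Poly_Mapping.single (m - Poly_Mapping.single v 1)
         (of_nat (Poly_Mapping.lookup m v) * Poly_Mapping.lookup p m))"

definition mp_homogeneous :: "nat \<Rightarrow> ('v, 'k::comm_ring_1) mpoly \<Rightarrow> bool" where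
  "mp_homogeneous d p \<longleftrightarrow> (\<forall>m\<in>Poly_Mapping.keys p. (\<Sum>v\<in>Poly_Mapping.keys m. Poly_Mapping.lookup m v) = d)"

definition grad :: "('v, 'k::comm_ring_1) mpoly \<Rightarrow> ('v \<Rightarrow> 'k) \<Rightarrow> ('v \<Rightarrow> 'k)" where
  "grad h x = (\<lambda>v. mpeval (mpderiv v h) x)"

text \<open>Zariski topology on the affine space 'v => 'k.  Projective algebraic sets are
  represented throughout by their affine cones.\<close>
definition zclosed :: "('v \<Rightarrow> 'k::comm_ring_1) set \<Rightarrow> bool" where
  "zclosed S \<longleftrightarrow> (\<exists>P :: ('v, 'k) mpoly set. S = {x. \<forall>p\<in>P. mpeval p x = 0})"

definition zclosure :: "('v \<Rightarrow> 'k::comm_ring_1) set \<Rightarrow> ('v \<Rightarrow> 'k) set" where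
  "zclosure S = {x. \<forall>p :: ('v, 'k) mpoly. (\<forall>y\<in>S. mpeval p y = 0) \<longrightarrow> mpeval p x = 0}"

definition zirred :: "('v \<Rightarrow> 'k::comm_ring_1) set \<Rightarrow> bool" where
  "zirred T \<longleftrightarrow> zclosed T \<and> T \<noteq> {} \<and>
     (\<forall>A B. zclosed A \<and> zclosed B \<and> T \<subseteq> A \<union> B \<longrightarrow> T \<subseteq> A \<or> T \<subseteq> B)"

definition kdim :: "('v \<Rightarrow> 'k::comm_ring_1) set \<Rightarrow> nat" where
  "kdim S = Sup {k. \<exists>C :: nat \<Rightarrow> ('v \<Rightarrow> 'k) set.
       (\<forall>i\<le>k. zirred (C i) \<and> C i \<subseteq> S) \<and> (\<forall>i<k. C i \<subset> C (Suc i))}"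

definition codim :: "('v \<Rightarrow> 'k::comm_ring_1) set \<Rightarrow> ('v \<Rightarrow> 'k) set \<Rightarrow> int" where
  "codim A B = int (kdim B) - int (kdim A)"

definition polar_image :: "('v, 'k::comm_ring_1) mpoly \<Rightarrow> ('v \<Rightarrow> 'k) set" where
  "polar_image h = zclosure {(\<lambda>v. c * grad h p v) | c p.
      p \<noteq> (\<lambda>_. 0) \<and> grad h p \<noteq> (\<lambda>_. 0)}"

definition dual_variety :: "('v, 'k::comm_ring_1) mpoly \<Rightarrow> ('v \<Rightarrow> 'k) set" where
  "dual_variety h = zclosure {(\<lambda>v. c * grad h p v) | c p.
      p \<noteq> (\<lambda>_. 0) \<and> mpeval h p = 0 \<and> grad h p \<noteq> (\<lambda>_. 0)}"

definition hypersurface_is_cone :: "('v, 'k::comm_ring_1) mpoly \<Rightarrow> bool" where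
  "hypersurface_is_cone g \<longleftrightarrow> (\<exists>p. p \<noteq> (\<lambda>_. 0) \<and>
     (\<forall>q. mpeval g q = 0 \<longrightarrow> (\<forall>s t. mpeval g (\<lambda>i. s * p i + t * q i) = 0)))"

definition hessian :: "('n::finite, 'k::comm_ring_1) mpoly \<Rightarrow> ('n, 'k) mpoly" where
  "hessian g = det (\<chi> i j. mpderiv i (mpderiv j g))"

datatype 'n fvar = FU | FV | FX 'n | FY 'n

definition fpoint :: "'k \<Rightarrow> 'k \<Rightarrow> ('n \<Rightarrow> 'k) \<Rightarrow> ('n \<Rightarrow> 'k) \<Rightarrow> ('n fvar \<Rightarrow> 'k)" where
  "fpoint u v x y = (\<lambda>w. case w of FU \<Rightarrow> u | FV \<Rightarrow> v | FX i \<Rightarrow> x i | FY i \<Rightarrow> y i)"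

definition f_of :: "('n, 'k::comm_ring_1) mpoly \<Rightarrow> ('n fvar, 'k) mpoly" where
  "f_of g = mpsubst g (\<lambda>i. mpvar FU * mpvar (FX i) - mpvar FV * mpvar (FY i))"

definition cone_segre :: "('n \<Rightarrow> 'k::comm_ring_1) set \<Rightarrow> ('n fvar \<Rightarrow> 'k) set" where
  "cone_segre Z = zclosure {fpoint u' v' (\<lambda>i. \<alpha> * z i) (\<lambda>i. \<beta> * z i) | u' v' \<alpha> \<beta> z.
      (\<alpha>, \<beta>) \<noteq> (0, 0) \<and> z \<in> Z \<and> z \<noteq> (\<lambda>_. 0)}"

text \<open>Affine cone of P^1 x (cone over Y with vertex (1:0:...:0)), Segre embedded by
  ((a:b),(w0:w)) |-> (b w0 : a w0 : a w : b w); Y given by its affine cone.\<close>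
definition segre_cone_over :: "('n \<Rightarrow> 'k::comm_ring_1) set \<Rightarrow> ('n fvar \<Rightarrow> 'k) set" where
  "segre_cone_over Y = {fpoint (\<beta> * w0) (\<alpha> * w0) (\<lambda>i. \<alpha> * w i) (\<lambda>i. \<beta> * w i) | \<alpha> \<beta> w0 w.
      w \<in> Y}"

end

theory Submission
  imports Defs
begin

text \<open>Put \<open>q = u x - v y\<close>. The gradient of \<open>f\<close> is
  \<open>(x \<cdot> \<nabla>g(q), - y \<cdot> \<nabla>g(q), u \<nabla>g(q), - v \<nabla>g(q))\<close>. For prescribed \<open>u\<close>, \<open>v\<close> and
  \<open>q\<close> the only constraint on the first two entries is Euler's identity
  \<open>u (x \<cdot> \<nabla>g(q)) - v (y \<cdot> \<nabla>g(q)) = d g(q)\<close>. Off \<open>X\<close> the value \<open>g(q)\<close> can be rescaled freely,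
  which gives the cone with vertex \<open>L'\<close>; on \<open>X\<close> it is zero, which gives the Segre product. Exceptional
  parameter values are absorbed by the closures, by restricting to lines.

  For the codimensions, the Krull dimension of a closed set is identified with the largest number of
  coordinates that are algebraically independent on it. That a proper irreducible subset, or a
  polynomial image, has no larger transcendence degree follows by counting monomials; chains of full
  length come from a lifting theorem for points, proved for arbitrary prime ideals so that it also yields
  the Nullstellensatz. The last ingredient is a smooth point of \<open>V(g)\<close>: since polynomial rings are
  factorial, \<open>(g)\<close> is prime, and it does not contain the nonzero partial derivatives of \<open>g\<close>.\<close>

section \<open>Polynomial functions\<close>

text \<open>Since projective sets are given by affine cones, the codimensions can be predicted by
  counting parameters. A point of the cone in (i) depends on a point of \<open>Z\<close>, on
  \<open>u'\<close>, on \<open>v'\<close> and on the ratio of \<alpha> and \<beta>: three parameters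
  on top of \<open>Z\<close>. A point of the Segre product in (ii) depends on \<open>w0\<close> and
  that ratio: two on top of \<open>Y\<close>. The difference is the extra 1 in (iii). Turning the
  count into values of \<open>kdim\<close> takes two opposite bounds. A parametrisation cannot raise
  the dimension, which gives the upper one; coordinates that can be prescribed freely on the set
  give the lower one. The obstacle is that the closures at hand are not presented as irreducible
  sets, while transcendence degree lives on prime ideals. Independence is therefore stated modulo an
  arbitrary set of functions. When a prime is called for, it is taken maximal among the ideals that
  contain the vanishing ideal and avoid all nonzero expressions in the independent functions, so the
  independence survives modulo it.\<close>

inductive_set polyfun :: "(('v \<Rightarrow> 'k::comm_ring_1) \<Rightarrow> 'k) set" where
  const: "(\<lambda>_. c) \<in> polyfun"
| var: "(\<lambda>a. a v) \<in> polyfun"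
| add: "f \<in> polyfun \<Longrightarrow> h \<in> polyfun \<Longrightarrow> (\<lambda>a. f a + h a) \<in> polyfun"
| mult: "f \<in> polyfun \<Longrightarrow> h \<in> polyfun \<Longrightarrow> (\<lambda>a. f a * h a) \<in> polyfun"

lemma polyfun_uminus: "f \<in> polyfun \<Longrightarrow> (\<lambda>a. - f a) \<in> polyfun"
  using polyfun.mult[OF polyfun.const[of "-1"], of f] by simp

lemma polyfun_diff: "f \<in> polyfun \<Longrightarrow> h \<in> polyfun \<Longrightarrow> (\<lambda>a. f a - h a) \<in> polyfun"
  using polyfun.add[OF _ polyfun_uminus, of f h] by simp

text \<open>The device behind most vanishing arguments below: along a polynomial curve a polynomial
  function becomes a univariate polynomial, so vanishing for all but finitely many parameters forces
  vanishing for all.\<close>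

lemma polyfun_along_curve:
  "f \<in> polyfun \<Longrightarrow> \<exists>P. \<forall>t. f (\<lambda>v. poly (c v) t) = poly P t"
proof (induction rule: polyfun.induct)
  case (const c)
  show ?case by (rule exI[of _ "[:c:]"]) simp
next
  case (var v)
  show ?case by blast
next
  case (add f h)
  then show ?case by (metis poly_add)
next
  case (mult f h)
  then show ?case by (metis poly_mult)
qed

text \<open>The line joining a point where \<open>f\<close> is nonzero to one where \<open>h\<close>
  is nonzero restricts both to nonzero univariate polynomials, whose product cannot be zero.\<close>

lemma polyfun_no_zero_divisors:
  fixes f h :: "('v \<Rightarrow> 'k::field_char_0) \<Rightarrow> 'k"
  assumes "f \<in> polyfun" "h \<in> polyfun" "\<And>a. f a * h a = 0"
  shows "(\<forall>a. f a = 0) \<or> (\<forall>a. h a = 0)"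
proof (rule ccontr)
  assume "\<not> ?thesis"
  then obtain a b where ab: "f a \<noteq> 0" "h b \<noteq> 0" by auto
  let ?c = "\<lambda>v. [:a v, b v - a v:]"
  obtain P where P: "\<And>t. f (\<lambda>v. poly (?c v) t) = poly P t"
    using polyfun_along_curve[OF assms(1), of ?c] by blast
  obtain Q where Q: "\<And>t. h (\<lambda>v. poly (?c v) t) = poly Q t"
    using polyfun_along_curve[OF assms(2), of ?c] by blast
  have "poly (P * Q) t = 0" for t
    using assms(3)[of "\<lambda>v. poly (?c v) t"] P[of t] Q[of t] by simp
  then have "P * Q = 0" using poly_all_0_iff_0 by blast
  then show False using ab P[of 0] Q[of 1] by auto
qed

text \<open>A field of characteristic zero is infinite, so polynomials and polynomial functions
  coincide. Working with functions turns every ring identity into a pointwise check; the formal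
  polynomials of the theorem enter through \<open>mp\<close>.\<close>

typedef (overloaded) ('v, 'k) pfun = "polyfun :: (('v \<Rightarrow> 'k::field_char_0) \<Rightarrow> 'k) set"
  morphisms ev Abs_pfun
  by (meson polyfun.const ex_in_conv)

lemma pfun_eqI: "(\<And>a. ev p a = ev q a) \<Longrightarrow> p = q"
  by (metis ev_inject ext)

definition cst :: "'k \<Rightarrow> ('v, 'k::field_char_0) pfun" where
  "cst c = Abs_pfun (\<lambda>_. c)"

definition X :: "'v \<Rightarrow> ('v, 'k::field_char_0) pfun" where
  "X v = Abs_pfun (\<lambda>a. a v)"

lemma ev_cst [simp]: "ev (cst c) a = c"
  by (simp add: cst_def Abs_pfun_inverse polyfun.const)

lemma ev_X [simp]: "ev (X v) a = a v"
  by (simp add: X_def Abs_pfun_inverse polyfun.var)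

instantiation pfun :: (type, field_char_0) comm_ring_1
begin
definition "0 = cst 0"
definition "1 = cst 1"
definition "p + q = Abs_pfun (\<lambda>a. ev p a + ev q a)"
definition "p * q = Abs_pfun (\<lambda>a. ev p a * ev q a)"
definition "- p = Abs_pfun (\<lambda>a. - ev p a)"
definition "p - q = Abs_pfun (\<lambda>a. ev p a - ev q a)"

lemma ev_0 [simp]: "ev 0 a = 0"
  by (simp add: zero_pfun_def)

lemma ev_1 [simp]: "ev 1 a = 1"
  by (simp add: one_pfun_def)

lemma ev_add [simp]: "ev (p + q) a = ev p a + ev q a"
  by (simp add: plus_pfun_def Abs_pfun_inverse ev polyfun.add)

lemma ev_mult [simp]: "ev (p * q) a = ev p a * ev q a"
  by (simp add: times_pfun_def Abs_pfun_inverse ev polyfun.mult)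

lemma ev_uminus [simp]: "ev (- p) a = - ev p a"
  by (simp add: uminus_pfun_def Abs_pfun_inverse ev polyfun_uminus)

lemma ev_diff [simp]: "ev (p - q) a = ev p a - ev q a"
  by (simp add: minus_pfun_def Abs_pfun_inverse ev polyfun_diff)

instance
proof
  show "(0::('a, 'b) pfun) \<noteq> 1"
    by (metis ev_0 ev_1 zero_neq_one)
qed (rule pfun_eqI; simp add: algebra_simps)+

end

instance pfun :: (type, field_char_0) idom
proof
  fix p q :: "('a, 'b) pfun"
  assume "p \<noteq> 0" "q \<noteq> 0"
  then show "p * q \<noteq> 0"
    using polyfun_no_zero_divisors[OF ev ev, of p q] by (metis ev_0 ev_mult pfun_eqI)
qed

lemma ev_of_nat [simp]: "ev (of_nat n) a = of_nat n"
  by (induction n) auto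

instance pfun :: (type, field_char_0) ring_char_0
proof
  show "inj (of_nat :: nat \<Rightarrow> ('a, 'b) pfun)"
    by (metis ev_of_nat injI of_nat_eq_iff)
qed

lemma ev_power [simp]: "ev (p ^ n) a = ev p a ^ n"
  by (induction n) auto

lemma ev_sum [simp]: "ev (sum f I) a = (\<Sum>i\<in>I. ev (f i) a)"
  by (induction I rule: infinite_finite_induct) auto

lemma ev_prod [simp]: "ev (prod f I) a = (\<Prod>i\<in>I. ev (f i) a)"
  by (induction I rule: infinite_finite_induct) auto

lemma pfun_neq_0E:
  assumes "p \<noteq> 0" obtains a where "ev p a \<noteq> 0"
  using assms by (metis ev_0 pfun_eqI)

lemma cst_0 [simp]: "cst 0 = 0" and cst_1 [simp]: "cst 1 = 1"
  by (simp_all add: zero_pfun_def one_pfun_def)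

lemma cst_eq_0_iff [simp]: "cst c = 0 \<longleftrightarrow> c = 0"
  by (metis cst_0 ev_cst)

lemma ev_along_curve: "\<exists>P. \<forall>t. ev p (\<lambda>v. poly (c v) t) = poly P t"
  by (rule polyfun_along_curve[OF ev])

definition pcomp :: "('w, 'k) pfun \<Rightarrow> ('w \<Rightarrow> ('v, 'k::field_char_0) pfun) \<Rightarrow> ('v, 'k) pfun" where
  "pcomp F \<phi> = Abs_pfun (\<lambda>a. ev F (\<lambda>w. ev (\<phi> w) a))"

lemma ev_pcomp [simp]: "ev (pcomp F \<phi>) a = ev F (\<lambda>w. ev (\<phi> w) a)"
proof -
  have "f \<in> polyfun \<Longrightarrow> (\<lambda>a. f (\<lambda>w. ev (\<phi> w) a)) \<in> polyfun" for f
    by (induction rule: polyfun.induct) (auto intro: polyfun.intros ev)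
  then show ?thesis
    by (simp add: pcomp_def Abs_pfun_inverse ev)
qed

lemma pcomp_0 [simp]: "pcomp 0 \<phi> = 0" and pcomp_1 [simp]: "pcomp 1 \<phi> = 1"
  and pcomp_mult: "pcomp (F * G) \<phi> = pcomp F \<phi> * pcomp G \<phi>"
  and pcomp_add: "pcomp (F + G) \<phi> = pcomp F \<phi> + pcomp G \<phi>"
  and pcomp_X [simp]: "pcomp (X w) \<phi> = \<phi> w"
  by (rule pfun_eqI; simp)+

section \<open>Subrings generated by some of the coordinates, and expansion in one further
  coordinate\<close>

inductive_set pfun_in :: "'v set \<Rightarrow> ('v, 'k::field_char_0) pfun set" for A where
  const: "cst c \<in> pfun_in A"
| var: "v \<in> A \<Longrightarrow> X v \<in> pfun_in A"
| add: "p \<in> pfun_in A \<Longrightarrow> q \<in> pfun_in A \<Longrightarrow> p + q \<in> pfun_in A"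
| mult: "p \<in> pfun_in A \<Longrightarrow> q \<in> pfun_in A \<Longrightarrow> p * q \<in> pfun_in A"

lemma pfun_in_UNIV [simp]: "p \<in> pfun_in UNIV"
proof -
  have "f \<in> polyfun \<Longrightarrow> Abs_pfun f \<in> pfun_in UNIV" for f :: "('v \<Rightarrow> 'k::field_char_0) \<Rightarrow> 'k"
  proof (induction rule: polyfun.induct)
    case (add f h)
    then show ?case
      using pfun_in.add[OF add.IH] by (simp add: plus_pfun_def Abs_pfun_inverse)
  next
    case (mult f h)
    then show ?case
      using pfun_in.mult[OF mult.IH] by (simp add: times_pfun_def Abs_pfun_inverse)
  qed (use pfun_in.const[where A=UNIV] pfun_in.var[where A=UNIV] in \<open>auto simp: cst_def X_def\<close>)
  then show ?thesis by (metis ev ev_inverse)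
qed

lemma pfun_in_UNIV_eq [simp]: "pfun_in UNIV = UNIV"
  by auto

lemma pfun_in_0 [simp]: "0 \<in> pfun_in A" and pfun_in_1 [simp]: "1 \<in> pfun_in A"
  by (metis pfun_in.const cst_0, metis pfun_in.const cst_1)

lemma pfun_in_uminus: "p \<in> pfun_in A \<Longrightarrow> - p \<in> pfun_in A"
proof -
  have "- p = cst (-1) * p" by (rule pfun_eqI) simp
  then show "p \<in> pfun_in A \<Longrightarrow> - p \<in> pfun_in A" by (metis pfun_in.mult pfun_in.const)
qed

lemma pfun_in_diff: "p \<in> pfun_in A \<Longrightarrow> q \<in> pfun_in A \<Longrightarrow> p - q \<in> pfun_in A"
  using pfun_in.add[OF _ pfun_in_uminus, of p A q] by simp

lemma pfun_in_sum: "(\<And>i. i \<in> I \<Longrightarrow> f i \<in> pfun_in A) \<Longrightarrow> sum f I \<in> pfun_in A"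
  by (induction I rule: infinite_finite_induct) (auto intro: pfun_in.add)

lemma pfun_in_prod: "(\<And>i. i \<in> I \<Longrightarrow> f i \<in> pfun_in A) \<Longrightarrow> prod f I \<in> pfun_in A"
  by (induction I rule: infinite_finite_induct) (auto intro: pfun_in.mult)

lemma pfun_in_power: "p \<in> pfun_in A \<Longrightarrow> p ^ n \<in> pfun_in A"
  by (induction n) (auto intro: pfun_in.mult)

lemma pfun_in_mono: "A \<subseteq> B \<Longrightarrow> pfun_in A \<subseteq> pfun_in B"
proof
  fix p :: "('a, 'b::field_char_0) pfun" assume "A \<subseteq> B" "p \<in> pfun_in A"
  from this(2,1) show "p \<in> pfun_in B" by (induction rule: pfun_in.induct) (auto intro: pfun_in.intros)
qed

lemma ev_pfun_in_cong: "p \<in> pfun_in A \<Longrightarrow> (\<And>v. v \<in> A \<Longrightarrow> a v = b v) \<Longrightarrow> ev p a = ev p b"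
  by (induction rule: pfun_in.induct) auto

lemma ev_pfun_in_upd [simp]: "p \<in> pfun_in A \<Longrightarrow> x \<notin> A \<Longrightarrow> ev p (a(x := t)) = ev p a"
  by (rule ev_pfun_in_cong) auto

lemma pfun_in_empty: "p \<in> pfun_in {} \<Longrightarrow> \<exists>c. p = cst c"
proof -
  assume "p \<in> pfun_in {}"
  then have "p = cst (ev p undefined)"
    by (intro pfun_eqI) (auto intro: ev_pfun_in_cong)
  then show ?thesis ..
qed

definition evp :: "('v \<Rightarrow> 'k::field_char_0) \<Rightarrow> ('v, 'k) pfun poly \<Rightarrow> 'k poly" where
  "evp a P = map_poly (\<lambda>c. ev c a) P"

lemma coeff_evp [simp]: "coeff (evp a P) i = ev (coeff P i) a"
  by (simp add: evp_def coeff_map_poly)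

lemma ev_poly: "ev (poly P q) a = poly (evp a P) (ev q a)"
proof (induction P)
  case (pCons c P)
  have "evp a (pCons c P) = pCons (ev c a) (evp a P)"
    by (rule poly_eqI) (simp add: coeff_pCons split: nat.split)
  then show ?case using pCons by simp
qed (simp add: evp_def)

definition coeffs_in :: "'v set \<Rightarrow> ('v, 'k::field_char_0) pfun poly set" where
  "coeffs_in A = {P. \<forall>i. coeff P i \<in> pfun_in A}"

lemma coeffs_in_coeff: "P \<in> coeffs_in A \<Longrightarrow> coeff P i \<in> pfun_in A"
  by (simp add: coeffs_in_def)

lemma coeffs_in_0 [simp]: "0 \<in> coeffs_in A" and coeffs_in_1 [simp]: "1 \<in> coeffs_in A"
  by (auto simp: coeffs_in_def coeff_1)

lemma coeffs_in_const: "c \<in> pfun_in A \<Longrightarrow> [:c:] \<in> coeffs_in A"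
  by (auto simp: coeffs_in_def coeff_pCons split: nat.split)

lemma coeffs_in_monom: "c \<in> pfun_in A \<Longrightarrow> monom c n \<in> coeffs_in A"
  by (auto simp: coeffs_in_def)

lemma coeffs_in_add: "P \<in> coeffs_in A \<Longrightarrow> Q \<in> coeffs_in A \<Longrightarrow> P + Q \<in> coeffs_in A"
  by (auto simp: coeffs_in_def intro: pfun_in.add)

lemma coeffs_in_diff: "P \<in> coeffs_in A \<Longrightarrow> Q \<in> coeffs_in A \<Longrightarrow> P - Q \<in> coeffs_in A"
  by (auto simp: coeffs_in_def intro: pfun_in_diff)

lemma coeffs_in_mult: "P \<in> coeffs_in A \<Longrightarrow> Q \<in> coeffs_in A \<Longrightarrow> P * Q \<in> coeffs_in A"
  by (auto simp: coeffs_in_def coeff_mult intro!: pfun_in_sum pfun_in.mult)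

lemma coeffs_in_smult: "c \<in> pfun_in A \<Longrightarrow> Q \<in> coeffs_in A \<Longrightarrow> smult c Q \<in> coeffs_in A"
  by (auto simp: coeffs_in_def intro!: pfun_in.mult)

lemma pfun_in_insert_poly:
  assumes "p \<in> pfun_in (insert x A)"
  shows "\<exists>P\<in>coeffs_in A. p = poly P (X x)"
  using assms
proof (induction rule: pfun_in.induct)
  case (const c)
  then show ?case by (intro bexI[of _ "[:cst c:]"]) (auto intro: coeffs_in_const pfun_in.const)
next
  case (var v)
  show ?case
  proof (cases "v = x")
    case True
    then show ?thesis
      by (intro bexI[of _ "[:0,1:]"]) (auto simp: coeffs_in_def coeff_pCons split: nat.split)
  next
    case False
    then show ?thesis using var
      by (intro bexI[of _ "[:X v:]"]) (auto intro: coeffs_in_const pfun_in.var)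
  qed
next
  case (add p q)
  then show ?case by (metis coeffs_in_add poly_add)
next
  case (mult p q)
  then show ?case by (metis coeffs_in_mult poly_mult)
qed

lemma poly_coeffs_in:
  assumes "P \<in> coeffs_in A" shows "poly P (X x) \<in> pfun_in (insert x A)"
proof -
  have "coeff P i \<in> pfun_in (insert x A)" for i
    using coeffs_in_coeff[OF assms] pfun_in_mono[of A "insert x A"] by blast
  then show ?thesis
    unfolding poly_altdef by (intro pfun_in_sum pfun_in.mult pfun_in_power pfun_in.var) auto
qed

lemma coeffs_in_mono: "A \<subseteq> B \<Longrightarrow> coeffs_in A \<subseteq> coeffs_in B"
  using pfun_in_mono by (fastforce simp: coeffs_in_def)

lemma ev_poly_X_upd:
  assumes "Q \<in> coeffs_in A" "x \<notin> A"
  shows "ev (poly Q (X x)) (a(x := t)) = poly (evp a Q) t"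
proof -
  have "evp (a(x := t)) Q = evp a Q"
    by (rule poly_eqI) (simp add: ev_pfun_in_upd[OF coeffs_in_coeff[OF assms(1)] assms(2)])
  then show ?thesis by (simp add: ev_poly)
qed

text \<open>\<open>X x\<close> is transcendental over the functions of the other coordinates: moving
  coordinate \<open>x\<close> alone leaves the coefficients fixed, so the specialised polynomial has
  every \<open>t\<close> as a root.\<close>

lemma poly_X_coeffs_in_eq_0:
  assumes "P \<in> coeffs_in (- {x})" "poly P (X x) = 0"
  shows "P = 0"
proof (rule poly_eqI, rule pfun_eqI)
  fix i a
  have "poly (evp a P) t = 0" for t
    using ev_poly_X_upd[OF assms(1), of x a t] assms(2) by simp
  then have "evp a P = 0" using poly_all_0_iff_0 by blast
  then show "ev (coeff P i) a = ev (coeff 0 i) a"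
    by (metis coeff_0 coeff_evp ev_0)
qed

lemma poly_X_coeffs_in_inject:
  assumes "P \<in> coeffs_in (- {x})" "Q \<in> coeffs_in (- {x})" "poly P (X x) = poly Q (X x)"
  shows "P = Q"
  using poly_X_coeffs_in_eq_0[of "P - Q" x] assms by (simp add: coeffs_in_diff)

text \<open>Instead of dividing by the leading coefficient one multiplies by it, so that quotient
  and remainder stay over the subring of functions in \<open>A\<close>.\<close>

lemma coeffs_in_pseudo_division:
  assumes D: "D \<in> coeffs_in A" "D \<noteq> 0" and F: "F \<in> coeffs_in A"
  shows "\<exists>k Q R. Q \<in> coeffs_in A \<and> R \<in> coeffs_in A \<and> smult (lead_coeff D ^ k) F = D * Q + R
           \<and> (R = 0 \<or> degree R < degree D)"
  using F
proof (induction "degree F" arbitrary: F rule: less_induct)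
  case less
  show ?case
  proof (cases "F = 0 \<or> degree F < degree D")
    case True
    then show ?thesis
      by (intro exI[of _ 0] exI[of _ "0::('a,'b) pfun poly"] exI[of _ F]) (use less in auto)
  next
    case False
    let ?c = "lead_coeff D"
    let ?M = "monom (lead_coeff F) (degree F - degree D)"
    let ?G = "smult ?c F - D * ?M"
    have M: "?M \<in> coeffs_in A" using less.prems by (intro coeffs_in_monom coeffs_in_coeff)
    have G: "?G \<in> coeffs_in A"
      by (intro coeffs_in_diff coeffs_in_smult coeffs_in_mult M coeffs_in_coeff less.prems D)
    have Gc: "coeff ?G (degree F) = 0"
      using False by (simp add: coeff_monom_mult mult.commute[of D])
    have Gd: "degree ?G \<le> degree F"
    proof (rule degree_diff_le)
      show "degree (D * ?M) \<le> degree F"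
        using degree_mult_le[of D ?M] degree_monom_le[of "lead_coeff F" "degree F - degree D"] False
        by linarith
    qed (rule degree_smult_le)
    show ?thesis
    \<comment> \<open>For constant \<open>F\<close> the degree cannot drop; there, cancelling the
      leading term already gives zero.\<close>
    proof (cases "degree F = 0")
      case True
      then have "?G = 0" using Gc Gd
        by (metis le_zero_eq leading_coeff_0_iff)
      then show ?thesis
        by (intro exI[of _ 1] exI[of _ ?M] exI[of _ "0::('a,'b) pfun poly"]) (use M in auto)
    next
      case dF: False
      have "degree ?G < degree F"
        using Gc Gd dF by (metis le_neq_implies_less leading_coeff_0_iff degree_0 neq0_conv)
      from less.hyps[OF this G] obtain k Q R where *: "Q \<in> coeffs_in A" "R \<in> coeffs_in A"
        "smult (?c ^ k) ?G = D * Q + R" "R = 0 \<or> degree R < degree D" by blast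
      have "smult (?c ^ Suc k) F = smult (?c ^ k) ?G + smult (?c ^ k) (D * ?M)"
        by (simp add: smult_diff_right mult.commute)
      also have "\<dots> = D * (Q + smult (?c ^ k) ?M) + R"
        unfolding *(3) by (simp add: algebra_simps)
      finally show ?thesis
        using * M by (intro exI[of _ "Suc k"] exI[of _ "Q + smult (?c ^ k) ?M"] exI[of _ R])
          (auto intro!: coeffs_in_add coeffs_in_smult pfun_in_power coeffs_in_coeff D)
    qed
  qed
qed

section \<open>Prime ideals and the Nullstellensatz\<close>

locale alg_closed_field =
  fixes K :: "'k::field_char_0 itself"
  assumes root_exists: "degree (p :: 'k poly) > 0 \<Longrightarrow> \<exists>x. poly p x = 0"

definition is_ideal :: "'a::comm_ring_1 set \<Rightarrow> bool" where
  "is_ideal I \<longleftrightarrow> 0 \<in> I \<and> (\<forall>a\<in>I. \<forall>b\<in>I. a + b \<in> I) \<and> (\<forall>a\<in>I. \<forall>r. r * a \<in> I)"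

definition is_prime_ideal :: "'a::comm_ring_1 set \<Rightarrow> bool" where
  "is_prime_ideal I \<longleftrightarrow> is_ideal I \<and> 1 \<notin> I \<and> (\<forall>a b. a * b \<in> I \<longrightarrow> a \<in> I \<or> b \<in> I)"

context
  fixes I :: "'a::comm_ring_1 set"
  assumes I: "is_ideal I"
begin

lemma ideal_0: "0 \<in> I"
  using I by (simp add: is_ideal_def)

lemma ideal_add: "a \<in> I \<Longrightarrow> b \<in> I \<Longrightarrow> a + b \<in> I"
  using I by (simp add: is_ideal_def)

lemma ideal_mult: "a \<in> I \<Longrightarrow> r * a \<in> I"
  using I by (simp add: is_ideal_def)

lemma ideal_mult': "a \<in> I \<Longrightarrow> a * r \<in> I"
  using ideal_mult[of a r] by (simp add: mult.commute)

lemma ideal_uminus: "a \<in> I \<Longrightarrow> - a \<in> I"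
  using ideal_mult[of a "-1"] by simp

lemma ideal_diff: "a \<in> I \<Longrightarrow> b \<in> I \<Longrightarrow> a - b \<in> I"
  using ideal_add[OF _ ideal_uminus, of a b] by simp

lemma ideal_sum: "(\<And>i. i \<in> S \<Longrightarrow> f i \<in> I) \<Longrightarrow> sum f S \<in> I"
  by (induction S rule: infinite_finite_induct) (auto intro: ideal_0 ideal_add)

lemma ideal_poly: "(\<And>i. coeff Q i \<in> I) \<Longrightarrow> poly Q y \<in> I"
  unfolding poly_altdef by (intro ideal_sum ideal_mult') auto

end

lemma prime_idealD:
  assumes "is_prime_ideal P"
  shows "is_ideal P" "1 \<notin> P" "a * b \<in> P \<Longrightarrow> a \<in> P \<or> b \<in> P"
  using assms by (auto simp: is_prime_ideal_def)

lemma prime_ideal_power: "is_prime_ideal P \<Longrightarrow> a ^ n \<in> P \<Longrightarrow> a \<in> P"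
  by (induction n) (auto dest: prime_idealD)

lemma prime_ideal_prod:
  "finite S \<Longrightarrow> is_prime_ideal P \<Longrightarrow> prod f S \<in> P \<Longrightarrow> \<exists>i\<in>S. f i \<in> P"
  by (induction S rule: finite_induct) (auto dest: prime_idealD)

text \<open>Cutting \<open>Q\<close> off above its last coefficient outside \<open>P\<close> changes
  the value only by an element of \<open>P\<close>. Afterwards the leading coefficient survives
  modulo \<open>P\<close>, as division modulo \<open>P\<close> requires.\<close>

lemma truncate_mod_ideal:
  assumes P: "is_ideal P" and Q: "Q \<in> coeffs_in A" "coeff Q j \<notin> P"
  shows "\<exists>Q'\<in>coeffs_in A. degree Q' \<le> degree Q \<and> lead_coeff Q' \<notin> P \<and> poly Q y - poly Q' y \<in> P"
proof -
  let ?i = "Max {i. coeff Q i \<notin> P}"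
  have sub: "{i. coeff Q i \<notin> P} \<subseteq> {..degree Q}"
    using ideal_0[OF P] by (auto intro: le_degree)
  then have fin: "finite {i. coeff Q i \<notin> P}" using finite_subset by blast
  have i: "coeff Q ?i \<notin> P" using Max_in[OF fin] Q(2) by auto
  have above: "coeff Q k \<in> P" if "k > ?i" for k
    using Max_ge[OF fin, of k] that by force
  let ?Q = "poly_cutoff (Suc ?i) Q"
  have c: "coeff ?Q k = (if k \<le> ?i then coeff Q k else 0)" for k
    by (auto simp: coeff_poly_cutoff)
  have deg: "degree ?Q = ?i"
  proof (rule antisym)
    show "degree ?Q \<le> ?i" by (rule degree_le) (auto simp: c)
    have "coeff ?Q ?i \<noteq> 0" using i ideal_0[OF P] by (metis c order_refl)
    then show "?i \<le> degree ?Q" by (rule le_degree)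
  qed
  have "poly (Q - ?Q) y \<in> P"
    by (rule ideal_poly[OF P]) (auto simp: c intro: above ideal_0[OF P])
  moreover have "?Q \<in> coeffs_in A" using Q(1) by (auto simp: coeffs_in_def c)
  moreover have "?i \<le> degree Q" using i sub by auto
  moreover have "lead_coeff ?Q \<notin> P" using i by (simp add: deg c)
  ultimately show ?thesis using deg by (intro bexI[of _ ?Q]) auto
qed

lemma infinite_nonroot:
  fixes p :: "'k::field_char_0 poly"
  shows "p \<noteq> 0 \<Longrightarrow> \<exists>t. poly p t \<noteq> 0"
  using poly_all_0_iff_0 by blast

context alg_closed_field
begin

text \<open>Either no element of \<open>P\<close> constrains \<open>x\<close>, and almost every value of \<open>x\<close> works; or \<open>x\<close> is algebraic
  modulo \<open>P\<close>. Then a root of a polynomial of least degree in \<open>P\<close> works, and \<open>v\<close> stays nonzero because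
  some \<open>w \<notin> P\<close> not involving \<open>x\<close> lies in \<open>P + (v)\<close>.\<close>

lemma extend_point_one_coordinate:
  fixes P :: "('v, 'k) pfun set"
  assumes P: "is_prime_ideal P" and x: "x \<notin> A" and v: "v \<in> pfun_in (insert x A)" "v \<notin> P"
  shows "\<exists>u\<in>pfun_in A. u \<notin> P \<and> (\<forall>a. (\<forall>r\<in>P \<inter> pfun_in A. ev r a = 0) \<and> ev u a \<noteq> 0 \<longrightarrow>
    (\<exists>t. (\<forall>r\<in>P \<inter> pfun_in (insert x A). ev r (a(x := t)) = 0) \<and> ev v (a(x := t)) \<noteq> 0))"
proof -
  note I = prime_idealD(1)[OF P]
  let ?E = "pfun_in (insert x A) :: ('v, 'k) pfun set"
  note ev_upd = ev_poly_X_upd[OF _ x]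
  have AE: "pfun_in A \<subseteq> ?E" by (rule pfun_in_mono) auto
  obtain V where V: "V \<in> coeffs_in A" "v = poly V (X x)" using pfun_in_insert_poly[OF v(1)] by blast
  show ?thesis
  proof (cases "\<forall>Q\<in>coeffs_in A. poly Q (X x) \<in> P \<longrightarrow> (\<forall>i. coeff Q i \<in> P)")
    case True
    \<comment> \<open>If this coefficient is nonzero at \<open>a\<close>, then \<open>v\<close>
      becomes a nonzero polynomial in the new coordinate and some \<open>t\<close> avoids its roots.
      Elements of \<open>P\<close> vanish for every \<open>t\<close>, because all their coefficients
      lie in \<open>P\<close> and so vanish at \<open>a\<close>.\<close>
    obtain i where i: "coeff V i \<notin> P" using ideal_poly[OF I, of V "X x"] V v(2) by blast
    show ?thesis
    proof (intro bexI[of _ "coeff V i"] conjI i allI impI)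
      show "coeff V i \<in> pfun_in A" by (rule coeffs_in_coeff[OF V(1)])
      fix a assume a: "(\<forall>r\<in>P \<inter> pfun_in A. ev r a = 0) \<and> ev (coeff V i) a \<noteq> 0"
      then have "evp a V \<noteq> 0" by (metis coeff_0 coeff_evp)
      then obtain t where t: "poly (evp a V) t \<noteq> 0" using infinite_nonroot by blast
      have "ev r (a(x := t)) = 0" if r: "r \<in> P \<inter> ?E" for r
      proof -
        obtain Q where Q: "Q \<in> coeffs_in A" "r = poly Q (X x)" using pfun_in_insert_poly[of r x A] r by auto
        have "evp a Q = 0"
          by (rule poly_eqI) (use True Q r a coeffs_in_coeff[OF Q(1)] in auto)
        then show ?thesis using ev_upd[OF Q(1)] Q(2) by simp
      qed
      then show "\<exists>t. (\<forall>r\<in>P \<inter> ?E. ev r (a(x := t)) = 0) \<and> ev v (a(x := t)) \<noteq> 0"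
        using t ev_upd[OF V(1)] V(2) by metis
    qed
  next
    case False
    define good where "good J m \<longleftrightarrow> (\<exists>Q\<in>coeffs_in A. lead_coeff Q \<notin> P \<and> poly Q (X x) \<in> J \<and> degree Q = m)"
      for J m
    \<comment> \<open>Below the least degree in \<open>good J\<close>, every coefficient of an
      element of \<open>J\<close> lies in \<open>P\<close>, since truncation would otherwise produce
      a smaller good degree. It is applied both to \<open>P\<close> and to the larger ideal
      \<open>J\<close> below.\<close>
    have low: "coeff Q i \<in> P"
      if J: "\<And>w s. w \<in> J \<Longrightarrow> s \<in> P \<inter> ?E \<Longrightarrow> w - s \<in> J"
        and Q: "Q \<in> coeffs_in A" "poly Q (X x) \<in> J" "Q = 0 \<or> degree Q < (LEAST m. good J m)"
      for J Q i
    proof (rule ccontr)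
      assume i: "coeff Q i \<notin> P"
      obtain Q' where Q': "Q' \<in> coeffs_in A" "degree Q' \<le> degree Q" "lead_coeff Q' \<notin> P"
        "poly Q (X x) - poly Q' (X x) \<in> P"
        using truncate_mod_ideal[OF I Q(1) i] by blast
      have "poly Q (X x) - (poly Q (X x) - poly Q' (X x)) \<in> J"
        using Q' Q by (intro J) (auto intro!: pfun_in_diff poly_coeffs_in)
      then have "good J (degree Q')" using Q' by (auto simp: good_def)
      then have "(LEAST m. good J m) \<le> degree Q'" by (rule Least_le)
      moreover have "Q \<noteq> 0" using i ideal_0[OF I] by auto
      ultimately show False using Q(3) Q'(2) by simp
    qed
    \<comment> \<open>The ideal generated by \<open>P\<close> and \<open>v\<close> in the functions
      of \<open>insert x A\<close>. The aim is an element of it that lies outside \<open>P\<close>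
      and is free of \<open>x\<close>.\<close>
    define J where "J = {s + v * y | s y. s \<in> P \<inter> ?E \<and> y \<in> ?E}"
    have J_diff: "w - s \<in> J" if ws: "w \<in> J" "s \<in> P \<inter> ?E" for w s
    proof -
      obtain s' y where "w = s' + v * y" "s' \<in> P \<inter> ?E" "y \<in> ?E" using ws(1) J_def by blast
      then have "w - s = (s' - s) + v * y" "s' - s \<in> P \<inter> ?E"
        using ws(2) ideal_diff[OF I] pfun_in_diff by auto
      then show ?thesis using \<open>y \<in> ?E\<close> J_def by blast
    qed
    have J_mult: "w * c - w' * y' \<in> J"
      if ww: "w \<in> J" "w' \<in> J" "c \<in> ?E" "y' \<in> ?E" for w w' c y'
    proof -
      obtain s y s' z where *: "w = s + v * y" "s \<in> P \<inter> ?E" "y \<in> ?E"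
        "w' = s' + v * z" "s' \<in> P \<inter> ?E" "z \<in> ?E"
        using ww(1,2) unfolding J_def by blast
      have "w * c - w' * y' = (s * c - s' * y') + v * (y * c - z * y')"
        by (simp add: * algebra_simps)
      moreover have "s * c - s' * y' \<in> P \<inter> ?E" "y * c - z * y' \<in> ?E"
        using * ww(3,4) ideal_diff[OF I] ideal_mult'[OF I] by (auto intro!: pfun_in_diff pfun_in.mult)
      ultimately show ?thesis unfolding J_def by blast
    qed
    have PJ: "s \<in> J" if "s \<in> P" "s \<in> ?E" for s
      unfolding J_def using that by (intro CollectI exI[of _ s] exI[of _ 0]) auto
    have vJ: "v \<in> J"
      unfolding J_def using ideal_0[OF I] by (intro CollectI exI[of _ 0] exI[of _ 1]) auto
    obtain p0 where "p0 \<in> coeffs_in A" "poly p0 (X x) \<in> P" and p0: "\<exists>i. coeff p0 i \<notin> P"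
      using False by blast
    then obtain p1 where p1: "p1 \<in> coeffs_in A" "lead_coeff p1 \<notin> P" "poly p0 (X x) - poly p1 (X x) \<in> P"
      using truncate_mod_ideal[OF I] by blast
    then have "poly p0 (X x) - (poly p0 (X x) - poly p1 (X x)) \<in> P"
      using \<open>poly p0 (X x) \<in> P\<close> ideal_diff[OF I] by blast
    then have ex: "good P (degree p1)" using p1 good_def by auto
    let ?m = "LEAST m. good P m"
    obtain p where p: "p \<in> coeffs_in A" "lead_coeff p \<notin> P" "poly p (X x) \<in> P" "degree p = ?m"
      using LeastI[of "good P", OF ex] unfolding good_def by blast
    have pJ: "poly p (X x) \<in> J" using p by (intro PJ poly_coeffs_in)
    have m_pos: "?m > 0"
    proof (rule ccontr)
      assume "\<not> ?m > 0"
      then have "degree p = 0" using p by simp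
      then obtain c where "p = [:c:]" by (metis degree_eq_zeroE)
      then show False using p by simp
    qed
    have exJ: "good J ?m" using p pJ good_def by metis
    let ?k = "LEAST m. good J m"
    have km: "?k \<le> ?m" using exJ by (rule Least_le)
    obtain r where r: "r \<in> coeffs_in A" "lead_coeff r \<notin> P" "poly r (X x) \<in> J" "degree r = ?k"
      using LeastI[of "good J", OF exJ] unfolding good_def by blast
    have r0: "r \<noteq> 0" using r(2) ideal_0[OF I] by auto
    have mod_r: "\<exists>k Q R. Q \<in> coeffs_in A \<and> (\<forall>i. coeff R i \<in> P) \<and> (R = 0 \<or> degree R < degree r)
        \<and> smult (lead_coeff r ^ k) F = r * Q + R"
      if F: "F \<in> coeffs_in A" "poly F (X x) \<in> J" for F
    proof -
      obtain k Q R where *: "Q \<in> coeffs_in A" "R \<in> coeffs_in A" "smult (lead_coeff r ^ k) F = r * Q + R"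
        "R = 0 \<or> degree R < degree r"
        using coeffs_in_pseudo_division[OF r(1) r0 F(1)] by blast
      have "R = smult (lead_coeff r ^ k) F - r * Q" using *(3) by simp
      then have "poly R (X x) = poly F (X x) * lead_coeff r ^ k - poly r (X x) * poly Q (X x)"
        by (simp add: mult.commute)
      also have "\<dots> \<in> J"
        using F r * AE coeffs_in_coeff[OF r(1)] by (intro J_mult poly_coeffs_in pfun_in_power) auto
      finally have "coeff R i \<in> P" for i
        using *(2,4) r(4) J_diff by (intro low[of J]) auto
      then show ?thesis using * by blast
    qed
    have lcpow: "lead_coeff r ^ k \<notin> P" for k using prime_ideal_power[OF P] r(2) by blast
    \<comment> \<open>Division of \<open>p\<close> by \<open>r\<close> modulo \<open>P\<close> puts
      the product of \<open>r\<close> and the quotient \<open>Q\<close> into \<open>P\<close>, so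
      one of them is in \<open>P\<close>. If \<open>r\<close> is, dividing \<open>v\<close> by
      \<open>r\<close> gives \<open>v\<close> in \<open>P\<close>. If \<open>Q\<close> is, then,
      having smaller degree than \<open>p\<close>, it has its leading coefficient in
      \<open>P\<close>; but that coefficient times the one of \<open>r\<close> is a power of
      \<open>lead_coeff r\<close> times \<open>lead_coeff p\<close>, which is outside
      \<open>P\<close>.\<close>
    have "degree r = 0"
    proof (rule ccontr)
      assume dr: "degree r \<noteq> 0"
      obtain k Q R where Q: "Q \<in> coeffs_in A" "\<And>i. coeff R i \<in> P" "R = 0 \<or> degree R < degree r"
        "smult (lead_coeff r ^ k) p = r * Q + R"
        using mod_r[OF p(1) pJ] by blast
      have "poly r (X x) * poly Q (X x) = lead_coeff r ^ k * poly p (X x) - poly R (X x)"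
        using arg_cong[OF Q(4), of "\<lambda>q. poly q (X x)"] by (simp add: algebra_simps)
      also have "\<dots> \<in> P" by (intro ideal_diff[OF I] ideal_mult[OF I] p ideal_poly[OF I] Q)
      finally consider "poly r (X x) \<in> P" | "poly Q (X x) \<in> P" using prime_idealD(3)[OF P] by blast
      then show False
      proof cases
        case 1
        obtain k Q R where "Q \<in> coeffs_in A" and R: "\<And>i. coeff R i \<in> P"
          and eq: "smult (lead_coeff r ^ k) V = r * Q + R"
          using mod_r[OF V(1)] vJ V(2) by blast
        have "lead_coeff r ^ k * v = poly r (X x) * poly Q (X x) + poly R (X x)"
          using arg_cong[OF eq, of "\<lambda>q. poly q (X x)"] V(2) by simp
        also have "\<dots> \<in> P" by (intro ideal_add[OF I] ideal_mult'[OF I] 1 ideal_poly[OF I] R)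
        finally show False using prime_idealD(3)[OF P] lcpow v(2) by blast
      next
        case 2
        have p0: "p \<noteq> 0" using m_pos p(4) by auto
        have c0: "lead_coeff r ^ k \<noteq> 0" using r0 by simp
        have rQ: "r * Q = smult (lead_coeff r ^ k) p - R" using Q(4) by simp
        have R_lt: "degree R < degree p" using Q(3) km m_pos r(4) p(4) by auto
        have dQ: "degree (r * Q) = degree p"
          unfolding rQ using degree_add_eq_left[of "- R" "smult (lead_coeff r ^ k) p"] R_lt c0 by simp
        then have "r * Q \<noteq> 0" using m_pos p(4) by auto
        then have Q0: "Q \<noteq> 0" by auto
        have "degree Q < ?m" using dQ degree_mult_eq[OF r0 Q0] dr p(4) by simp
        moreover have "w - s \<in> P" if "w \<in> P" "s \<in> P \<inter> ?E" for w s
          using that ideal_diff[OF I] by blast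
        ultimately have "lead_coeff Q \<in> P" using low[of P Q] Q(1) 2 by blast
        then have "lead_coeff (r * Q) \<in> P" by (simp add: lead_coeff_mult ideal_mult[OF I])
        moreover have "lead_coeff (r * Q) = lead_coeff r ^ k * lead_coeff p"
          unfolding dQ using R_lt by (simp add: rQ coeff_eq_0)
        ultimately show False using prime_idealD(3)[OF P] lcpow p(2) by metis
      qed
    qed
    then obtain w where rw: "r = [:w:]" by (metis degree_eq_zeroE)
    then have w: "w \<in> pfun_in A" "w \<notin> P" "w \<in> J" using r coeffs_in_coeff[of r A 0] by auto
    obtain s y where s: "w = s + v * y" "s \<in> P \<inter> ?E" "y \<in> ?E" using w(3) J_def by blast
    \<comment> \<open>Where \<open>?c\<close> is nonzero, \<open>p\<close> keeps positive degree
      after specialisation and so has a root. Where \<open>w\<close> is nonzero,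
      \<open>w = s + v * y\<close> with \<open>s\<close> in \<open>P\<close> forces \<open>v\<close>
      to be nonzero at the extended point.\<close>
    let ?c = "lead_coeff p"
    show ?thesis
    proof (intro bexI[of _ "?c * w"] conjI allI impI)
      show "?c * w \<in> pfun_in A" by (intro pfun_in.mult coeffs_in_coeff p w)
      show "?c * w \<notin> P" using prime_idealD(3)[OF P] p w by blast
      fix a assume a: "(\<forall>r\<in>P \<inter> pfun_in A. ev r a = 0) \<and> ev (?c * w) a \<noteq> 0"
      have "degree (evp a p) \<ge> ?m" using a p(4) by (intro le_degree) auto
      then obtain t where t: "poly (evp a p) t = 0" using root_exists m_pos by (metis less_le_trans)
      have zero: "ev r (a(x := t)) = 0" if r: "r \<in> P \<inter> ?E" for r
      proof -
        obtain F where F: "F \<in> coeffs_in A" "r = poly F (X x)" using pfun_in_insert_poly[of r x A] r by auto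
        have "p \<noteq> 0" using m_pos p(4) by auto
        then obtain k Q R where *: "Q \<in> coeffs_in A" "R \<in> coeffs_in A" "smult (?c ^ k) F = p * Q + R"
          "R = 0 \<or> degree R < degree p"
          using coeffs_in_pseudo_division[OF p(1) _ F(1)] by blast
        \<comment> \<open>The remainder lies in \<open>P\<close> and has degree below the minimum,
          so all its coefficients vanish at \<open>a\<close>. At the root \<open>t\<close> this
          leaves a power of \<open>?c\<close> times \<open>r\<close>, and \<open>?c\<close> is
          nonzero there.\<close>
        have eqR: "poly R (X x) = ?c ^ k * r - poly p (X x) * poly Q (X x)"
          using arg_cong[OF *(3), of "\<lambda>q. poly q (X x)"] F(2) by (simp add: algebra_simps)
        have "poly R (X x) \<in> P"
          unfolding eqR using r by (intro ideal_diff[OF I] ideal_mult[OF I] ideal_mult'[OF I] p) auto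
        then have "coeff R i \<in> P" for i
          using * p(4) ideal_diff[OF I] by (intro low[of P]) auto
        then have "evp a R = 0"
          by (intro poly_eqI) (use a coeffs_in_coeff[OF *(2)] in auto)
        then have "ev (poly R (X x)) (a(x := t)) = 0" using ev_upd[OF *(2)] by simp
        then have "ev ?c a ^ k * ev r (a(x := t)) = 0"
          unfolding eqR using ev_upd[OF p(1)] t
          by (simp add: ev_pfun_in_upd[OF coeffs_in_coeff[OF p(1)] x])
        then show ?thesis using a by simp
      qed
      have "ev w (a(x := t)) \<noteq> 0" using a ev_pfun_in_upd[OF w(1) x] by simp
      then have "ev v (a(x := t)) \<noteq> 0" using s zero by auto
      then show "\<exists>t. (\<forall>r\<in>P \<inter> ?E. ev r (a(x := t)) = 0) \<and> ev v (a(x := t)) \<noteq> 0"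
        using zero by blast
    qed
  qed
qed

text \<open>Coordinates are added one at a time. The conclusion carries an arbitrary
  \<open>v\<close> because each extension imposes a new non-vanishing condition that the earlier
  extensions must be able to meet. In geometric terms, the projection of the zero set of
  \<open>P\<close> to the coordinates in \<open>A\<close> contains a nonempty open part of its
  closure.\<close>

lemma extend_point:
  fixes P :: "('v, 'k) pfun set"
  assumes P: "is_prime_ideal P"
  shows "finite B \<Longrightarrow> A \<inter> B = {} \<Longrightarrow> v \<in> pfun_in (A \<union> B) \<Longrightarrow> v \<notin> P \<Longrightarrow>
    \<exists>u\<in>pfun_in A. u \<notin> P \<and> (\<forall>a. (\<forall>r\<in>P \<inter> pfun_in A. ev r a = 0) \<and> ev u a \<noteq> 0 \<longrightarrow>
    (\<exists>b. (\<forall>v\<in>A. b v = a v) \<and> (\<forall>r\<in>P \<inter> pfun_in (A \<union> B). ev r b = 0) \<and> ev v b \<noteq> 0))"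
proof (induction B arbitrary: v rule: finite_induct)
  case empty
  then show ?case by auto
next
  case (insert x B)
  have x: "x \<notin> A \<union> B" using insert by auto
  obtain u1 where u1: "u1 \<in> pfun_in (A \<union> B)" "u1 \<notin> P"
    "\<And>a. (\<forall>r\<in>P \<inter> pfun_in (A \<union> B). ev r a = 0) \<Longrightarrow> ev u1 a \<noteq> 0 \<Longrightarrow>
      \<exists>t. (\<forall>r\<in>P \<inter> pfun_in (insert x (A \<union> B)). ev r (a(x := t)) = 0) \<and> ev v (a(x := t)) \<noteq> 0"
    using extend_point_one_coordinate[OF P x, of v] insert by auto
  obtain u where u: "u \<in> pfun_in A" "u \<notin> P"
    "\<And>a. (\<forall>r\<in>P \<inter> pfun_in A. ev r a = 0) \<Longrightarrow> ev u a \<noteq> 0 \<Longrightarrow>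
    \<exists>b. (\<forall>v\<in>A. b v = a v) \<and> (\<forall>r\<in>P \<inter> pfun_in (A \<union> B). ev r b = 0) \<and> ev u1 b \<noteq> 0"
    using insert.IH[OF _ u1(1,2)] insert.prems(1) by auto
  show ?case
  proof (intro bexI[of _ u] conjI u allI impI)
    fix a assume "(\<forall>r\<in>P \<inter> pfun_in A. ev r a = 0) \<and> ev u a \<noteq> 0"
    then obtain b where b: "\<forall>v\<in>A. b v = a v" "\<forall>r\<in>P \<inter> pfun_in (A \<union> B). ev r b = 0" "ev u1 b \<noteq> 0"
      using u(3) by blast
    then obtain t where "\<forall>r\<in>P \<inter> pfun_in (insert x (A \<union> B)). ev r (b(x := t)) = 0"
      "ev v (b(x := t)) \<noteq> 0" using u1(3) by blast
    moreover have "\<forall>v\<in>A. (b(x := t)) v = a v" using b x by auto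
    ultimately show "\<exists>b. (\<forall>v\<in>A. b v = a v) \<and> (\<forall>r\<in>P \<inter> pfun_in (A \<union> insert x B). ev r b = 0) \<and> ev v b \<noteq> 0"
      by (intro exI[of _ "b(x := t)"]) auto
  qed
qed

end

definition zset :: "('v, 'k::field_char_0) pfun set \<Rightarrow> ('v \<Rightarrow> 'k) set" where
  "zset I = {a. \<forall>p\<in>I. ev p a = 0}"

definition van :: "('v \<Rightarrow> 'k::field_char_0) set \<Rightarrow> ('v, 'k) pfun set" where
  "van S = {p. \<forall>a\<in>S. ev p a = 0}"

lemma van_ideal: "is_ideal (van S)"
  by (auto simp: is_ideal_def van_def)

text \<open>This is \<open>extend_point\<close> starting from no coordinates: \<open>P\<close>
  contains no nonzero constant, so the starting conditions hold at every point, and any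
  \<open>v\<close> outside \<open>P\<close> is nonzero at some common zero of
  \<open>P\<close>.\<close>

lemma (in alg_closed_field) nullstellensatz:
  fixes P :: "('v::finite, 'k) pfun set"
  assumes P: "is_prime_ideal P"
  shows "van (zset P) = P"
proof
  show "P \<subseteq> van (zset P)" by (auto simp: van_def zset_def)
  have "v \<notin> van (zset P)" if v: "v \<notin> P" for v
  proof -
    obtain u where u: "u \<in> pfun_in {}" "u \<notin> P"
      "\<And>a. (\<forall>r\<in>P \<inter> pfun_in {}. ev r a = 0) \<Longrightarrow> ev u a \<noteq> 0 \<Longrightarrow>
        \<exists>b. (\<forall>r\<in>P. ev r b = 0) \<and> ev v b \<noteq> 0"
      using extend_point[OF P, of UNIV "{}" v] v by auto
    have "ev r a = 0" if r: "r \<in> P" "r \<in> pfun_in {}" for r a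
    proof (rule ccontr)
      assume "ev r a \<noteq> 0"
      moreover obtain c where c: "r = cst c" using pfun_in_empty r by blast
      ultimately have "cst (inverse c) * r = 1" by (intro pfun_eqI) auto
      then show False using ideal_mult[OF prime_idealD(1)[OF P] r(1)] prime_idealD(2)[OF P] by metis
    qed
    moreover have "\<exists>a. ev u a \<noteq> 0"
      using u(2) ideal_0[OF prime_idealD(1)[OF P]] pfun_neq_0E by metis
    ultimately obtain b where "\<forall>r\<in>P. ev r b = 0" "ev v b \<noteq> 0" using u(3) by (metis IntE)
    then show ?thesis by (auto simp: van_def zset_def)
  qed
  then show "van (zset P) \<subseteq> P" by blast
qed

text \<open>An ideal maximal among those containing \<open>I\<close> and disjoint from
  \<open>M\<close> is prime. Adjoining either of two elements outside it produces an element of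
  \<open>M\<close>; if their product were in the ideal, so would be the product of these two
  elements of \<open>M\<close>.\<close>

lemma prime_ideal_avoiding:
  fixes I :: "'a::comm_ring_1 set"
  assumes I: "is_ideal I" and M: "1 \<in> M" "\<And>a b. a \<in> M \<Longrightarrow> b \<in> M \<Longrightarrow> a * b \<in> M"
    and IM: "I \<inter> M = {}"
  shows "\<exists>P. is_prime_ideal P \<and> I \<subseteq> P \<and> P \<inter> M = {}"
proof -
  let ?A = "{J. is_ideal J \<and> I \<subseteq> J \<and> J \<inter> M = {}}"
  have "\<exists>P\<in>?A. \<forall>J\<in>?A. P \<subseteq> J \<longrightarrow> J = P"
  proof (rule subset_Zorn_nonempty)
    show "?A \<noteq> {}" using I IM by blast
    fix C assume C: "C \<noteq> {}" "subset.chain ?A C"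
    have CA: "\<And>J. J \<in> C \<Longrightarrow> J \<in> ?A" and tot: "\<And>J J'. J \<in> C \<Longrightarrow> J' \<in> C \<Longrightarrow> J \<subseteq> J' \<or> J' \<subseteq> J"
      using C(2) unfolding subset_chain_def by blast+
    have "is_ideal (\<Union>C)"
      unfolding is_ideal_def
    proof (intro conjI ballI allI)
      show "0 \<in> \<Union>C" using C(1) CA ideal_0 by blast
      fix a r assume "a \<in> \<Union>C"
      then show "r * a \<in> \<Union>C" using CA ideal_mult by blast
    next
      fix a b assume "a \<in> \<Union>C" "b \<in> \<Union>C"
      then obtain J where "J \<in> C" "a \<in> J" "b \<in> J" using tot by (metis UnionE subsetD)
      then show "a + b \<in> \<Union>C" using CA ideal_add by blast
    qed
    then show "\<Union>C \<in> ?A" using C(1) CA by blast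
  qed
  then obtain P where P: "is_ideal P" "I \<subseteq> P" "P \<inter> M = {}"
    and max: "\<And>J. is_ideal J \<Longrightarrow> J \<inter> M = {} \<Longrightarrow> P \<subseteq> J \<Longrightarrow> J = P" by auto
  have ex: "\<exists>s\<in>P. \<exists>r. s + r * a \<in> M" if a: "a \<notin> P" for a
  proof (rule ccontr)
    assume no: "\<not> ?thesis"
    let ?J = "{s + r * a | s r. s \<in> P}"
    have "is_ideal ?J"
      unfolding is_ideal_def
    proof (intro conjI ballI allI)
      show "0 \<in> ?J" using ideal_0[OF P(1)] by (intro CollectI exI[of _ 0]) auto
    next
      fix b c assume "b \<in> ?J" "c \<in> ?J"
      then obtain s r s' r' where "b = s + r * a" "c = s' + r' * a" "s \<in> P" "s' \<in> P" by blast
      then have "b + c = (s + s') + (r + r') * a" "s + s' \<in> P"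
        using ideal_add[OF P(1)] by (auto simp: algebra_simps)
      then show "b + c \<in> ?J" by blast
    next
      fix b t assume "b \<in> ?J"
      then obtain s r where "b = s + r * a" "s \<in> P" by blast
      then have "t * b = t * s + (t * r) * a" "t * s \<in> P"
        using ideal_mult[OF P(1)] by (auto simp: algebra_simps)
      then show "t * b \<in> ?J" by blast
    qed
    moreover have "?J \<inter> M = {}" using no by blast
    moreover have "P \<subseteq> ?J"
    proof
      fix s assume "s \<in> P"
      then show "s \<in> ?J" by (intro CollectI exI[of _ s] exI[of _ 0]) auto
    qed
    ultimately have "?J = P" by (rule max)
    moreover have "a \<in> ?J" using ideal_0[OF P(1)] by (intro CollectI exI[of _ 0] exI[of _ 1]) auto
    ultimately show False using a by blast
  qed
  have "is_prime_ideal P"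
    unfolding is_prime_ideal_def
  proof (intro conjI P allI impI)
    show "1 \<notin> P" using P M by blast
    fix a b assume ab: "a * b \<in> P"
    show "a \<in> P \<or> b \<in> P"
    proof (rule ccontr)
      assume "\<not> ?thesis"
      then obtain s r s' r' where *: "s \<in> P" "s' \<in> P" "s + r * a \<in> M" "s' + r' * b \<in> M"
        using ex by meson
      have "(s + r * a) * (s' + r' * b) = (s' + r' * b) * s + (r * a) * s' + (r * r') * (a * b)"
        by (simp add: algebra_simps)
      also have "\<dots> \<in> P"
        by (intro ideal_add[OF P(1)] ideal_mult[OF P(1)] * ab)
      finally show False using M(2)[OF *(3,4)] P(3) by blast
    qed
  qed
  then show ?thesis using P by blast
qed

section \<open>Counting monomials\<close>

text \<open>Induction on the variables: moving one variable along a line, the coefficient of each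
  power of \<open>t\<close> is a relation among monomials in the remaining variables.\<close>

lemma monomials_linearly_independent:
  fixes c :: "('i \<Rightarrow> nat) \<Rightarrow> 'k::field_char_0"
  assumes "finite I" "finite S" "S \<subseteq> I \<rightarrow>\<^sub>E UNIV"
    and "\<And>a. (\<Sum>e\<in>S. c e * (\<Prod>i\<in>I. a i ^ e i)) = 0"
  shows "\<forall>e\<in>S. c e = 0"
  using assms
proof (induction I arbitrary: S c rule: finite_induct)
  case empty
  then have S: "S \<subseteq> {\<lambda>x. undefined}" by auto
  show ?case
  proof
    fix e assume "e \<in> S"
    then have "S = {e}" using S by blast
    then show "c e = 0" using empty.prems(3) by simp
  qed
next
  case (insert x I)
  show ?case
  proof
    fix e0 assume e0: "e0 \<in> S"
    define n where "n = e0 x"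
    let ?S = "{e\<in>S. e x = n}"
    \<comment> \<open>Exponent vectors are extensional functions, so dropping \<open>x\<close> from
      the index set means resetting its entry to \<open>undefined\<close>. On \<open>?S\<close> the
      old entry is always \<open>n\<close>, so the reset can be undone.\<close>
    let ?r = "\<lambda>e. e(x := undefined)"
    have inj: "inj_on ?r ?S"
      by (rule inj_onI) (metis (mono_tags, lifting) fun_upd_triv fun_upd_upd mem_Collect_eq)
    have ins: "(?r e)(x := n) = e" if "e \<in> ?S" for e
      using that by auto
    have zero: "(\<Sum>e\<in>?S. c e * (\<Prod>i\<in>I. a i ^ e i)) = 0" for a
    proof -
      define Q where "Q = (\<Sum>e\<in>S. monom (c e * (\<Prod>i\<in>I. a i ^ e i)) (e x))"
      have "poly Q t = 0" for t
      proof -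
        have "(\<Prod>i\<in>insert x I. (a(x := t)) i ^ e i) = t ^ e x * (\<Prod>i\<in>I. a i ^ e i)" for e
        proof -
          have "(\<Prod>i\<in>I. (a(x := t)) i ^ e i) = (\<Prod>i\<in>I. a i ^ e i)"
            using insert.hyps by (intro prod.cong) auto
          then show ?thesis using insert.hyps by simp
        qed
        then show ?thesis
          using insert.prems(3)[of "a(x := t)"] by (simp add: Q_def poly_sum poly_monom mult_ac)
      qed
      then have "Q = 0" using poly_all_0_iff_0 by blast
      then have "coeff Q n = 0" by simp
      then show ?thesis
        by (simp add: Q_def coeff_sum sum.If_cases[OF insert.prems(1)] sum.inter_filter insert.prems(1))
    qed
    have "\<forall>e\<in>?r ` ?S. c (e(x := n)) = 0"
    proof (rule insert.IH)
      show "finite (?r ` ?S)" using insert.prems by auto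
      show "?r ` ?S \<subseteq> I \<rightarrow>\<^sub>E UNIV"
        using insert.prems(2) by (fastforce simp: PiE_iff extensional_def)
      fix a
      have "(\<Sum>e\<in>?r ` ?S. c (e(x := n)) * (\<Prod>i\<in>I. a i ^ e i))
          = (\<Sum>e\<in>?S. c e * (\<Prod>i\<in>I. a i ^ e i))"
        unfolding sum.reindex[OF inj] o_def
      proof (rule sum.cong)
        fix e assume e: "e \<in> ?S"
        have "(\<Prod>i\<in>I. a i ^ ?r e i) = (\<Prod>i\<in>I. a i ^ e i)"
          using insert.hyps by (intro prod.cong) auto
        then show "c ((?r e)(x := n)) * (\<Prod>i\<in>I. a i ^ ?r e i) = c e * (\<Prod>i\<in>I. a i ^ e i)"
          by (simp only: ins[OF e])
      qed simp
      then show "(\<Sum>e\<in>?r ` ?S. c (e(x := n)) * (\<Prod>i\<in>I. a i ^ e i)) = 0" using zero by simp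
    qed
    then show "c e0 = 0" using e0 ins[of e0] n_def by force
  qed
qed

text \<open>Elimination: an equation is solved for an unknown \<open>j0\<close> with nonzero
  coefficient, which leaves one equation and one unknown fewer.\<close>

lemma homogeneous_system_nontrivial_solution:
  fixes M :: "'j \<Rightarrow> 'b \<Rightarrow> 'k::field"
  assumes "finite B" "finite J" "card B < card J"
  shows "\<exists>c. (\<exists>j\<in>J. c j \<noteq> 0) \<and> (\<forall>b\<in>B. (\<Sum>j\<in>J. c j * M j b) = 0)"
  using assms
proof (induction B arbitrary: J M rule: finite_induct)
  case empty
  then show ?case by (intro exI[of _ "\<lambda>_. 1"]) (auto simp: card_gt_0_iff)
next
  case (insert b B)
  show ?case
  proof (cases "\<forall>j\<in>J. M j b = 0")
    case True
    then show ?thesis using insert.IH[of J M] insert by auto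
  next
    case False
    then obtain j0 where j0: "j0 \<in> J" "M j0 b \<noteq> 0" by blast
    let ?J = "J - {j0}"
    let ?q = "\<lambda>j. M j b / M j0 b"
    have "card B < card ?J" using insert j0 by (simp add: card_Diff_singleton)
    then obtain c where c: "\<exists>j\<in>?J. c j \<noteq> 0"
      "\<And>b'. b' \<in> B \<Longrightarrow> (\<Sum>j\<in>?J. c j * (M j b' - ?q j * M j0 b')) = 0"
      using insert.IH[of ?J "\<lambda>j b'. M j b' - ?q j * M j0 b'"] insert.prems by blast
    let ?c = "c(j0 := - (\<Sum>j\<in>?J. c j * ?q j))"
    have split: "(\<Sum>j\<in>J. ?c j * M j b') = - (\<Sum>j\<in>?J. c j * ?q j) * M j0 b' + (\<Sum>j\<in>?J. c j * M j b')"
      for b'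
      using sum.remove[OF insert.prems(1) j0(1), of "\<lambda>j. ?c j * M j b'"] by simp
    have "(\<Sum>j\<in>J. ?c j * M j b') = 0" if "b' \<in> insert b B" for b'
    proof (cases "b' = b")
      case True
      then show ?thesis unfolding split using j0(2) by (simp add: sum_distrib_right)
    next
      case False
      then show ?thesis unfolding split
        using c(2)[of b'] that by (simp add: sum_distrib_right sum_distrib_left algebra_simps sum_subtractf)
    qed
    moreover have "\<exists>j\<in>J. ?c j \<noteq> 0" using c(1) by auto
    ultimately show ?thesis by blast
  qed
qed

text \<open>Algebraic independence of the residue classes modulo \<open>P\<close>. \<open>P\<close>
  may be any set, in particular the vanishing ideal of a reducible set, and the family may consist
  of arbitrary polynomial functions instead of coordinates.\<close>

definition indep :: "('v, 'k::field_char_0) pfun set \<Rightarrow> ('i \<Rightarrow> ('v, 'k) pfun) \<Rightarrow> 'i set \<Rightarrow> bool" where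
  "indep P \<phi> I \<longleftrightarrow> (\<forall>F\<in>pfun_in I. pcomp F \<phi> \<in> P \<longrightarrow> F = 0)"

lemma pcomp_X_id [simp]: "pcomp F X = F"
  by (rule pfun_eqI) simp

lemma indep_X: "indep P X B \<longleftrightarrow> P \<inter> pfun_in B \<subseteq> {0}"
  by (auto simp: indep_def)

lemma indep_antimono: "indep P \<phi> I \<Longrightarrow> Q \<subseteq> P \<Longrightarrow> indep Q \<phi> I"
  unfolding indep_def by blast

text \<open>A relation for the enlarged family is a polynomial in \<open>X v\<close> over the
  functions in \<open>B\<close>. Independence of \<open>B\<close> keeps its nonzero leading
  coefficient outside \<open>P\<close>, and hence also rules out degree zero.\<close>

lemma algebraic_coordinate:
  assumes P: "is_prime_ideal P" and B: "indep P X B" "\<not> indep P X (insert v B)"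
  shows "\<exists>p\<in>coeffs_in B. lead_coeff p \<notin> P \<and> poly p (X v) \<in> P \<and> degree p > 0"
proof -
  obtain r where r: "r \<in> P" "r \<in> pfun_in (insert v B)" "r \<noteq> 0" using B(2) by (auto simp: indep_X)
  obtain Q where Q: "Q \<in> coeffs_in B" "r = poly Q (X v)" using pfun_in_insert_poly[OF r(2)] by blast
  have Q0: "Q \<noteq> 0" using Q r(3) by auto
  have "lead_coeff Q \<notin> P" using coeffs_in_coeff[OF Q(1)] B(1) Q0 by (auto simp: indep_X)
  moreover have "degree Q > 0"
  proof (rule ccontr)
    assume "\<not> degree Q > 0"
    then obtain c where "Q = [:c:]" by (metis degree_eq_zeroE gr0I)
    then show False using calculation Q r by simp
  qed
  ultimately show ?thesis using Q r by blast
qed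

text \<open>The counting argument for transcendence degrees: modulo \<open>P\<close> and up to multiplication by powers
  of a fixed \<open>u \<notin> P\<close>, the monomials of degree at most \<open>N\<close> in any family lie in a space of
  dimension \<open>O(N ^ card B)\<close>.\<close>

lemma indep_card_le:
  fixes P :: "('v::finite, 'k::field_char_0) pfun set"
  assumes P: "is_prime_ideal P" and B: "indep P X B" "\<And>v. v \<notin> B \<Longrightarrow> \<not> indep P X (insert v B)"
    and I: "finite I" "indep P \<phi> I"
  shows "card I \<le> card B"
proof -
  note Id = prime_idealD(1)[OF P]
  obtain p where p: "\<And>v. v \<notin> B \<Longrightarrow> p v \<in> coeffs_in B" "\<And>v. v \<notin> B \<Longrightarrow> lead_coeff (p v) \<notin> P"
    "\<And>v. v \<notin> B \<Longrightarrow> poly (p v) (X v) \<in> P" "\<And>v. v \<notin> B \<Longrightarrow> degree (p v) > 0"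
    using algebraic_coordinate[OF P B(1) B(2)] by metis
  \<comment> \<open>Exponents in \<open>B\<close> range up to \<open>N\<close>. For an algebraic
    coordinate only exponents below the degree of its relation \<open>p v\<close> occur, since
    higher powers can be rewritten. So \<open>card (E N)\<close> is a constant times the power
    \<open>card B\<close> of \<open>N + 1\<close>.\<close>
  define E where "E N = PiE UNIV (\<lambda>v. if v \<in> B then {..N} else {..<degree (p v)})" for N
  define mono where "mono e = (\<Prod>v\<in>UNIV. X v ^ e v :: ('v, 'k) pfun)" for e :: "'v \<Rightarrow> nat"
  define V where "V N = {x. \<exists>c. x - (\<Sum>e\<in>E N. cst (c e) * mono e) \<in> P}" for N
  \<comment> \<open>Multiplication by \<open>f\<close> raises the filtration \<open>V\<close> by at
    most \<open>D\<close>, uniformly in \<open>N\<close>. Uniformity is what makes the bounds add up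
    under products.\<close>
  define bd where "bd D f \<longleftrightarrow> (\<forall>N. \<forall>x\<in>V N. f * x \<in> V (N + D))" for D f
  have finE: "finite (E N)" for N unfolding E_def by (rule finite_PiE) auto
  have E_iff: "e \<in> E N \<longleftrightarrow> (\<forall>v\<in>B. e v \<le> N) \<and> (\<forall>v. v \<notin> B \<longrightarrow> e v < degree (p v))" for e N
    by (auto simp: E_def PiE_iff split: if_splits)
  have E_mono: "E N \<subseteq> E N'" if "N \<le> N'" for N N'
    using that by (force simp: E_iff)
  have V_mono: "V N \<subseteq> V N'" if "N \<le> N'" for N N'
  proof
    fix x assume "x \<in> V N"
    then obtain c where c: "x - (\<Sum>e\<in>E N. cst (c e) * mono e) \<in> P" by (auto simp: V_def)
    let ?c = "\<lambda>e. if e \<in> E N then c e else 0"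
    have "(\<Sum>e\<in>E N'. cst (?c e) * mono e) = (\<Sum>e\<in>E N. cst (c e) * mono e)"
      by (rule sum.mono_neutral_cong_right) (use E_mono[OF that] finE in auto)
    then show "x \<in> V N'" unfolding V_def using c by (intro CollectI exI[of _ ?c]) simp
  qed
  have P_V: "x \<in> V N" if "x \<in> P" for x N
    unfolding V_def using that by (intro CollectI exI[of _ "\<lambda>_. 0"]) simp
  have mono_V: "mono e \<in> V N" if "e \<in> E N" for e N
  proof -
    have "(\<Sum>e'\<in>E N. cst (if e' = e then 1 else 0) * mono e') = (\<Sum>e'\<in>{e}. mono e')"
      by (rule sum.mono_neutral_cong_right) (use that finE in auto)
    then show ?thesis unfolding V_def
      by (intro CollectI exI[of _ "\<lambda>e'. if e' = e then 1 else 0"]) (simp add: ideal_0[OF Id])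
  qed
  have V_add: "x + y \<in> V N" if xy: "x \<in> V N" "y \<in> V N" for x y N
  proof -
    obtain c d where cd: "x - (\<Sum>e\<in>E N. cst (c e) * mono e) \<in> P" "y - (\<Sum>e\<in>E N. cst (d e) * mono e) \<in> P"
      using xy by (auto simp: V_def)
    have "(\<Sum>e\<in>E N. cst (c e + d e) * mono e) = (\<Sum>e\<in>E N. cst (c e) * mono e) + (\<Sum>e\<in>E N. cst (d e) * mono e)"
      by (rule pfun_eqI) (simp add: algebra_simps sum.distrib)
    then have "x + y - (\<Sum>e\<in>E N. cst (c e + d e) * mono e) \<in> P"
      using ideal_add[OF Id cd] by (simp add: algebra_simps)
    then show ?thesis unfolding V_def by (intro CollectI exI[of _ "\<lambda>e. c e + d e"])
  qed
  have V_scale: "cst k * x \<in> V N" if x: "x \<in> V N" for x k N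
  proof -
    obtain c where c: "x - (\<Sum>e\<in>E N. cst (c e) * mono e) \<in> P" using x by (auto simp: V_def)
    have "cst k * (x - (\<Sum>e\<in>E N. cst (c e) * mono e)) = cst k * x - (\<Sum>e\<in>E N. cst (k * c e) * mono e)"
      by (rule pfun_eqI) (simp add: algebra_simps sum_distrib_left)
    then have "cst k * x - (\<Sum>e\<in>E N. cst (k * c e) * mono e) \<in> P" using ideal_mult[OF Id c] by metis
    then show ?thesis unfolding V_def by (intro CollectI exI[of _ "\<lambda>e. k * c e"])
  qed
  have V_0: "0 \<in> V N" for N by (rule P_V[OF ideal_0[OF Id]])
  have V_sum: "(\<And>i. i \<in> S \<Longrightarrow> f i \<in> V N) \<Longrightarrow> sum f S \<in> V N" for S N and f :: "'z \<Rightarrow> _"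
    by (induction S rule: infinite_finite_induct) (auto intro: V_0 V_add)
  have bd_basis: "bd D f" if f: "\<And>N e. e \<in> E N \<Longrightarrow> f * mono e \<in> V (N + D)" for D f
    unfolding bd_def
  proof (intro allI ballI)
    fix N x assume "x \<in> V N"
    then obtain c where c: "x - (\<Sum>e\<in>E N. cst (c e) * mono e) \<in> P" by (auto simp: V_def)
    have "f * x = f * (x - (\<Sum>e\<in>E N. cst (c e) * mono e)) + (\<Sum>e\<in>E N. cst (c e) * (f * mono e))"
      by (rule pfun_eqI) (simp add: algebra_simps sum_distrib_left)
    also have "\<dots> \<in> V (N + D)"
      by (intro V_add V_sum V_scale f P_V ideal_mult[OF Id c])
    finally show "f * x \<in> V (N + D)" .
  qed
  have bd_mono: "bd D f \<Longrightarrow> D \<le> D' \<Longrightarrow> bd D' f" for D D' f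
    unfolding bd_def by (meson V_mono add_left_mono subsetD)
  have bd_mult: "bd D f \<Longrightarrow> bd D' h \<Longrightarrow> bd (D + D') (f * h)" for D D' f h
    unfolding bd_def by (metis add.assoc add.commute mult.assoc)
  have bd_add: "bd D f \<Longrightarrow> bd D h \<Longrightarrow> bd D (f + h)" for D f h
    unfolding bd_def by (auto simp: distrib_right intro: V_add)
  have bd_cst: "bd 0 (cst k)" for k unfolding bd_def by (auto intro: V_scale)
  have bd_1: "bd 0 1" using bd_cst[of 1] by simp
  have bd_power: "bd D f \<Longrightarrow> bd (n * D) (f ^ n)" for D f n
    by (induction n) (auto simp: bd_1 intro: bd_mult)
  have bd_prod: "finite S \<Longrightarrow> (\<And>i. i \<in> S \<Longrightarrow> bd D (f i)) \<Longrightarrow> bd (card S * D) (prod f S)"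
    for S D and f :: "'z \<Rightarrow> _"
    by (induction S rule: finite_induct) (auto simp: bd_1 intro: bd_mult)
  have mono_upd: "mono (e(v := n)) = X v ^ n * mono (e(v := 0))" for e v n
    unfolding mono_def by (subst (1 2) prod.remove[of UNIV v]) (auto intro!: arg_cong2[of _ _ _ _ "(*)"] prod.cong)
  have X_mono: "X v * mono e = mono (e(v := Suc (e v)))" for e v
    using mono_upd[of e v "e v"] mono_upd[of e v "Suc (e v)"] by (simp add: mult_ac)
  have bd_pfun_in: "\<exists>D. bd D f" if "f \<in> pfun_in B" for f
    using that
  proof (induction rule: pfun_in.induct)
    case (const c)
    then show ?case using bd_cst by blast
  next
    case (var v)
    have "bd 1 (X v)"
      by (rule bd_basis) (use var in \<open>auto simp: X_mono E_iff le_SucI intro!: mono_V\<close>)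
    then show ?case by blast
  next
    case (add f h)
    then show ?case by (metis bd_add bd_mono le_add1 le_add2)
  next
    case (mult f h)
    then show ?case using bd_mult by blast
  qed
  \<comment> \<open>The relations \<open>p v\<close> are not monic; one factor \<open>u\<close>
    supplies the leading coefficient of any one of them, and \<open>u\<close> itself involves only
    \<open>B\<close>.\<close>
  define u where "u = (\<Prod>v\<in>- B. lead_coeff (p v))"
  have uB: "u \<in> pfun_in B" unfolding u_def using p(1) by (intro pfun_in_prod coeffs_in_coeff) auto
  have uP: "u \<notin> P" using prime_ideal_prod[OF _ P, of "- B" "\<lambda>v. lead_coeff (p v)"] p(2) by (auto simp: u_def)
  have bd_uX: "\<exists>D. bd D (u * X v)" for v
  proof (cases "v \<in> B")
    case True
    then show ?thesis using bd_pfun_in uB pfun_in.mult pfun_in.var by metis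
  next
    case v: False
    let ?m = "degree (p v)"
    define u' where "u' = (\<Prod>w\<in>- B - {v}. lead_coeff (p w))"
    have u': "u' \<in> pfun_in B" unfolding u'_def using p(1) by (intro pfun_in_prod coeffs_in_coeff) auto
    have u_eq: "u = lead_coeff (p v) * u'"
      unfolding u_def u'_def using v by (subst prod.remove[of _ v]) auto
    have "\<exists>D. \<forall>i. bd (D i) (u' * coeff (p v) i)"
      by (intro choice allI bd_pfun_in pfun_in.mult u' coeffs_in_coeff[OF p(1)[OF v]])
    then obtain D1 where D1: "\<And>i. bd (D1 i) (u' * coeff (p v) i)" by blast
    obtain D2 where D2: "bd D2 u" using bd_pfun_in uB by blast
    let ?D = "D2 + (\<Sum>i<?m. D1 i)"
    have "bd ?D (u * X v)"
    proof (rule bd_basis)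
      fix N e assume e: "e \<in> E N"
      show "u * X v * mono e \<in> V (N + ?D)"
      proof (cases "Suc (e v) < ?m")
        case True
        then have "mono (e(v := Suc (e v))) \<in> V N"
          using e v by (intro mono_V) (auto simp: E_iff)
        moreover have "bd ?D u" using D2 by (rule bd_mono) simp
        ultimately show ?thesis using X_mono by (simp add: bd_def mult.assoc)
      next
        case False
        \<comment> \<open>The exponent has just reached the degree of the relation, so the top power
          of \<open>X v\<close>, multiplied by its leading coefficient, is replaced by lower powers
          modulo \<open>P\<close>.\<close>
        then have m: "Suc (e v) = ?m" using e v by (auto simp: E_iff)
        let ?e = "e(v := 0)"
        have "mono (e(v := Suc (e v))) = X v ^ ?m * mono ?e" by (metis m mono_upd)
        moreover have sum_eq: "(\<Sum>i<?m. u' * coeff (p v) i * mono (e(v := i)))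
            = (\<Sum>i<?m. u' * coeff (p v) i * (X v ^ i * mono ?e))"
          by (simp only: mono_upd[symmetric])
        ultimately have "u * X v * mono e = u' * mono ?e * (lead_coeff (p v) * X v ^ ?m)"
          using X_mono[of v e] by (simp add: u_eq mult_ac)
        also have "lead_coeff (p v) * X v ^ ?m = poly (p v) (X v) - (\<Sum>i<?m. coeff (p v) i * X v ^ i)"
          by (simp add: poly_altdef lessThan_Suc_atMost[symmetric])
        also have "u' * mono ?e * \<dots> = u' * mono ?e * poly (p v) (X v)
            + cst (-1) * (\<Sum>i<?m. u' * coeff (p v) i * mono (e(v := i)))"
          unfolding sum_eq by (rule pfun_eqI) (simp add: algebra_simps sum_distrib_left sum_negf)
        also have "\<dots> \<in> V (N + ?D)"
        proof (rule V_add, use ideal_mult[OF Id p(3)[OF v]] in \<open>rule P_V\<close>, intro V_scale V_sum)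
          fix i assume i: "i \<in> {..<?m}"
          have "D1 i \<le> ?D" using i by (simp add: member_le_sum trans_le_add2)
          then have "bd ?D (u' * coeff (p v) i)" using D1 bd_mono by blast
          moreover have "mono (e(v := i)) \<in> V N" using e v i by (intro mono_V) (auto simp: E_iff)
          ultimately show "u' * coeff (p v) i * mono (e(v := i)) \<in> V (N + ?D)" by (simp add: bd_def)
        qed
        finally show ?thesis .
      qed
    qed
    then show ?thesis by blast
  qed
  have bd_upow: "\<exists>D. bd D (u ^ n)" for n using bd_pfun_in uB bd_power by blast
  have bd_all: "\<exists>L D. bd D (u ^ L * f)" for f
  proof -
    have "f \<in> pfun_in UNIV" by simp
    then show ?thesis
    proof (induction rule: pfun_in.induct)
      case (const c)
      have "bd 0 (u ^ 0 * cst c)" using bd_cst by simp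
      then show ?case by blast
    next
      case (var v)
      obtain D where "bd D (u ^ 1 * X v)" using bd_uX by auto
      then show ?case by blast
    next
      case (add f h)
      then obtain L D L' D' where *: "bd D (u ^ L * f)" "bd D' (u ^ L' * h)" by blast
      obtain D1 D2 where "bd D1 (u ^ L)" "bd D2 (u ^ L')" using bd_upow by blast
      then have "bd (D2 + D) (u ^ L' * (u ^ L * f))" "bd (D1 + D') (u ^ L * (u ^ L' * h))"
        using * bd_mult by auto
      then have "bd (D2 + D + (D1 + D')) (u ^ L' * (u ^ L * f) + u ^ L * (u ^ L' * h))"
        by (intro bd_add) (auto elim: bd_mono)
      then have "bd (D2 + D + (D1 + D')) (u ^ (L + L') * (f + h))"
        by (simp add: power_add algebra_simps)
      then show ?case by blast
    next
      case (mult f h)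
      then obtain L D L' D' where *: "bd D (u ^ L * f)" "bd D' (u ^ L' * h)" by blast
      then have "bd (D + D') (u ^ L * f * (u ^ L' * h))" by (rule bd_mult)
      then have "bd (D + D') (u ^ (L + L') * (f * h))" by (simp add: power_add mult_ac)
      then show ?case by blast
    qed
  qed
  \<comment> \<open>A common power of \<open>u\<close> and a common bound for the whole family, and
    for that power of \<open>u\<close> by itself, because it also serves as padding below.\<close>
  have "\<exists>L D. bd D (u ^ L) \<and> (\<forall>i\<in>J. bd D (u ^ L * \<phi> i))" if "finite J" for J
    using that
  proof (induction J rule: finite_induct)
    case empty
    then show ?case using bd_upow by auto
  next
    case (insert j J)
    then obtain L D where LD: "bd D (u ^ L)" "\<forall>i\<in>J. bd D (u ^ L * \<phi> i)" by blast
    obtain L' D' where LD': "bd D' (u ^ L' * \<phi> j)" using bd_all by blast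
    obtain D2 where D2: "bd D2 (u ^ L')" using bd_upow by blast
    let ?D = "D + D' + D2"
    have "bd ?D (u ^ (L + L'))"
      using bd_mono[OF bd_mult[OF LD(1) D2], of ?D] by (simp add: power_add)
    moreover have "bd ?D (u ^ (L + L') * \<phi> j)"
      using bd_mono[OF bd_mult[OF LD(1) LD'], of ?D] by (simp add: power_add mult_ac)
    moreover have "bd ?D (u ^ (L + L') * \<phi> i)" if "i \<in> J" for i
      using bd_mono[OF bd_mult[OF D2 LD(2)[rule_format, OF that]], of ?D]
      by (simp add: power_add mult_ac)
    ultimately show ?case by (intro exI[of _ "L + L'"] exI[of _ ?D]) auto
  qed
  from this[OF I(1)] obtain L D where L: "bd D (u ^ L)" and LD: "\<And>i. i \<in> I \<Longrightarrow> bd D (u ^ L * \<phi> i)"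
    by auto
  define C where "C = card I * D"
  have zeroV: "mono (\<lambda>_. 0) \<in> V 0" by (rule mono_V) (use p in \<open>auto simp: E_iff\<close>)
  have bound: "(N + 1) ^ card I \<le> card (E (C * N))" for N
  proof (rule ccontr)
    assume neg: "\<not> (N + 1) ^ card I \<le> card (E (C * N))"
    define J where "J = I \<rightarrow>\<^sub>E {..N}"
    have cJ: "card J = (N + 1) ^ card I" using I(1) by (simp add: J_def card_PiE)
    have finJ: "finite J" using I(1) by (auto simp: J_def intro: finite_PiE)
    \<comment> \<open>Every factor receives \<open>u ^ (L * N)\<close> whatever its exponent:
      \<open>e i\<close> copies of \<open>u ^ L\<close> accompany \<phi> and the other
      \<open>N - e i\<close> are padding. All monomials thus carry the same multiplier, which is
      outside \<open>P\<close> and can be cancelled from a linear relation.\<close>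
    let ?T = "u ^ (L * N * card I)"
    have inV: "?T * (\<Prod>i\<in>I. \<phi> i ^ e i) \<in> V (C * N)" if e: "e \<in> J" for e
    proof -
      have f: "u ^ (L * N) * \<phi> i ^ e i = (u ^ L) ^ (N - e i) * (u ^ L * \<phi> i) ^ e i" if "i \<in> I" for i
      proof -
        have "e i \<le> N" using e that by (auto simp: J_def)
        then have "(u ^ L) ^ N = (u ^ L) ^ (N - e i) * (u ^ L) ^ e i" by (metis le_add_diff_inverse2 power_add)
        then show ?thesis by (simp add: power_mult power_mult_distrib mult_ac)
      qed
      have "bd (N * D) (u ^ (L * N) * \<phi> i ^ e i)" if i: "i \<in> I" for i
      proof -
        have "e i \<le> N" using e that by (auto simp: J_def)
        then have "(N - e i) * D + e i * D = N * D" by (metis add_mult_distrib le_add_diff_inverse2)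
        then show ?thesis unfolding f[OF i] by (metis bd_mult bd_power L LD[OF i])
      qed
      then have "bd (card I * (N * D)) (\<Prod>i\<in>I. u ^ (L * N) * \<phi> i ^ e i)"
        by (intro bd_prod I(1))
      moreover have "(\<Prod>i\<in>I. u ^ (L * N) * \<phi> i ^ e i) = ?T * (\<Prod>i\<in>I. \<phi> i ^ e i)"
        by (simp add: prod.distrib power_mult)
      ultimately have "bd (card I * (N * D)) (?T * (\<Prod>i\<in>I. \<phi> i ^ e i))" by simp
      then have "?T * (\<Prod>i\<in>I. \<phi> i ^ e i) * mono (\<lambda>_. 0) \<in> V (0 + card I * (N * D))"
        using zeroV unfolding bd_def by blast
      then show ?thesis by (simp add: mono_def C_def mult_ac)
    qed
    then have "\<forall>e\<in>J. \<exists>c. ?T * (\<Prod>i\<in>I. \<phi> i ^ e i) - (\<Sum>b\<in>E (C * N). cst (c b) * mono b) \<in> P"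
      by (auto simp: V_def)
    from bchoice[OF this] obtain M where M: "\<And>e. e \<in> J \<Longrightarrow>
        ?T * (\<Prod>i\<in>I. \<phi> i ^ e i) - (\<Sum>b\<in>E (C * N). cst (M e b) * mono b) \<in> P"
      by auto
    obtain c where c: "\<exists>e\<in>J. c e \<noteq> 0" "\<And>b. b \<in> E (C * N) \<Longrightarrow> (\<Sum>e\<in>J. c e * M e b) = 0"
      using homogeneous_system_nontrivial_solution[OF finE finJ, of "C * N" M] neg cJ by auto
    define F where "F = (\<Sum>e\<in>J. cst (c e) * (\<Prod>i\<in>I. X i ^ e i))"
    have FI: "F \<in> pfun_in I" unfolding F_def by (intro pfun_in_sum pfun_in.mult pfun_in.const pfun_in_prod pfun_in_power pfun_in.var)
    have "?T * pcomp F \<phi> = (\<Sum>e\<in>J. cst (c e) * (?T * (\<Prod>i\<in>I. \<phi> i ^ e i)))"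
      by (rule pfun_eqI) (simp add: F_def sum_distrib_left mult_ac)
    also have "\<dots> = (\<Sum>e\<in>J. cst (c e) * (?T * (\<Prod>i\<in>I. \<phi> i ^ e i) - (\<Sum>b\<in>E (C * N). cst (M e b) * mono b)))
        + (\<Sum>e\<in>J. cst (c e) * (\<Sum>b\<in>E (C * N). cst (M e b) * mono b))"
      by (simp add: algebra_simps sum.distrib sum_subtractf)
    also have "(\<Sum>e\<in>J. cst (c e) * (\<Sum>b\<in>E (C * N). cst (M e b) * mono b))
        = (\<Sum>b\<in>E (C * N). cst (\<Sum>e\<in>J. c e * M e b) * mono b)"
      by (rule pfun_eqI) (simp add: sum_distrib_left sum_distrib_right mult.assoc sum.swap[of _ J])
    also have "\<dots> = 0" by (simp add: c(2))
    finally have "?T * pcomp F \<phi> = (\<Sum>e\<in>J. cst (c e) * (?T * (\<Prod>i\<in>I. \<phi> i ^ e i) - (\<Sum>b\<in>E (C * N). cst (M e b) * mono b)))"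
      by simp
    also have "\<dots> \<in> P" by (intro ideal_sum[OF Id] ideal_mult[OF Id] M)
    finally have "pcomp F \<phi> \<in> P" using prime_idealD(3)[OF P] prime_ideal_power[OF P] uP by metis
    then have "F = 0" using I(2) FI by (auto simp: indep_def)
    then have "(\<Sum>e\<in>J. c e * (\<Prod>i\<in>I. a i ^ e i)) = 0" for a
    proof -
      have "ev F a = (\<Sum>e\<in>J. c e * (\<Prod>i\<in>I. a i ^ e i))" by (simp add: F_def)
      then show ?thesis using \<open>F = 0\<close> by simp
    qed
    then have "\<forall>e\<in>J. c e = 0"
      using finJ by (intro monomials_linearly_independent[OF I(1)]) (auto simp: J_def PiE_iff)
    then show False using c(1) by blast
  qed
  define \<mu> where "\<mu> = (\<Prod>v\<in>- B. degree (p v))"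
  have cE: "card (E N) = (N + 1) ^ card B * \<mu>" for N
  proof -
    have "card (E N) = (\<Prod>v\<in>UNIV. card (if v \<in> B then {..N} else {..<degree (p v)}))"
      unfolding E_def by (simp add: card_PiE)
    also have "\<dots> = (\<Prod>v\<in>UNIV. if v \<in> B then N + 1 else degree (p v))"
      by (intro prod.cong) auto
    also have "\<dots> = (N + 1) ^ card B * \<mu>"
      by (simp add: prod.If_cases \<mu>_def)
    finally show ?thesis .
  qed
  show ?thesis
  proof (rule ccontr)
    assume "\<not> ?thesis"
    then have lt: "Suc (card B) \<le> card I" by simp
    \<comment> \<open>Chosen so that (C * N + 1) ^ card B * \<mu>, which is at most ((C + 1) * (N +
      1)) ^ card B * \<mu>, is bounded by N * (N + 1) ^ card B. One more independent function would
      require at least (N + 1) * (N + 1) ^ card B.\<close>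
    define N where "N = (C + 1) ^ card B * \<mu>"
    have "(N + 1) * (N + 1) ^ card B \<le> (N + 1) ^ card I"
      using power_increasing[OF lt, of "N + 1"] by simp
    also have "\<dots> \<le> (C * N + 1) ^ card B * \<mu>" using bound[of N] cE by simp
    also have "\<dots> \<le> ((C + 1) * (N + 1)) ^ card B * \<mu>"
      by (intro mult_right_mono power_mono) auto
    also have "\<dots> = N * (N + 1) ^ card B"
      unfolding power_mult_distrib by (subst (2) N_def) (simp only: mult_ac)
    finally show False by simp
  qed
qed

section \<open>Transcendence degree\<close>

lemma pcomp_cst [simp]: "pcomp (cst c) \<phi> = cst c"
  by (rule pfun_eqI) simp

lemma prime_ideal_cst:
  assumes "is_prime_ideal P" "cst c \<in> P" shows "c = 0"
proof (rule ccontr)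
  assume "c \<noteq> 0"
  then have "cst (inverse c) * cst c = 1" by (intro pfun_eqI) auto
  then show False
    using assms ideal_mult[OF prime_idealD(1)[OF assms(1)]] prime_idealD(2)[OF assms(1)] by metis
qed

lemma indep_empty: "is_prime_ideal P \<Longrightarrow> indep P \<phi> {}"
  using pfun_in_empty prime_ideal_cst by (fastforce simp: indep_def)

text \<open>Only sets of coordinates compete here, so the maximum is over a finite set; that
  arbitrary families of functions cannot do better is \<open>indep_card_le_trdeg\<close>.\<close>

definition trdeg :: "('v, 'k::field_char_0) pfun set \<Rightarrow> nat" where
  "trdeg P = Max {card B | B. indep P X B}"

lemma trdeg_finite: "finite {card B | B. indep P X (B :: 'v::finite set)}"
  by (rule finite_subset[of _ "card ` UNIV"]) auto

lemma card_le_trdeg: "indep P X (B :: 'v::finite set) \<Longrightarrow> card B \<le> trdeg P"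
  unfolding trdeg_def by (rule Max_ge[OF trdeg_finite]) auto

lemma trdeg_witness:
  fixes P :: "('v::finite, 'k::field_char_0) pfun set"
  assumes "is_prime_ideal P"
  obtains B where "indep P X B" "card B = trdeg P"
proof -
  have "trdeg P \<in> {card B | B. indep P X B}"
    unfolding trdeg_def using indep_empty[OF assms] by (intro Max_in[OF trdeg_finite]) auto
  then show ?thesis using that by auto
qed

lemma indep_card_le_trdeg:
  fixes P :: "('v::finite, 'k::field_char_0) pfun set"
  assumes P: "is_prime_ideal P" and I: "finite I" "indep P \<phi> I"
  shows "card I \<le> trdeg P"
proof -
  obtain B where B: "indep P X B" "card B = trdeg P" using trdeg_witness[OF P] by blast
  have "\<not> indep P X (insert v B)" if "v \<notin> B" for v
    using card_le_trdeg[of P "insert v B"] B(2) that by auto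
  then show ?thesis using indep_card_le[OF P B(1) _ I] B(2) by simp
qed

text \<open>A coordinate family \<open>B\<close> independent modulo \<open>Q\<close>, together with
  one \<open>h\<close> in \<open>Q\<close> but not in \<open>P\<close>, is independent modulo
  \<open>P\<close>. In a relation the constant term with respect to \<open>h\<close> lies in
  \<open>Q\<close>, hence is zero; then \<open>h\<close> cancels by primality and the argument
  repeats. The index \<open>None\<close> stands for \<open>h\<close>.\<close>

lemma trdeg_strict_antimono:
  fixes P Q :: "('v::finite, 'k::field_char_0) pfun set"
  assumes P: "is_prime_ideal P" and Q: "is_prime_ideal Q" and PQ: "P \<subset> Q"
  shows "trdeg Q < trdeg P"
proof -
  obtain h where h: "h \<in> Q" "h \<notin> P" using PQ by blast
  obtain B where B: "indep Q X B" "card B = trdeg Q" using trdeg_witness[OF Q] by blast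
  define \<phi> where "\<phi> = case_option h (X :: 'v \<Rightarrow> ('v, 'k) pfun)"
  have base: "c = 0" if c: "c \<in> pfun_in (Some ` B)" "pcomp c \<phi> \<in> Q" for c
  proof -
    let ?c = "pcomp c (\<lambda>o'. X (the o')) :: ('v, 'k) pfun"
    have eq: "pcomp c \<phi> = ?c"
      by (rule pfun_eqI) (use c(1) in \<open>auto simp: \<phi>_def intro: ev_pfun_in_cong\<close>)
    have "?c \<in> pfun_in B"
      using c(1) by (induction rule: pfun_in.induct) (auto simp: pcomp_add pcomp_mult intro: pfun_in.intros)
    then have "?c = 0" using B(1) c(2) eq by (auto simp: indep_X)
    have "ev c a = 0" for a
    proof -
      have "ev c a = ev ?c (\<lambda>v. a (Some v))"
        using c(1) by (auto intro: ev_pfun_in_cong)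
      then show ?thesis using \<open>?c = 0\<close> by simp
    qed
    then show ?thesis by (intro pfun_eqI) simp
  qed
  have poly: "G \<in> coeffs_in (Some ` B) \<Longrightarrow> pcomp (poly G (X None)) \<phi> \<in> P \<Longrightarrow> G = 0" for G
  proof (induction G)
    case (pCons c G)
    have G: "G \<in> coeffs_in (Some ` B)" "c \<in> pfun_in (Some ` B)"
      using coeffs_in_coeff[OF pCons.prems(1), of "Suc _"] coeffs_in_coeff[OF pCons.prems(1), of 0]
      by (auto simp: coeffs_in_def)
    have eq: "pcomp (poly (pCons c G) (X None)) \<phi> = pcomp c \<phi> + h * pcomp (poly G (X None)) \<phi>"
      by (simp add: pcomp_add pcomp_mult \<phi>_def)
    have "pcomp c \<phi> = pcomp (poly (pCons c G) (X None)) \<phi> - pcomp (poly G (X None)) \<phi> * h"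
      unfolding eq by (simp add: mult.commute)
    also have "\<dots> \<in> Q"
      using pCons.prems(2) PQ h by (intro ideal_diff ideal_mult prime_idealD(1)[OF Q]) auto
    finally have c: "c = 0" using base G by blast
    then have "h * pcomp (poly G (X None)) \<phi> \<in> P" using pCons.prems(2) eq by simp
    then have "G = 0" using pCons.IH G(1) h(2) prime_idealD(3)[OF P] by blast
    then show ?case using c by simp
  qed simp
  have "indep P \<phi> (insert None (Some ` B))"
    unfolding indep_def
  proof (intro ballI impI)
    fix F assume F: "F \<in> pfun_in (insert None (Some ` B))" "pcomp F \<phi> \<in> P"
    obtain G where G: "G \<in> coeffs_in (Some ` B)" "F = poly G (X None)" using pfun_in_insert_poly[OF F(1)] by blast
    then have "G = 0" using poly F(2) by blast
    then show "F = 0" using G by simp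
  qed
  then have "card (insert None (Some ` B)) \<le> trdeg P" by (intro indep_card_le_trdeg[OF P]) auto
  moreover have "card (insert None (Some ` B)) = Suc (card B)"
    by (subst card_insert_disjoint) (auto simp: card_image)
  ultimately show ?thesis using B(2) by simp
qed

lemma zset_van_subset: "P \<subseteq> van (zset P)"
  by (auto simp: van_def zset_def)

lemma van_antimono: "S \<subseteq> T \<Longrightarrow> van T \<subseteq> van S"
  by (auto simp: van_def)

context alg_closed_field
begin

text \<open>One member \<open>b\<close> of a transcendence basis is frozen at a constant. For a
  suitable constant the slice \<open>W\<close> still leaves the rest of the basis independent, and a
  prime above its vanishing ideal that avoids the nonzero functions of that rest is the required
  \<open>Q\<close>.\<close>

lemma exists_prime_above:
  fixes P :: "('v::finite, 'k) pfun set"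
  assumes P: "is_prime_ideal P" and pos: "trdeg P = Suc k"
  shows "\<exists>Q. is_prime_ideal Q \<and> P \<subset> Q \<and> k \<le> trdeg Q"
proof -
  obtain B where B: "indep P X B" "card B = trdeg P" using trdeg_witness[OF P] by blast
  obtain b where b: "b \<in> B" using B(2) pos by fastforce
  obtain u where u: "u \<in> pfun_in B" "u \<notin> P"
    "\<And>a. (\<forall>r\<in>P \<inter> pfun_in B. ev r a = 0) \<Longrightarrow> ev u a \<noteq> 0 \<Longrightarrow> \<exists>z. (\<forall>v\<in>B. z v = a v) \<and> z \<in> zset P"
    using extend_point[OF P, of "- B" B 1] prime_idealD(2)[OF P] by (auto simp: zset_def)
  have lift: "\<exists>z. (\<forall>v\<in>B. z v = a v) \<and> z \<in> zset P" if "ev u a \<noteq> 0" for a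
    using u(3) that B(1) by (force simp: indep_X)
  obtain a0 where a0: "ev u a0 \<noteq> 0"
    using u(2) ideal_0[OF prime_idealD(1)[OF P]] pfun_neq_0E by metis
  \<comment> \<open>With the value taken from a point where \<open>u\<close> is nonzero,
    \<open>u\<close> does not become identically zero when \<open>b\<close> is set to
    \<open>c\<close>; so a generic choice of the other basis coordinates still lifts to a zero of
    \<open>P\<close>.\<close>
  define c where "c = a0 b"
  define W where "W = {z \<in> zset P. z b = c}"
  let ?M = "pfun_in (B - {b}) - {0} :: ('v, 'k) pfun set"
  have "van W \<inter> ?M = {}"
  proof (rule ccontr)
    assume "van W \<inter> ?M \<noteq> {}"
    then obtain F where F: "F \<in> van W" "F \<in> pfun_in (B - {b})" "F \<noteq> 0" by blast
    let ?u = "pcomp u (X(b := cst c))"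
    have evu: "ev ?u a = ev u (a(b := c))" for a
      by (auto intro!: arg_cong[of _ _ "ev u"])
    have "ev ?u a0 \<noteq> 0" unfolding evu unfolding c_def using a0 by simp
    then have "?u \<noteq> 0" by (metis ev_0)
    \<comment> \<open>Where \<open>?u\<close> is nonzero the basis values lift to a point of
      \<open>W\<close>, on which \<open>F\<close> vanishes; \<open>F\<close> sees only those
      values.\<close>
    moreover have "F * ?u = 0"
    proof (rule pfun_eqI)
      fix a
      show "ev (F * ?u) a = ev 0 a"
      proof (cases "ev u (a(b := c)) = 0")
        case False
        then obtain z where z: "\<forall>v\<in>B. z v = (a(b := c)) v" "z \<in> zset P" using lift by blast
        then have "z \<in> W" using b by (auto simp: W_def)
        then have "ev F z = 0" using F(1) by (auto simp: van_def)
        moreover have "ev F z = ev F a" using z(1) by (intro ev_pfun_in_cong[OF F(2)]) auto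
        ultimately show ?thesis by simp
      qed (simp only: ev_mult evu, simp)
    qed
    ultimately show False using F(3) by simp
  qed
  then obtain Q where Q: "is_prime_ideal Q" "van W \<subseteq> Q" "Q \<inter> ?M = {}"
    using prime_ideal_avoiding[OF van_ideal, of ?M W] by (auto intro: pfun_in.mult)
  have "P \<subseteq> Q" using zset_van_subset[of P] van_antimono[of W "zset P"] Q(2) by (auto simp: W_def)
  moreover have "X b - cst c \<in> Q" using Q(2) by (auto simp: van_def W_def)
  moreover have "X b - cst c \<notin> P"
  proof
    assume "X b - cst c \<in> P"
    then have "X b - cst c = (0 :: ('v, 'k) pfun)"
      using B(1) b by (auto simp: indep_X intro!: pfun_in_diff pfun_in.intros)
    then have "ev (X b - cst c) (\<lambda>_. c + 1) = (0 :: 'k)" by simp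
    then show False by simp
  qed
  moreover have "indep Q X (B - {b})" using Q(3) by (auto simp: indep_X)
  then have "card (B - {b}) \<le> trdeg Q" by (rule card_le_trdeg)
  then have "k \<le> trdeg Q" using b B(2) pos by (simp add: card_Diff_singleton)
  ultimately show ?thesis using Q(1) by blast
qed

text \<open>The largest ideal comes first, so that the zero sets increase with the index as in the
  chains of \<open>kdim\<close>.\<close>

lemma prime_chain:
  fixes P :: "('v::finite, 'k) pfun set"
  assumes "is_prime_ideal P" "k \<le> trdeg P"
  shows "\<exists>C. (\<forall>i\<le>k. is_prime_ideal (C i)) \<and> C k = P \<and> (\<forall>i<k. C (Suc i) \<subset> C i)"
  using assms
proof (induction k arbitrary: P)
  case 0
  then show ?case by (intro exI[of _ "\<lambda>_. P"]) auto
next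
  case (Suc k)
  obtain m where m: "trdeg P = Suc m" "k \<le> m" using Suc.prems(2) by (cases "trdeg P") auto
  obtain Q where Q: "is_prime_ideal Q" "P \<subset> Q" "m \<le> trdeg Q"
    using exists_prime_above[OF Suc.prems(1) m(1)] by blast
  obtain C where C: "\<forall>i\<le>k. is_prime_ideal (C i)" "C k = Q" "\<forall>i<k. C (Suc i) \<subset> C i"
    using Suc.IH[OF Q(1)] m(2) Q(3) by auto
  show ?case
    using C Q Suc.prems(1) by (intro exI[of _ "C(Suc k := P)"]) (auto simp: le_Suc_eq less_Suc_eq)
qed

lemma prime_chain_length:
  fixes C :: "nat \<Rightarrow> ('v::finite, 'k) pfun set"
  assumes "\<forall>i\<le>k. is_prime_ideal (C i)" "\<forall>i<k. C (Suc i) \<subset> C i"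
  shows "k \<le> trdeg (C k)"
  using assms
proof (induction k)
  case (Suc k)
  then have "k \<le> trdeg (C k)" by simp
  also have "\<dots> < trdeg (C (Suc k))" using Suc.prems by (intro trdeg_strict_antimono) auto
  finally show ?case by simp
qed simp

end

section \<open>Krull dimension of closed sets\<close>

lemma mpeval_finite_vars:
  fixes x :: "'v::finite \<Rightarrow> 'k::comm_ring_1"
  assumes "finite S" "Poly_Mapping.keys p \<subseteq> S"
  shows "mpeval p x = (\<Sum>m\<in>S. Poly_Mapping.lookup p m * (\<Prod>v\<in>UNIV. x v ^ Poly_Mapping.lookup m v))"
proof -
  have m: "(\<Prod>v\<in>Poly_Mapping.keys m. x v ^ Poly_Mapping.lookup m v) = (\<Prod>v\<in>UNIV. x v ^ Poly_Mapping.lookup m v)"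
    for m by (rule prod.mono_neutral_left) (auto simp: in_keys_iff)
  show ?thesis
    unfolding mpeval_def m using assms by (intro sum.mono_neutral_left) (auto simp: in_keys_iff)
qed

lemma mpeval_single:
  fixes x :: "'v::finite \<Rightarrow> 'k::comm_ring_1"
  shows "mpeval (Poly_Mapping.single m c) x = c * (\<Prod>v\<in>UNIV. x v ^ Poly_Mapping.lookup m v)"
  by (subst mpeval_finite_vars[of "{m}"]) auto

lemma mpeval_0 [simp]: "mpeval 0 x = 0"
  by (simp add: mpeval_def)

lemma mpeval_add [simp]:
  fixes x :: "'v::finite \<Rightarrow> 'k::comm_ring_1"
  shows "mpeval (p + q) x = mpeval p x + mpeval q x"
proof -
  let ?S = "Poly_Mapping.keys p \<union> Poly_Mapping.keys q"
  have S: "finite ?S" "Poly_Mapping.keys (p + q) \<subseteq> ?S" using keys_add[of p q] by auto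
  show ?thesis
    unfolding mpeval_finite_vars[OF S] mpeval_finite_vars[OF S(1) Un_upper1] mpeval_finite_vars[OF S(1) Un_upper2]
    by (simp add: lookup_add algebra_simps sum.distrib)
qed

lemma poly_mapping_sum_singles:
  "(\<Sum>m\<in>Poly_Mapping.keys p. Poly_Mapping.single m (Poly_Mapping.lookup p m)) = p"
  by (rule poly_mapping_eqI) (auto simp: lookup_sum lookup_single when_def in_keys_iff)

lemma mpoly_induct [case_names zero single add]:
  fixes p :: "'a \<Rightarrow>\<^sub>0 'b::comm_monoid_add"
  assumes "Q 0" "\<And>m c. Q (Poly_Mapping.single m c)" "\<And>p q. Q p \<Longrightarrow> Q q \<Longrightarrow> Q (p + q)"
  shows "Q p"
proof -
  have "Q (\<Sum>m\<in>S. Poly_Mapping.single m (Poly_Mapping.lookup p m))" for S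
    by (induction S rule: infinite_finite_induct) (auto intro: assms)
  then show ?thesis using poly_mapping_sum_singles by metis
qed

lemma mpeval_mult [simp]:
  fixes x :: "'v::finite \<Rightarrow> 'k::comm_ring_1"
  shows "mpeval (p * q) x = mpeval p x * mpeval q x"
proof (induction p rule: mpoly_induct)
  case (single m c)
  show ?case
  proof (induction q rule: mpoly_induct)
    case (single m' c')
    show ?case
      by (simp add: mult_single mpeval_single lookup_add power_add prod.distrib mult_ac)
  qed (auto simp: algebra_simps)
qed (auto simp: algebra_simps)

lemma mpeval_const [simp]:
  fixes x :: "'v::finite \<Rightarrow> 'k::comm_ring_1" shows "mpeval (mpconst c) x = c"
  by (simp add: mpconst_def mpeval_single)

lemma mpeval_1 [simp]:
  fixes x :: "'v::finite \<Rightarrow> 'k::comm_ring_1" shows "mpeval 1 x = 1"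
  using mpeval_const[of 1 x] by (simp add: mpconst_def)

lemma mpeval_var [simp]:
  fixes x :: "'v::finite \<Rightarrow> 'k::comm_ring_1" shows "mpeval (mpvar v) x = x v"
proof -
  have "(\<Prod>w\<in>UNIV. x w ^ Poly_Mapping.lookup (Poly_Mapping.single v 1) w) = (\<Prod>w\<in>{v}. x w)"
    by (rule prod.mono_neutral_cong_right) (auto simp: lookup_single when_def)
  then show ?thesis by (simp add: mpvar_def mpeval_single)
qed

lemma mpeval_uminus [simp]:
  fixes x :: "'v::finite \<Rightarrow> 'k::comm_ring_1" shows "mpeval (- p) x = - mpeval p x"
  using mpeval_add[of p "- p" x] by (simp add: eq_neg_iff_add_eq_0 add.commute)

lemma mpeval_diff [simp]:
  fixes x :: "'v::finite \<Rightarrow> 'k::comm_ring_1" shows "mpeval (p - q) x = mpeval p x - mpeval q x"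
  using mpeval_add[of p "- q" x] by simp

lemma mpeval_sum [simp]:
  fixes x :: "'v::finite \<Rightarrow> 'k::comm_ring_1" shows "mpeval (sum f S) x = (\<Sum>i\<in>S. mpeval (f i) x)"
  by (induction S rule: infinite_finite_induct) auto

lemma mpeval_prod [simp]:
  fixes x :: "'v::finite \<Rightarrow> 'k::comm_ring_1" shows "mpeval (prod f S) x = (\<Prod>i\<in>S. mpeval (f i) x)"
  by (induction S rule: infinite_finite_induct) auto

lemma mpeval_power [simp]:
  fixes x :: "'v::finite \<Rightarrow> 'k::comm_ring_1" shows "mpeval (p ^ n) x = mpeval p x ^ n"
  by (induction n) auto

lemma mpeval_of_nat [simp]:
  fixes x :: "'v::finite \<Rightarrow> 'k::comm_ring_1" shows "mpeval (of_nat n) x = of_nat n"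
  by (induction n) auto

lemma mpeval_of_int [simp]:
  fixes x :: "'v::finite \<Rightarrow> 'k::comm_ring_1" shows "mpeval (of_int n) x = of_int n"
  by (cases n) auto

lemma mpeval_in_polyfun:
  fixes p :: "('v::finite, 'k::field_char_0) mpoly" shows "mpeval p \<in> polyfun"
proof -
  have sum: "(\<And>i. i \<in> S \<Longrightarrow> h i \<in> polyfun) \<Longrightarrow> (\<lambda>x. \<Sum>i\<in>S. h i x) \<in> polyfun"
    for S :: "'i set" and h :: "'i \<Rightarrow> ('v \<Rightarrow> 'k) \<Rightarrow> 'k"
    by (induction S rule: infinite_finite_induct) (auto intro: polyfun.intros)
  have prod: "(\<And>i. i \<in> S \<Longrightarrow> h i \<in> polyfun) \<Longrightarrow> (\<lambda>x. \<Prod>i\<in>S. h i x) \<in> polyfun"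
    for S :: "'i set" and h :: "'i \<Rightarrow> ('v \<Rightarrow> 'k) \<Rightarrow> 'k"
    by (induction S rule: infinite_finite_induct) (auto intro: polyfun.intros)
  have power: "h \<in> polyfun \<Longrightarrow> (\<lambda>x. h x ^ n) \<in> polyfun" for h :: "('v \<Rightarrow> 'k) \<Rightarrow> 'k" and n
    by (induction n) (auto intro: polyfun.intros)
  show ?thesis
    unfolding mpeval_finite_vars[OF finite_keys order_refl]
    by (intro sum polyfun.mult polyfun.const prod power polyfun.var)
qed

definition mp :: "('v::finite, 'k::field_char_0) mpoly \<Rightarrow> ('v, 'k) pfun" where
  "mp p = Abs_pfun (mpeval p)"

lemma ev_mp [simp]: "ev (mp p) x = mpeval p x"
  by (simp add: mp_def Abs_pfun_inverse mpeval_in_polyfun)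

lemma mp_surj: "\<exists>p. mp p = q"
proof -
  have "q \<in> pfun_in UNIV" by simp
  then show ?thesis
  proof (induction rule: pfun_in.induct)
    case (const c)
    then show ?case by (intro exI[of _ "mpconst c"] pfun_eqI) simp
  next
    case (var v)
    then show ?case by (intro exI[of _ "mpvar v"] pfun_eqI) simp
  next
    case (add p q)
    then obtain p' q' where "mp p' = p" "mp q' = q" by blast
    then show ?case by (intro exI[of _ "p' + q'"] pfun_eqI) auto
  next
    case (mult p q)
    then obtain p' q' where "mp p' = p" "mp q' = q" by blast
    then show ?case by (intro exI[of _ "p' * q'"] pfun_eqI) auto
  qed
qed

lemma mpeval_eq_0_imp:
  fixes p :: "('v::finite, 'k::field_char_0) mpoly"
  assumes "\<And>x. mpeval p x = 0"
  shows "p = 0"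
proof -
  let ?L = "Poly_Mapping.lookup :: ('v \<Rightarrow>\<^sub>0 nat) \<Rightarrow> 'v \<Rightarrow> nat"
  let ?S = "?L ` Poly_Mapping.keys p"
  let ?c = "\<lambda>e. Poly_Mapping.lookup p (Abs_poly_mapping e)"
  have inj: "inj_on ?L (Poly_Mapping.keys p)" by (simp add: inj_on_def)
  have "(\<Sum>e\<in>?S. ?c e * (\<Prod>v\<in>UNIV. x v ^ e v)) = 0" for x
    using assms[of x] unfolding sum.reindex[OF inj]
    by (simp add: mpeval_finite_vars[OF finite_keys order_refl] lookup_inverse)
  then have "\<forall>e\<in>?S. ?c e = 0"
    by (intro monomials_linearly_independent[of UNIV]) auto
  then show ?thesis by (intro poly_mapping_eqI) (auto simp: lookup_inverse in_keys_iff)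
qed

lemma mp_inject: "mp p = mp q \<longleftrightarrow> p = q"
proof
  assume "mp p = mp q"
  then have "mpeval (p - q) x = 0" for x by (metis ev_mp mpeval_diff right_minus_eq)
  then show "p = q" using mpeval_eq_0_imp[of "p - q"] by simp
qed simp

lemma mp_mult: "mp (p * q) = mp p * mp q" and mp_1: "mp 1 = 1" and mp_0: "mp 0 = 0"
  by (rule pfun_eqI; simp)+

lemma mp_dvd_iff: "mp p dvd mp q \<longleftrightarrow> p dvd q"
  unfolding dvd_def by (metis mp_mult mp_surj mp_inject)

lemma irreducible_mp:
  assumes "irreducible p" shows "irreducible (mp p)"
proof (rule irreducibleI)
  show "mp p \<noteq> 0" using assms by (metis irreducible_def mp_0 mp_inject)
  show "\<not> mp p dvd 1" using assms by (metis irreducible_def mp_1 mp_dvd_iff)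
  fix a b assume ab: "mp p = a * b"
  obtain a' b' where "mp a' = a" "mp b' = b" using mp_surj by metis
  then show "a dvd 1 \<or> b dvd 1" using ab assms by (metis irreducibleD mp_1 mp_dvd_iff mp_inject mp_mult)
qed

section \<open>Zariski closed sets and their vanishing ideals\<close>

lemma zclosed_iff_zset: "zclosed S \<longleftrightarrow> (\<exists>Q. S = zset Q)" for S :: "('v::finite \<Rightarrow> 'k::field_char_0) set"
proof
  assume "zclosed S"
  then obtain Q where "S = {x. \<forall>p\<in>Q. mpeval p x = 0}" by (auto simp: zclosed_def)
  then have "S = zset (mp ` Q)" by (auto simp: zset_def)
  then show "\<exists>Q. S = zset Q" by blast
next
  assume "\<exists>Q. S = zset Q"
  then obtain Q where "S = zset Q" by blast
  moreover have "zset Q = {x. \<forall>p\<in>mp -` Q. mpeval p x = 0}"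
  proof -
    have "mp ` (mp -` Q) = Q" using mp_surj by (metis surj_def surj_image_vimage_eq)
    then have "zset Q = zset (mp ` (mp -` Q))" by simp
    also have "\<dots> = {x. \<forall>p\<in>mp -` Q. mpeval p x = 0}" unfolding zset_def ball_simps ev_mp ..
    finally show ?thesis .
  qed
  ultimately show "zclosed S" unfolding zclosed_def by blast
qed

lemma zclosure_eq_zset: "zclosure S = zset (van S)" for S :: "('v::finite \<Rightarrow> 'k::field_char_0) set"
proof -
  have "(\<forall>p. (\<forall>y\<in>S. mpeval p y = 0) \<longrightarrow> mpeval p x = 0) \<longleftrightarrow> (\<forall>p. (\<forall>y\<in>S. ev p y = 0) \<longrightarrow> ev p x = 0)" for x
  proof
    assume *: "\<forall>p. (\<forall>y\<in>S. mpeval p y = 0) \<longrightarrow> mpeval p x = 0"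
    show "\<forall>p. (\<forall>y\<in>S. ev p y = 0) \<longrightarrow> ev p x = 0"
    proof
      fix p :: "('v, 'k) pfun"
      obtain q where "mp q = p" using mp_surj by blast
      then show "(\<forall>y\<in>S. ev p y = 0) \<longrightarrow> ev p x = 0" using * by auto
    qed
  next
    assume *: "\<forall>p. (\<forall>y\<in>S. ev p y = 0) \<longrightarrow> ev p x = 0"
    show "\<forall>p. (\<forall>y\<in>S. mpeval p y = 0) \<longrightarrow> mpeval p x = 0"
      using * by (metis ev_mp)
  qed
  then show ?thesis by (auto simp: zclosure_def zset_def van_def)
qed

lemma zset_van_zset [simp]: "zset (van (zset Q)) = zset Q"
  by (auto simp: zset_def van_def)

lemma van_zset_van [simp]: "van (zset (van S)) = van S"
  by (auto simp: zset_def van_def)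

lemma zclosed_iff: "zclosed S \<longleftrightarrow> zset (van S) = S" for S :: "('v::finite \<Rightarrow> 'k::field_char_0) set"
  by (metis zclosed_iff_zset zset_van_zset)

lemma zset_antimono: "P \<subseteq> Q \<Longrightarrow> zset Q \<subseteq> zset P"
  by (auto simp: zset_def)

lemma zirred_imp_prime:
  fixes T :: "('v::finite \<Rightarrow> 'k::field_char_0) set"
  assumes "zirred T" shows "is_prime_ideal (van T)"
  unfolding is_prime_ideal_def
proof (intro conjI van_ideal allI impI)
  show "1 \<notin> van T" using assms by (auto simp: zirred_def van_def)
  fix a b assume ab: "a * b \<in> van T"
  have "T \<subseteq> zset {a} \<union> zset {b}" using ab by (auto simp: zset_def van_def)
  then have "T \<subseteq> zset {a} \<or> T \<subseteq> zset {b}" using assms unfolding zirred_def zclosed_iff_zset by blast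
  then show "a \<in> van T \<or> b \<in> van T" by (auto simp: zset_def van_def)
qed

context alg_closed_field
begin

lemma prime_imp_zirred:
  fixes P :: "('v::finite, 'k) pfun set"
  assumes P: "is_prime_ideal P" shows "zirred (zset P)"
  unfolding zirred_def
proof (intro conjI allI impI)
  note N = nullstellensatz[OF P]
  show "zclosed (zset P)" unfolding zclosed_iff_zset by blast
  show "zset P \<noteq> {}"
  proof
    assume "zset P = {}"
    then have "1 \<in> van (zset P)" by (simp add: van_def)
    then show False using N prime_idealD(2)[OF P] by simp
  qed
  have ex: "\<exists>a\<in>van A. a \<notin> P" if "zclosed A" "\<not> zset P \<subseteq> A" for A
  proof -
    have "\<not> zset P \<subseteq> zset (van A)" using that zclosed_iff by metis
    then show ?thesis using zset_antimono by blast
  qed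
  fix A B assume AB: "zclosed A \<and> zclosed B \<and> zset P \<subseteq> A \<union> B"
  show "zset P \<subseteq> A \<or> zset P \<subseteq> B"
  proof (rule ccontr)
    assume "\<not> ?thesis"
    then obtain a b where ab: "a \<in> van A" "a \<notin> P" "b \<in> van B" "b \<notin> P" using ex AB by meson
    then have "a * b \<in> van (zset P)" using AB by (fastforce simp: van_def)
    then show False using N ab prime_idealD(3)[OF P] by blast
  qed
qed

text \<open>A family independent on \<open>S\<close> stays independent modulo some prime above
  \<open>van S\<close>, and chains of primes above that one give chains of irreducible subsets of
  \<open>S\<close>. Conversely, the top member of a longest chain is irreducible, and a
  transcendence basis of coordinates on it is independent on all of \<open>S\<close>, because
  \<open>van S\<close> is the smaller ideal.\<close>

lemma
  fixes S :: "('v::finite \<Rightarrow> 'k) set"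
  assumes S: "zclosed S" "S \<noteq> {}"
  shows indep_card_le_kdim: "finite I \<Longrightarrow> indep (van S) \<phi> I \<Longrightarrow> card I \<le> kdim S"
    and kdim_witness: "\<exists>B. indep (van S) X B \<and> card B = kdim S"
proof -
  let ?K = "{k. \<exists>C :: nat \<Rightarrow> ('v \<Rightarrow> 'k) set.
       (\<forall>i\<le>k. zirred (C i) \<and> C i \<subseteq> S) \<and> (\<forall>i<k. C i \<subset> C (Suc i))}"
  have chain_bound: "\<exists>T. zirred T \<and> T \<subseteq> S \<and> k \<le> trdeg (van T)" if k: "k \<in> ?K" for k
  proof -
    obtain C :: "nat \<Rightarrow> ('v \<Rightarrow> 'k) set" where C: "\<forall>i\<le>k. zirred (C i) \<and> C i \<subseteq> S" "\<forall>i<k. C i \<subset> C (Suc i)"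
      using k by blast
    have "van (C (Suc i)) \<subset> van (C i)" if "i < k" for i
    proof -
      have "zset (van (C i)) = C i" "zset (van (C (Suc i))) = C (Suc i)"
        using C(1) that by (auto simp: zirred_def zclosed_iff)
      then show ?thesis using C(2) that van_antimono by (metis psubset_eq psubset_imp_subset)
    qed
    then have "k \<le> trdeg (van (C k))"
      using C(1) by (intro prime_chain_length) (auto intro: zirred_imp_prime)
    then show ?thesis using C(1) by blast
  qed
  \<comment> \<open>\<open>kdim\<close> is a supremum of naturals, meaningful as a maximum only once
    the chain lengths are known to be bounded.\<close>
  have bound: "k \<le> CARD('v)" if "k \<in> ?K" for k
  proof -
    obtain T :: "('v \<Rightarrow> 'k) set" where T: "zirred T" "k \<le> trdeg (van T)" using chain_bound[OF \<open>k \<in> ?K\<close>] by blast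
    obtain B :: "'v set" where "card B = trdeg (van T)" by (rule trdeg_witness[OF zirred_imp_prime[OF T(1)]])
    then show ?thesis using T(2) by (metis card_mono finite subset_UNIV le_trans)
  qed
  then have fin: "finite ?K" by (meson finite_nat_set_iff_bounded_le)
  have mem: "card I \<in> ?K" if I: "finite I" "indep (van S) \<phi> I" for I and \<phi> :: "'i \<Rightarrow> ('v, 'k) pfun"
  proof -
    \<comment> \<open>A prime that contains \<open>van S\<close> and avoids this multiplicative set
      is one modulo which the family is still independent.\<close>
    let ?M = "{pcomp F \<phi> | F. F \<in> pfun_in I \<and> F \<noteq> 0}"
    have 1: "1 \<in> ?M" by (intro CollectI exI[of _ 1]) auto
    have mult: "a * b \<in> ?M" if ab: "a \<in> ?M" "b \<in> ?M" for a b
    proof -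
      obtain F G where "a = pcomp F \<phi>" "b = pcomp G \<phi>" "F \<in> pfun_in I" "F \<noteq> 0" "G \<in> pfun_in I" "G \<noteq> 0"
        using ab by blast
      then show ?thesis by (intro CollectI exI[of _ "F * G"]) (auto simp: pcomp_mult intro: pfun_in.mult)
    qed
    have disj: "van S \<inter> ?M = {}" using I(2) by (auto simp: indep_def)
    obtain P where P: "is_prime_ideal P" "van S \<subseteq> P" "P \<inter> ?M = {}"
      using prime_ideal_avoiding[OF van_ideal 1 mult disj] by auto
    have "indep P \<phi> I" using P(3) by (auto simp: indep_def)
    then have "card I \<le> trdeg P" by (rule indep_card_le_trdeg[OF P(1) I(1)])
    then obtain C where C: "\<forall>i\<le>card I. is_prime_ideal (C i)" "C (card I) = P"
      "\<forall>i<card I. C (Suc i) \<subset> C i" using prime_chain[OF P(1)] by blast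
    have PS: "zset P \<subseteq> S" using zset_antimono[OF P(2)] S(1) zclosed_iff by metis
    have "C (card I) \<subseteq> C i" if "i \<le> card I" for i
      using that by (induction i rule: inc_induct) (use C(3) in auto)
    then have sub: "zset (C i) \<subseteq> S" if "i \<le> card I" for i
      using zset_antimono[of P "C i"] PS C(2) that by blast
    have "zset (C i) \<subset> zset (C (Suc i))" if "i < card I" for i
    proof -
      have "van (zset (C i)) = C i" "van (zset (C (Suc i))) = C (Suc i)"
        using C(1) that by (auto intro!: nullstellensatz)
      then show ?thesis using C(3) that zset_antimono by (metis psubset_eq psubset_imp_subset)
    qed
    then show ?thesis
      using sub C(1) by (intro CollectI exI[of _ "\<lambda>i. zset (C i)"]) (auto intro: prime_imp_zirred)
  qed
  have le: "card I \<le> kdim S" if "finite I" "indep (van S) \<phi> I" for I and \<phi> :: "'i \<Rightarrow> ('v, 'k) pfun"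
    unfolding kdim_def by (rule cSup_upper[OF mem[OF that] bdd_above_finite[OF fin]])
  then show "finite I \<Longrightarrow> indep (van S) \<phi> I \<Longrightarrow> card I \<le> kdim S" by blast
  have "indep (van S) (X :: 'v \<Rightarrow> ('v, 'k) pfun) {}"
    using pfun_in_empty S(2) by (fastforce simp: indep_def van_def)
  then have "card ({} :: 'v set) \<in> ?K" using mem by blast
  then have ne: "?K \<noteq> {}" by (metis empty_iff)
  have "Sup ?K \<in> ?K" by (subst cSup_eq_Max[OF fin ne]) (rule Max_in[OF fin ne])
  then have "Sup ?K \<in> ?K \<and> kdim S = Sup ?K" by (simp only: kdim_def)
  then have "\<exists>T. zirred T \<and> T \<subseteq> S \<and> kdim S \<le> trdeg (van T)" using chain_bound by presburger
  then obtain T where T: "zirred T" "T \<subseteq> S" "kdim S \<le> trdeg (van T)" by blast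
  obtain B where B: "indep (van T) X B" "card B = trdeg (van T)"
    by (rule trdeg_witness[OF zirred_imp_prime[OF T(1)]])
  have "indep (van S) X B" using B(1) van_antimono[OF T(2)] by (rule indep_antimono)
  moreover from this have "card B \<le> kdim S" by (intro le) auto
  ultimately show "\<exists>B. indep (van S) X B \<and> card B = kdim S" using B(2) T(3) by auto
qed

end

section \<open>Unique factorisation\<close>

text \<open>The expansion of \<open>p\<close> in powers of \<open>x\<close> over the other
  coordinates; it is unique by \<open>poly_X_coeffs_in_inject\<close>, so the choice is
  determined.\<close>

definition upoly :: "'v \<Rightarrow> ('v, 'k::field_char_0) pfun \<Rightarrow> ('v, 'k) pfun poly" where
  "upoly x p = (SOME P. P \<in> coeffs_in (- {x}) \<and> p = poly P (X x))"

definition xdeg :: "'v \<Rightarrow> ('v, 'k::field_char_0) pfun \<Rightarrow> nat" where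
  "xdeg x p = degree (upoly x p)"

lemma upoly: "upoly x p \<in> coeffs_in (- {x})" "poly (upoly x p) (X x) = p"
proof -
  have "insert x (- {x}) = UNIV" by auto
  then have "p \<in> pfun_in (insert x (- {x}))" by simp
  from pfun_in_insert_poly[OF this] have "\<exists>P. P \<in> coeffs_in (- {x}) \<and> p = poly P (X x)" by blast
  from someI_ex[OF this] show "upoly x p \<in> coeffs_in (- {x})" "poly (upoly x p) (X x) = p"
    by (simp_all add: upoly_def)
qed

lemma upoly_eqI: "P \<in> coeffs_in (- {x}) \<Longrightarrow> poly P (X x) = p \<Longrightarrow> upoly x p = P"
  by (rule poly_X_coeffs_in_inject[OF upoly(1)]) (simp_all add: upoly(2))

lemma upoly_mult: "upoly x (p * q) = upoly x p * upoly x q"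
  by (rule upoly_eqI) (simp_all add: coeffs_in_mult upoly)

lemma upoly_eq_0_iff [simp]: "upoly x p = 0 \<longleftrightarrow> p = 0"
  by (metis upoly(2) upoly_eqI coeffs_in_0 poly_0)

lemma upoly_coeffs_in:
  assumes "p \<in> pfun_in (insert x A)" "x \<notin> A" shows "upoly x p \<in> coeffs_in A"
proof -
  obtain P where P: "P \<in> coeffs_in A" "p = poly P (X x)" using pfun_in_insert_poly[OF assms(1)] by blast
  have "P \<in> coeffs_in (- {x})" using coeffs_in_mono[of A "- {x}"] P(1) assms(2) by auto
  then have "upoly x p = P" using P(2) by (intro upoly_eqI) auto
  then show ?thesis using P(1) by simp
qed

lemma xdeg_mult: "p \<noteq> 0 \<Longrightarrow> q \<noteq> 0 \<Longrightarrow> xdeg x (p * q) = xdeg x p + xdeg x q"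
  by (simp add: xdeg_def upoly_mult degree_mult_eq)

lemma upoly_const: "p \<in> pfun_in (- {x}) \<Longrightarrow> upoly x p = [:p:]"
  by (rule upoly_eqI) (simp_all add: coeffs_in_const)

lemma xdeg_eq_0: "p \<in> pfun_in A \<Longrightarrow> x \<notin> A \<Longrightarrow> xdeg x p = 0"
  using pfun_in_mono[of A "- {x}"] upoly_const[of p x] by (auto simp: xdeg_def)

lemma xdeg_eq_0_imp:
  assumes "p \<in> pfun_in A" "xdeg x p = 0" shows "p \<in> pfun_in (A - {x})"
proof -
  have "p \<in> pfun_in (insert x (A - {x}))" using assms(1) pfun_in_mono[of A "insert x (A - {x})"] by blast
  then have U: "upoly x p \<in> coeffs_in (A - {x})" by (rule upoly_coeffs_in) simp
  obtain c where c: "upoly x p = [:c:]" using assms(2) unfolding xdeg_def by (metis degree_eq_zeroE)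
  then have "p = c" using upoly(2)[of x p] by simp
  then show ?thesis using coeffs_in_coeff[OF U, of 0] c by simp
qed

lemma pfun_in_iff_xdeg:
  fixes p :: "('v::finite, 'k::field_char_0) pfun"
  shows "p \<in> pfun_in A \<longleftrightarrow> (\<forall>x. x \<notin> A \<longrightarrow> xdeg x p = 0)"
proof (intro iffI allI impI)
  assume *: "\<forall>x. x \<notin> A \<longrightarrow> xdeg x p = 0"
  have "finite S \<Longrightarrow> S \<subseteq> - A \<Longrightarrow> p \<in> pfun_in (- S)" for S
  proof (induction S rule: finite_induct)
    case (insert x S)
    then have "p \<in> pfun_in (- S - {x})" using * by (intro xdeg_eq_0_imp) auto
    moreover have "- S - {x} = - insert x S" by auto
    ultimately show ?case by simp
  qed simp
  from this[of "- A"] show "p \<in> pfun_in A" by simp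
qed (rule xdeg_eq_0)

text \<open>Degrees in each coordinate add up in a product, so a factor cannot involve a coordinate
  that the product avoids. This keeps the factorisation arguments inside the subrings used for
  induction.\<close>

lemma pfun_in_factor:
  fixes p q :: "('v::finite, 'k::field_char_0) pfun"
  assumes "p * q \<in> pfun_in A" "p * q \<noteq> 0" shows "p \<in> pfun_in A" "q \<in> pfun_in A"
proof -
  have "p \<noteq> 0" "q \<noteq> 0" using assms(2) by auto
  then show "p \<in> pfun_in A" "q \<in> pfun_in A" using assms(1) unfolding pfun_in_iff_xdeg by (simp_all add: xdeg_mult)
qed

lemma pfun_in_dvd:
  fixes p q :: "('v::finite, 'k::field_char_0) pfun"
  shows "p dvd q \<Longrightarrow> q \<in> pfun_in A \<Longrightarrow> q \<noteq> 0 \<Longrightarrow> p \<in> pfun_in A"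
  by (auto simp: dvd_def intro: pfun_in_factor)

text \<open>Like the total degree, this is additive on nonzero products and zero only on constants,
  which makes it a measure for splitting off factors.\<close>

definition sdeg :: "('v::finite, 'k::field_char_0) pfun \<Rightarrow> nat" where
  "sdeg p = (\<Sum>x\<in>UNIV. xdeg x p)"

lemma sdeg_mult: "p \<noteq> 0 \<Longrightarrow> q \<noteq> 0 \<Longrightarrow> sdeg (p * q) = sdeg p + sdeg q"
  by (simp add: sdeg_def xdeg_mult sum.distrib)

lemma pfun_in_empty_unit: "p \<in> pfun_in {} \<Longrightarrow> p \<noteq> 0 \<Longrightarrow> p dvd 1"
proof -
  assume "p \<in> pfun_in {}" "p \<noteq> 0"
  then obtain c where c: "p = cst c" "c \<noteq> 0" using pfun_in_empty by fastforce
  then have "1 = p * cst (inverse c)" by (intro pfun_eqI) simp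
  then show "p dvd 1" by (rule dvdI)
qed

lemma sdeg_eq_0_unit: "sdeg p = 0 \<Longrightarrow> p \<noteq> 0 \<Longrightarrow> p dvd 1"
  by (rule pfun_in_empty_unit) (simp_all add: pfun_in_iff_xdeg sdeg_def)

lemma exists_irreducible_factor:
  fixes p :: "('v::finite, 'k::field_char_0) pfun"
  assumes "p \<noteq> 0" "\<not> p dvd 1"
  shows "\<exists>q. irreducible q \<and> q dvd p"
  using assms
proof (induction "sdeg p" arbitrary: p rule: less_induct)
  case less
  show ?case
  proof (cases "irreducible p")
    case False
    then obtain a b where ab: "p = a * b" "\<not> a dvd 1" "\<not> b dvd 1"
      using less.prems by (auto simp: irreducible_def)
    then have nz: "a \<noteq> 0" "b \<noteq> 0" using less.prems by auto
    have "sdeg a < sdeg p" using sdeg_mult[OF nz] ab sdeg_eq_0_unit nz by fastforce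
    then obtain q where "irreducible q" "q dvd a" using less.hyps[of a] nz ab by blast
    then show ?thesis using ab(1) dvd_mult2 by blast
  qed auto
qed

text \<open>Primality tested against elements of the subring of \<open>A\<close> only. Divisibility
  is that of the whole ring, which for a divisor in the subring agrees with the one there by
  \<open>pfun_in_factor\<close>.\<close>

definition rel_prime_elem :: "'v set \<Rightarrow> ('v, 'k::field_char_0) pfun \<Rightarrow> bool" where
  "rel_prime_elem A p \<longleftrightarrow> (\<forall>a\<in>pfun_in A. \<forall>b\<in>pfun_in A. p dvd a * b \<longrightarrow> p dvd a \<or> p dvd b)"

text \<open>Gauss's lemma. \<open>p\<close> divides a function exactly if it divides all
  coefficients in \<open>x\<close>; with \<open>i\<close> and \<open>j\<close> the first
  coefficients it fails to divide, it fails to divide coefficient \<open>i + j\<close> of the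
  product.\<close>

lemma rel_prime_elem_insert:
  fixes p :: "('v::finite, 'k::field_char_0) pfun"
  assumes p: "rel_prime_elem A p" "p \<in> pfun_in A" and x: "x \<notin> A"
  shows "rel_prime_elem (insert x A) p"
  unfolding rel_prime_elem_def
proof (intro ballI impI)
  have pu: "upoly x p = [:p:]"
    using pfun_in_mono[of A "- {x}"] p(2) x by (intro upoly_const) auto
  have dvd: "p dvd q \<longleftrightarrow> (\<forall>i. p dvd coeff (upoly x q) i)" for q
  proof
    assume "p dvd q"
    then obtain w where "q = p * w" by (auto simp: dvd_def)
    then have "upoly x q = smult p (upoly x w)" by (simp add: upoly_mult pu)
    then show "\<forall>i. p dvd coeff (upoly x q) i" by simp
  next
    assume "\<forall>i. p dvd coeff (upoly x q) i"
    then have "p dvd poly (upoly x q) (X x)" unfolding poly_altdef by (intro dvd_sum) auto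
    then show "p dvd q" by (simp add: upoly)
  qed
  fix a b assume ab: "a \<in> pfun_in (insert x A)" "b \<in> pfun_in (insert x A)" "p dvd a * b"
  let ?P = "upoly x a" and ?Q = "upoly x b"
  show "p dvd a \<or> p dvd b"
  proof (rule ccontr)
    assume "\<not> ?thesis"
    then have ex: "\<exists>i. \<not> p dvd coeff ?P i" "\<exists>j. \<not> p dvd coeff ?Q j"
      using dvd[of a] dvd[of b] by simp_all
    define i where "i = (LEAST i. \<not> p dvd coeff ?P i)"
    define j where "j = (LEAST j. \<not> p dvd coeff ?Q j)"
    have i: "\<not> p dvd coeff ?P i" "\<And>k. k < i \<Longrightarrow> p dvd coeff ?P k"
      unfolding i_def using LeastI_ex[OF ex(1)] not_less_Least[of _ "\<lambda>i. \<not> p dvd coeff ?P i"] by blast+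
    have j: "\<not> p dvd coeff ?Q j" "\<And>k. k < j \<Longrightarrow> p dvd coeff ?Q k"
      unfolding j_def using LeastI_ex[OF ex(2)] not_less_Least[of _ "\<lambda>i. \<not> p dvd coeff ?Q i"] by blast+
    have "coeff (?P * ?Q) (i + j) = coeff ?P i * coeff ?Q j
        + (\<Sum>k\<in>{..i + j} - {i}. coeff ?P k * coeff ?Q (i + j - k))"
      unfolding coeff_mult by (subst sum.remove[of _ i]) auto
    moreover have "p dvd (\<Sum>k\<in>{..i + j} - {i}. coeff ?P k * coeff ?Q (i + j - k))"
    proof (rule dvd_sum)
      fix k assume k: "k \<in> {..i + j} - {i}"
      show "p dvd coeff ?P k * coeff ?Q (i + j - k)"
      proof (cases "k < i")
        case True
        then show ?thesis using i(2) by simp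
      next
        case False
        then have "i + j - k < j" using k by auto
        then show ?thesis using j(2) by simp
      qed
    qed
    moreover have "p dvd coeff (?P * ?Q) (i + j)" using ab(3) dvd[of "a * b"] by (simp add: upoly_mult)
    ultimately have "p dvd coeff ?P i * coeff ?Q j" by (simp add: dvd_add_left_iff)
    moreover have "coeff ?P i \<in> pfun_in A" "coeff ?Q j \<in> pfun_in A"
      by (intro coeffs_in_coeff upoly_coeffs_in x ab)+
    ultimately show False using p(1) i(1) j(1) by (auto simp: rel_prime_elem_def)
  qed
qed

text \<open>The irreducible factors of \<open>c\<close> are prime in the larger subring by Gauss's
  lemma, so each can be moved into \<open>r\<close> or \<open>q\<close> and cancelled there.\<close>

lemma cancel_scalar:
  fixes c g r q :: "('v::finite, 'k::field_char_0) pfun"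
  assumes IH: "\<And>p :: ('v, 'k) pfun. p \<in> pfun_in A \<Longrightarrow> irreducible p \<Longrightarrow> rel_prime_elem A p" and x: "x \<notin> A"
    and c: "c \<in> pfun_in A" "c \<noteq> 0"
    and rq: "c * g = r * q" "r \<in> pfun_in (insert x A)" "q \<in> pfun_in (insert x A)"
  shows "\<exists>c1 c2 r' q'. c = c1 * c2 \<and> r = c1 * r' \<and> q = c2 * q' \<and> g = r' * q'"
  using c rq
proof (induction "sdeg c" arbitrary: c r q rule: less_induct)
  case less
  show ?case
  proof (cases "c dvd 1")
    case True
    then obtain d where d: "1 = c * d" by (auto simp: dvd_def)
    have "r = c * (d * r)" "g = d * r * q"
      using d less.prems(3) by (metis mult.assoc mult_1, metis mult.assoc mult.commute mult_1)
    then show ?thesis by (intro exI[of _ c] exI[of _ 1] exI[of _ "d * r"] exI[of _ q]) auto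
  next
    case False
    then obtain \<pi> where pi: "irreducible \<pi>" "\<pi> dvd c" using exists_irreducible_factor less.prems by blast
    then obtain c' where c': "c = \<pi> * c'" by (auto simp: dvd_def)
    then have nz: "\<pi> \<noteq> 0" "c' \<noteq> 0" using less.prems by auto
    have A: "\<pi> \<in> pfun_in A" "c' \<in> pfun_in A" using pfun_in_factor less.prems(1,2) c' by metis+
    have "sdeg \<pi> > 0" using sdeg_eq_0_unit[OF _ nz(1)] pi(1) by (auto simp: irreducible_def)
    then have lt: "sdeg c' < sdeg c" using sdeg_mult[OF nz] c' by simp
    have "\<pi> dvd r * q" using less.prems(3) c' by (metis dvd_triv_left mult.assoc)
    then consider "\<pi> dvd r" | "\<pi> dvd q"
      using rel_prime_elem_insert[OF IH[OF A(1) pi(1)] A(1) x] less.prems(4,5)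
      by (auto simp: rel_prime_elem_def)
    then show ?thesis
    proof cases
      case 1
      then obtain r0 where r0: "r = \<pi> * r0" by (auto simp: dvd_def)
      then have "c' * g = r0 * q" using less.prems(3) c' nz(1) by (simp add: mult.assoc)
      moreover have "r0 \<in> pfun_in (insert x A)"
        using r0 less.prems(4) nz(1) pfun_in_factor(2)[of \<pi> r0] by (cases "r0 = 0") auto
      ultimately obtain c1 c2 r' q' where "c' = c1 * c2" "r0 = c1 * r'" "q = c2 * q'" "g = r' * q'"
        using less.hyps[OF lt A(2) nz(2) _ _ less.prems(5)] by blast
      then show ?thesis using r0 c'
        by (intro exI[of _ "\<pi> * c1"] exI[of _ c2] exI[of _ r'] exI[of _ q']) (simp add: mult_ac)
    next
      case 2
      then obtain q0 where q0: "q = \<pi> * q0" by (auto simp: dvd_def)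
      then have "\<pi> * (c' * g) = \<pi> * (r * q0)" using less.prems(3) c' by (simp add: mult_ac)
      then have "c' * g = r * q0" using nz(1) by simp
      moreover have "q0 \<in> pfun_in (insert x A)"
        using q0 less.prems(5) nz(1) pfun_in_factor(2)[of \<pi> q0] by (cases "q0 = 0") auto
      ultimately obtain c1 c2 r' q' where "c' = c1 * c2" "r = c1 * r'" "q0 = c2 * q'" "g = r' * q'"
        using less.hyps[OF lt A(2) nz(2) _ less.prems(4)] by blast
      then show ?thesis using q0 c'
        by (intro exI[of _ c1] exI[of _ "\<pi> * c2"] exI[of _ r'] exI[of _ q']) (simp add: mult_ac)
    qed
  qed
qed

text \<open>An element of least \<open>x\<close>-degree in the ideal \<open>(g, a)\<close> divides both \<open>g\<close> and \<open>a\<close> up to factors not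
  involving \<open>x\<close>, and such factors cancel by induction.\<close>

lemma irreducible_rel_prime:
  fixes g :: "('v::finite, 'k::field_char_0) pfun"
  shows "finite A \<Longrightarrow> g \<in> pfun_in A \<Longrightarrow> irreducible g \<Longrightarrow> rel_prime_elem A g"
proof (induction A arbitrary: g rule: finite_induct)
  case empty
  then have "g dvd 1" by (intro pfun_in_empty_unit) auto
  then show ?case using empty by (simp add: irreducible_def)
next
  case (insert x A)
  note IH = insert.IH and x = insert.hyps(2)
  let ?E = "pfun_in (insert x A) :: ('v, 'k) pfun set"
  have AE: "pfun_in A \<subseteq> ?E" by (rule pfun_in_mono) auto
  have g0: "g \<noteq> 0" using insert.prems(2) by auto
  show ?case
  proof (cases "xdeg x g = 0")
    case True
    then have "g \<in> pfun_in A" using xdeg_eq_0_imp[OF insert.prems(1) True] x by simp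
    then show ?thesis using rel_prime_elem_insert IH insert.prems(2) x by blast
  next
    case dg: False
    \<comment> \<open>Distributing \<open>c\<close> over \<open>g\<close> and the cofactor writes
      \<open>g\<close> as \<open>c1 * g'\<close>. Since \<open>g\<close> involves \<open>x\<close>
      and \<open>c1\<close> does not, \<open>g'\<close> is no unit, so irreducibility makes
      \<open>c1\<close> a unit.\<close>
    have scalar: "g dvd b" if b: "c \<in> pfun_in A" "c \<noteq> 0" "b \<in> ?E" "g dvd c * b" for c b
    proof (cases "b = 0")
      case False
      obtain w where w: "c * b = g * w" using b(4) by (auto simp: dvd_def)
      have "w \<in> ?E" using pfun_in_factor(2)[of g w "insert x A"] w b AE False
        by (metis pfun_in.mult mult_eq_0_iff subsetD)
      then obtain c1 c2 g' w' where *: "c = c1 * c2" "g = c1 * g'" "w = c2 * w'" "b = g' * w'"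
        using cancel_scalar[OF IH x b(1,2) w insert.prems(1)] by blast
      have "\<not> g' dvd 1"
      proof
        assume "g' dvd 1"
        then have "g' \<in> pfun_in {}" by (rule pfun_in_dvd) auto
        then have "g' \<in> pfun_in A" using pfun_in_mono by blast
        moreover have "c1 \<in> pfun_in A" using pfun_in_factor(1)[of c1 c2 A] b(1,2) *(1) by simp
        ultimately show False using dg xdeg_eq_0[OF _ x] *(2) pfun_in.mult by metis
      qed
      then have "c1 dvd 1" using *(2) insert.prems(2) irreducibleD by blast
      then obtain d where "1 = c1 * d" by (auto simp: dvd_def)
      then have "b = g * (d * w')" using *(2,4) by (metis mult.assoc mult.commute mult_1)
      then show ?thesis by (rule dvdI)
    qed simp
    show ?thesis
      unfolding rel_prime_elem_def
    proof (intro ballI impI)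
      fix a b assume a: "a \<in> ?E" and b: "b \<in> ?E" and gab: "g dvd a * b"
      define J where "J = {g * s + a * t | s t. s \<in> ?E \<and> t \<in> ?E}"
      have J_E: "J \<subseteq> ?E" unfolding J_def using a insert.prems(1) by (auto intro!: pfun_in.add pfun_in.mult)
      have J_comb: "F * c - r * q \<in> J" if Fr: "F \<in> J" "r \<in> J" "c \<in> ?E" "q \<in> ?E" for F r c q
      proof -
        obtain s t s' t' where *: "F = g * s + a * t" "r = g * s' + a * t'" "s \<in> ?E" "t \<in> ?E" "s' \<in> ?E" "t' \<in> ?E"
          using Fr(1,2) unfolding J_def by blast
        have "F * c - r * q = g * (s * c - s' * q) + a * (t * c - t' * q)"
          by (simp add: * algebra_simps)
        moreover have "s * c - s' * q \<in> ?E" "t * c - t' * q \<in> ?E"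
          using * Fr(3,4) by (auto intro!: pfun_in_diff pfun_in.mult)
        ultimately show ?thesis unfolding J_def by blast
      qed
      have gJ: "g \<in> J" unfolding J_def by (intro CollectI exI[of _ 1] exI[of _ 0]) auto
      have aJ: "a \<in> J" unfolding J_def by (intro CollectI exI[of _ 0] exI[of _ 1]) auto
      define m where "m = (LEAST m. \<exists>r\<in>J. r \<noteq> 0 \<and> xdeg x r = m)"
      have "\<exists>m. \<exists>r\<in>J. r \<noteq> 0 \<and> xdeg x r = m" using gJ g0 by blast
      then have "\<exists>r\<in>J. r \<noteq> 0 \<and> xdeg x r = m" unfolding m_def by (rule LeastI_ex)
      then obtain r where r: "r \<in> J" "r \<noteq> 0" "xdeg x r = m" by blast
      have least: "r' = 0" if "r' \<in> J" "xdeg x r' < m" for r'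
        using not_less_Least[of "xdeg x r'" "\<lambda>m. \<exists>r\<in>J. r \<noteq> 0 \<and> xdeg x r = m"] that
        unfolding m_def by blast
      have div: "\<exists>c q. c \<in> pfun_in A \<and> c \<noteq> 0 \<and> q \<in> ?E \<and> c * F = r * q" if F: "F \<in> J" for F
      proof -
        let ?R = "upoly x r" and ?F = "upoly x F"
        have coeffs_in: "?R \<in> coeffs_in A" "?F \<in> coeffs_in A" using J_E r(1) F by (auto intro!: upoly_coeffs_in x)
        have R0: "?R \<noteq> 0" using r(2) by simp
        obtain k Q S where *: "Q \<in> coeffs_in A" "S \<in> coeffs_in A" "smult (lead_coeff ?R ^ k) ?F = ?R * Q + S"
          "S = 0 \<or> degree S < degree ?R"
          using coeffs_in_pseudo_division[OF coeffs_in(1) R0 coeffs_in(2)] by blast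
        let ?c = "lead_coeff ?R ^ k"
        have cA: "?c \<in> pfun_in A" by (intro pfun_in_power coeffs_in_coeff coeffs_in)
        have c0: "?c \<noteq> 0" using R0 by simp
        have eq: "?c * F = r * poly Q (X x) + poly S (X x)"
          using arg_cong[OF *(3), of "\<lambda>q. poly q (X x)"] by (simp add: upoly)
        then have "poly S (X x) = F * ?c - r * poly Q (X x)" by (simp add: mult.commute)
        also have "\<dots> \<in> J" using cA AE by (intro J_comb F r poly_coeffs_in *) auto
        finally have SJ: "poly S (X x) \<in> J" .
        have US: "upoly x (poly S (X x)) = S"
          using *(2) coeffs_in_mono[of A "- {x}"] x by (intro upoly_eqI) auto
        have "poly S (X x) = 0"
          using *(4) least[OF SJ] r(3) by (auto simp: xdeg_def US)
        then show ?thesis using eq cA c0 poly_coeffs_in[OF *(1)] by (metis add.right_neutral)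
      qed
      have rE: "r \<in> ?E" using r J_E by blast
      obtain c q where cq: "c \<in> pfun_in A" "c \<noteq> 0" "q \<in> ?E" "c * g = r * q" using div[OF gJ] by blast
      obtain c1 c2 r' q' where *: "c = c1 * c2" "r = c1 * r'" "q = c2 * q'" "g = r' * q'"
        using cancel_scalar[OF IH x cq(1,2,4) rE cq(3)] by blast
      \<comment> \<open>If \<open>r'\<close> is a unit, \<open>r\<close> is free of
        \<open>x\<close>; as \<open>r\<close> lies in \<open>J\<close>, \<open>r * b\<close> is a
        multiple of \<open>g\<close>, and \<open>r\<close> can be stripped. If \<open>q'\<close> is
        a unit, \<open>g\<close> divides \<open>r\<close>, hence a multiple of \<open>a\<close> by
        an element free of \<open>x\<close>, which is stripped likewise.\<close>
      consider "r' dvd 1" | "q' dvd 1" using *(4) insert.prems(2) irreducibleD by blast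
      then show "g dvd a \<or> g dvd b"
      proof cases
        case 1
        then have "r' \<in> pfun_in {}" by (rule pfun_in_dvd) auto
        then have "r' \<in> pfun_in A" using pfun_in_mono by blast
        then have rA: "r \<in> pfun_in A" using *(1,2) cq(1,2) pfun_in_factor(1)[of c1 c2 A] by (simp add: pfun_in.mult)
        obtain s t where "r = g * s + a * t" using r(1) J_def by blast
        then have "r * b = g * (s * b) + (a * b) * t" by (simp add: algebra_simps)
        then have "g dvd r * b" using gab by simp
        then show ?thesis using scalar[OF rA r(2) b] by simp
      next
        case 2
        then obtain d where d: "1 = q' * d" by (auto simp: dvd_def)
        obtain c' q2 where cq': "c' \<in> pfun_in A" "c' \<noteq> 0" "c' * a = r * q2" using div[OF aJ] by blast
        have "r' = g * d" using *(4) d by (metis mult.assoc mult.right_neutral)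
        then have "g dvd c' * a" using cq'(3) *(2) by simp
        then show ?thesis using scalar[OF cq'(1,2) a] by simp
      qed
    qed
  qed
qed

lemma irreducible_principal_prime:
  fixes g :: "('v::finite, 'k::field_char_0) pfun"
  assumes "irreducible g"
  shows "is_prime_ideal {p. g dvd p}"
  using irreducible_rel_prime[of UNIV g] assms
  by (auto simp: is_prime_ideal_def is_ideal_def rel_prime_elem_def irreducible_def)

section \<open>Derivatives and smooth points\<close>

lemma mpderiv_superset:
  assumes "finite S" "Poly_Mapping.keys p \<subseteq> S"
  shows "mpderiv v p = (\<Sum>m\<in>S. Poly_Mapping.single (m - Poly_Mapping.single v 1)
    (of_nat (Poly_Mapping.lookup m v) * Poly_Mapping.lookup p m))"
  unfolding mpderiv_def by (rule sum.mono_neutral_left) (use assms in \<open>auto simp: in_keys_iff\<close>)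

lemma mpderiv_0 [simp]: "mpderiv v 0 = 0"
  by (simp add: mpderiv_def)

lemma mpderiv_add: "mpderiv v (p + q) = mpderiv v p + mpderiv v q"
proof -
  let ?S = "Poly_Mapping.keys p \<union> Poly_Mapping.keys q"
  have S: "finite ?S" "Poly_Mapping.keys (p + q) \<subseteq> ?S" using keys_add[of p q] by auto
  show ?thesis
    unfolding mpderiv_superset[OF S] mpderiv_superset[OF S(1) Un_upper1] mpderiv_superset[OF S(1) Un_upper2]
    by (simp add: lookup_add algebra_simps sum.distrib single_add)
qed

lemma mpderiv_single:
  "mpderiv v (Poly_Mapping.single m c)
    = Poly_Mapping.single (m - Poly_Mapping.single v 1) (of_nat (Poly_Mapping.lookup m v) * c)"
  by (subst mpderiv_superset[of "{m}"]) auto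

lemma pderiv_prod:
  fixes f :: "'i \<Rightarrow> 'a::idom poly"
  shows "finite S \<Longrightarrow> pderiv (prod f S) = (\<Sum>i\<in>S. pderiv (f i) * prod f (S - {i}))"
proof (induction S rule: finite_induct)
  case (insert x S)
  have "(\<Sum>i\<in>S. pderiv (f i) * prod f (insert x S - {i})) = f x * (\<Sum>i\<in>S. pderiv (f i) * prod f (S - {i}))"
    unfolding sum_distrib_left
  proof (rule sum.cong)
    fix i assume i: "i \<in> S"
    then have "insert x S - {i} = insert x (S - {i})" using insert.hyps by auto
    then show "pderiv (f i) * prod f (insert x S - {i}) = f x * (pderiv (f i) * prod f (S - {i}))"
      using insert.hyps by (simp add: mult_ac)
  qed simp
  then show ?case using insert by (simp add: pderiv_mult mult_ac)
qed simp

text \<open>Links the formal partial derivatives of the definitions with derivatives of univariate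
  polynomials. Restriction and chain rule are established together because the induction needs the
  same \<open>P\<close> for both.\<close>

lemma mpeval_along_curve:
  fixes p :: "('v::finite, 'k::field_char_0) mpoly"
  shows "\<exists>P. \<forall>t. poly P t = mpeval p (\<lambda>v. poly (c v) t) \<and>
    poly (pderiv P) t = (\<Sum>v\<in>UNIV. poly (pderiv (c v)) t * mpeval (mpderiv v p) (\<lambda>v. poly (c v) t))"
proof (induction p rule: mpoly_induct)
  case zero
  show ?case by (intro exI[of _ 0]) simp
next
  case (add p q)
  then obtain P Q where
    "\<And>t. poly P t = mpeval p (\<lambda>v. poly (c v) t) \<and>
      poly (pderiv P) t = (\<Sum>v\<in>UNIV. poly (pderiv (c v)) t * mpeval (mpderiv v p) (\<lambda>v. poly (c v) t))"
    "\<And>t. poly Q t = mpeval q (\<lambda>v. poly (c v) t) \<and>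
      poly (pderiv Q) t = (\<Sum>v\<in>UNIV. poly (pderiv (c v)) t * mpeval (mpderiv v q) (\<lambda>v. poly (c v) t))"
    by auto
  then show ?case
    by (intro exI[of _ "P + Q"]) (simp add: pderiv_add mpderiv_add distrib_left sum.distrib)
next
  case (single m k)
  let ?m = "Poly_Mapping.lookup m"
  let ?P = "smult k (\<Prod>v\<in>UNIV. c v ^ ?m v)"
  \<comment> \<open>Subtraction of exponents is truncated at 0; the factor
    \<open>of_nat (?m v)\<close> makes both sides vanish exactly where truncation would
    matter.\<close>
  have drop: "of_nat (?m v) * (\<Prod>w\<in>UNIV. x w ^ Poly_Mapping.lookup (m - Poly_Mapping.single v 1) w)
      = of_nat (?m v) * x v ^ (?m v - 1) * (\<Prod>w\<in>UNIV - {v}. x w ^ ?m w)" for v and x :: "'v \<Rightarrow> 'k"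
  proof -
    have "(\<Prod>w\<in>UNIV - {v}. x w ^ Poly_Mapping.lookup (m - Poly_Mapping.single v 1) w)
        = (\<Prod>w\<in>UNIV - {v}. x w ^ ?m w)"
      by (rule prod.cong) (auto simp: lookup_minus lookup_single when_def)
    then show ?thesis by (subst prod.remove[of _ v]) (auto simp: lookup_minus)
  qed
  have "poly (pderiv ?P) t = (\<Sum>v\<in>UNIV. poly (pderiv (c v)) t *
      mpeval (mpderiv v (Poly_Mapping.single m k)) (\<lambda>v. poly (c v) t))" for t
  proof -
    have "poly (pderiv ?P) t = (\<Sum>v\<in>UNIV. k * (of_nat (?m v) * poly (c v) t ^ (?m v - 1) * poly (pderiv (c v)) t
        * (\<Prod>w\<in>UNIV - {v}. poly (c w) t ^ ?m w)))"
      by (simp add: pderiv_smult pderiv_prod poly_sum pderiv_power poly_prod sum_distrib_left mult_ac)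
    also have "\<dots> = (\<Sum>v\<in>UNIV. poly (pderiv (c v)) t *
      mpeval (mpderiv v (Poly_Mapping.single m k)) (\<lambda>v. poly (c v) t))"
    proof (rule sum.cong)
      fix v
      have "mpeval (mpderiv v (Poly_Mapping.single m k)) (\<lambda>v. poly (c v) t)
        = k * (of_nat (?m v) * (\<Prod>w\<in>UNIV. poly (c w) t ^ Poly_Mapping.lookup (m - Poly_Mapping.single v 1) w))"
        unfolding mpderiv_single mpeval_single by (simp only: mult_ac)
      also have "\<dots> = k * (of_nat (?m v) * poly (c v) t ^ (?m v - 1) * (\<Prod>w\<in>UNIV - {v}. poly (c w) t ^ ?m w))"
        unfolding drop ..
      finally show "k * (of_nat (?m v) * poly (c v) t ^ (?m v - 1) * poly (pderiv (c v)) t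
        * (\<Prod>w\<in>UNIV - {v}. poly (c w) t ^ ?m w)) = poly (pderiv (c v)) t *
      mpeval (mpderiv v (Poly_Mapping.single m k)) (\<lambda>v. poly (c v) t)" by (simp only: mult_ac)
    qed simp
    finally show ?thesis .
  qed
  then show ?case
    by (intro exI[of _ ?P]) (simp add: mpeval_single poly_prod)
qed

lemma chain_rule:
  fixes p :: "('v::finite, 'k::field_char_0) mpoly"
  assumes "\<And>t. poly P t = mpeval p (\<lambda>v. poly (c v) t)"
  shows "poly (pderiv P) t = (\<Sum>v\<in>UNIV. poly (pderiv (c v)) t * mpeval (mpderiv v p) (\<lambda>v. poly (c v) t))"
proof -
  obtain Q where Q: "\<And>t. poly Q t = mpeval p (\<lambda>v. poly (c v) t)"
    "\<And>t. poly (pderiv Q) t = (\<Sum>v\<in>UNIV. poly (pderiv (c v)) t * mpeval (mpderiv v p) (\<lambda>v. poly (c v) t))"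
    using mpeval_along_curve[of p c] by auto
  have "poly P = poly Q" using assms Q(1) by (intro ext) simp
  then have "P = Q" using poly_eq_poly_eq_iff by blast
  then show ?thesis using Q(2) by simp
qed

lemma sum_delta_mult:
  fixes f :: "'v::finite \<Rightarrow> 'k::comm_ring_1"
  shows "(\<Sum>v\<in>UNIV. (if v = w then 1 else 0) * f v) = f w"
  by (simp add: if_distrib[of "\<lambda>x. x * _"] sum.delta cong: if_cong)

lemma partial_derivative:
  fixes p :: "('v::finite, 'k::field_char_0) mpoly"
  assumes "\<And>t. poly P t = mpeval p (a(w := t))"
  shows "poly (pderiv P) (a w) = mpeval (mpderiv w p) a"
proof -
  let ?c = "\<lambda>v. if v = w then [:0, 1:] else [:a v:]"
  have c: "(\<lambda>v. poly (?c v) t) = a(w := t)" for t by (auto simp: fun_eq_iff)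
  have d: "poly (pderiv (?c v)) t = (if v = w then 1 else 0)" for v t
    by (auto simp: pderiv_pCons)
  show ?thesis
    using chain_rule[of P p ?c "a w"] assms unfolding c d by (simp add: sum_delta_mult)
qed

lemma mpeval_scale:
  assumes "mp_homogeneous d p"
  shows "mpeval p (\<lambda>v. t * x v) = t ^ d * mpeval p x"
  unfolding mpeval_def sum_distrib_left
proof (rule sum.cong)
  fix m assume m: "m \<in> Poly_Mapping.keys p"
  have "(\<Prod>v\<in>Poly_Mapping.keys m. (t * x v) ^ Poly_Mapping.lookup m v)
      = t ^ (\<Sum>v\<in>Poly_Mapping.keys m. Poly_Mapping.lookup m v) * (\<Prod>v\<in>Poly_Mapping.keys m. x v ^ Poly_Mapping.lookup m v)"
    by (simp add: power_mult_distrib prod.distrib power_sum)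
  then show "Poly_Mapping.lookup p m * (\<Prod>v\<in>Poly_Mapping.keys m. (t * x v) ^ Poly_Mapping.lookup m v) =
    t ^ d * (Poly_Mapping.lookup p m * (\<Prod>v\<in>Poly_Mapping.keys m. x v ^ Poly_Mapping.lookup m v))"
    using assms m by (simp add: mp_homogeneous_def mult_ac)
qed simp

text \<open>Differentiate p(t x) = t ^ d * p(x) along the line through \<open>x\<close> and set t =
  1.\<close>

lemma euler_identity:
  fixes p :: "('v::finite, 'k::field_char_0) mpoly"
  assumes "mp_homogeneous d p"
  shows "(\<Sum>v\<in>UNIV. x v * grad p x v) = of_nat d * mpeval p x"
proof -
  let ?P = "monom (mpeval p x) d"
  have "poly ?P t = mpeval p (\<lambda>v. poly [:0, x v:] t)" for t
    using mpeval_scale[OF assms, of t x] by (simp add: poly_monom mult.commute)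
  from chain_rule[OF this, of 1] have "poly (pderiv ?P) 1 = (\<Sum>v\<in>UNIV. x v * grad p x v)"
    by (simp add: pderiv_pCons grad_def)
  then show ?thesis by (simp add: pderiv_monom poly_monom)
qed

text \<open>The definitions of polar image and dual variety exclude the point zero; from degree 2
  on, a nonzero gradient guarantees this condition.\<close>

lemma grad_at_0:
  fixes p :: "('v::finite, 'k::field_char_0) mpoly"
  assumes "mp_homogeneous d p" "d \<ge> 2"
  shows "grad p (\<lambda>_. 0) = (\<lambda>_. 0)"
proof
  fix w
  let ?P = "monom (mpeval p ((\<lambda>_. 0)(w := 1))) d"
  have "poly ?P t = mpeval p ((\<lambda>_. 0)(w := t))" for t
  proof -
    have "(\<lambda>v. t * ((\<lambda>_. 0)(w := 1)) v) = (\<lambda>_. 0)(w := t)" by auto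
    then show ?thesis
      using mpeval_scale[OF assms(1), of t "(\<lambda>_. 0)(w := 1)"] by (simp add: poly_monom mult.commute)
  qed
  from partial_derivative[OF this] show "grad p (\<lambda>_. 0) w = 0"
    using assms(2) by (auto simp: grad_def pderiv_monom poly_monom power_0_left split: if_splits)
qed

lemma linear_form:
  fixes p :: "('v::finite, 'k::field_char_0) mpoly"
  assumes "mp_homogeneous 1 p"
  shows "mpeval p (\<lambda>v. s * x v + t * y v) = s * mpeval p x + t * mpeval p y"
proof -
  have "(\<Prod>v\<in>Poly_Mapping.keys m. (s * x v + t * y v) ^ Poly_Mapping.lookup m v)
      = s * (\<Prod>v\<in>Poly_Mapping.keys m. x v ^ Poly_Mapping.lookup m v)
        + t * (\<Prod>v\<in>Poly_Mapping.keys m. y v ^ Poly_Mapping.lookup m v)"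
    if m: "m \<in> Poly_Mapping.keys p" for m
  proof -
    have "(\<Sum>v\<in>Poly_Mapping.keys m. Poly_Mapping.lookup m v) = 1"
      using assms m by (simp add: mp_homogeneous_def)
    then obtain w where w: "w \<in> Poly_Mapping.keys m" "Poly_Mapping.lookup m w = 1"
      "\<forall>v\<in>Poly_Mapping.keys m. w \<noteq> v \<longrightarrow> Poly_Mapping.lookup m v = 0"
      using sum_eq_1_iff[OF finite_keys] by (metis (no_types, lifting))
    then have "Poly_Mapping.keys m = {w}" by (auto simp: in_keys_iff)
    then show ?thesis using w by simp
  qed
  then show ?thesis
    unfolding mpeval_def by (simp add: sum_distrib_left sum.distrib distrib_left mult_ac)
qed

text \<open>A constant is zero or a unit, hence not irreducible. A linear form in at least two
  variables has a nonzero zero, which is a vertex of the hyperplane.\<close>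

lemma degree_ge_2:
  fixes g :: "('n::finite, 'k::field_char_0) mpoly"
  assumes n: "CARD('n) \<ge> 2" and irr: "irreducible g" and hom: "mp_homogeneous d g"
    and not_cone: "\<not> hypersurface_is_cone g"
  shows "d \<ge> 2"
proof (rule ccontr)
  assume "\<not> d \<ge> 2"
  then consider "d = 0" | "d = 1" by linarith
  then show False
  proof cases
    case 1
    have "mp g = cst (mpeval g (\<lambda>_. 0))"
    proof (rule pfun_eqI)
      show "ev (mp g) a = ev (cst (mpeval g (\<lambda>_. 0))) a" for a
        using mpeval_scale[OF hom, of 0 a] 1 by simp
    qed
    then have "mp g \<in> pfun_in {}" by (metis pfun_in.const)
    then show False using irreducible_mp[OF irr] pfun_in_empty_unit by (auto simp: irreducible_def)
  next
    case 2
    obtain i j :: 'n where ij: "i \<noteq> j" using n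
      by (metis card_2_iff' card_le_Suc0_iff_eq finite UNIV_I not_less_eq_eq numeral_2_eq_2)
    let ?e = "\<lambda>i v. if v = i then 1 else 0 :: 'k"
    have "\<exists>p. p \<noteq> (\<lambda>_. 0) \<and> mpeval g p = 0"
    proof (cases "mpeval g (?e i) = 0")
      case True
      then show ?thesis by (intro exI[of _ "?e i"]) (auto simp: fun_eq_iff)
    next
      case False
      let ?p = "\<lambda>v. mpeval g (?e j) * ?e i v + (- mpeval g (?e i)) * ?e j v"
      have "?p \<noteq> (\<lambda>_. 0)"
      proof
        assume "?p = (\<lambda>_. 0)"
        from fun_cong[OF this, of j] show False using False ij by simp
      qed
      moreover have "mpeval g ?p = 0"
        using linear_form[of g "mpeval g (?e j)" "?e i" "- mpeval g (?e i)" "?e j"] hom 2 by simp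
      ultimately show ?thesis by blast
    qed
    then show False using not_cone linear_form[of g] hom 2 unfolding hypersurface_is_cone_def by auto
  qed
qed

text \<open>For a coordinate \<open>x\<close> that occurs in \<open>g\<close>, the partial
  derivative is nonzero in characteristic zero and has smaller degree in \<open>x\<close>, so it is
  no multiple of \<open>g\<close>. The Nullstellensatz for the prime ideal of multiples of
  \<open>g\<close> then yields a zero of \<open>g\<close> where it does not vanish.\<close>

lemma (in alg_closed_field) exists_smooth_point:
  fixes g :: "('v::finite, 'k) mpoly"
  assumes irr: "irreducible g"
  shows "\<exists>q. mpeval g q = 0 \<and> grad g q \<noteq> (\<lambda>_. 0)"
proof -
  let ?G = "mp g"
  have G: "irreducible ?G" by (rule irreducible_mp[OF irr])
  have "sdeg ?G \<noteq> 0" using sdeg_eq_0_unit[of ?G] G by (auto simp: irreducible_def)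
  then obtain x where x: "xdeg x ?G > 0" by (auto simp: sdeg_def)
  let ?U = "upoly x ?G"
  define D where "D = poly (pderiv ?U) (X x)"
  have U': "pderiv ?U \<in> coeffs_in (- {x})"
  proof -
    have "of_nat n \<in> pfun_in A" for n and A :: "'v set"
      by (induction n) (auto intro: pfun_in.add)
    then show ?thesis using coeffs_in_coeff[OF upoly(1)[of x ?G]]
      by (auto simp: coeffs_in_def coeff_pderiv intro!: pfun_in.mult pfun_in.add)
  qed
  then have UD: "upoly x D = pderiv ?U" by (intro upoly_eqI) (auto simp: D_def)
  have evD: "ev D a = mpeval (mpderiv x g) a" for a
  proof -
    have "poly (evp a ?U) t = mpeval g (a(x := t))" for t
      using ev_poly_X_upd[OF upoly(1)[of x ?G], of x a t] by (simp add: upoly)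
    then have "poly (pderiv (evp a ?U)) (a x) = mpeval (mpderiv x g) a" by (rule partial_derivative)
    moreover have "pderiv (evp a ?U) = evp a (pderiv ?U)"
      by (rule poly_eqI) (simp add: coeff_pderiv)
    ultimately show ?thesis by (simp add: D_def ev_poly)
  qed
  have "\<not> ?G dvd D"
  proof
    assume "?G dvd D"
    then obtain w where w: "D = ?G * w" by (auto simp: dvd_def)
    have "pderiv ?U \<noteq> 0" using x by (simp add: pderiv_eq_0_iff xdeg_def)
    then have "D \<noteq> 0" by (metis UD upoly_eq_0_iff)
    then have "xdeg x D \<ge> xdeg x ?G" using w by (auto simp: xdeg_mult)
    moreover have "xdeg x D < xdeg x ?G" using x by (simp add: xdeg_def UD degree_pderiv)
    ultimately show False by simp
  qed
  moreover have "van (zset {p. ?G dvd p}) = {p. ?G dvd p}"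
    by (rule nullstellensatz[OF irreducible_principal_prime[OF G]])
  ultimately have "D \<notin> van (zset {p. ?G dvd p})" by simp
  then obtain q where q: "q \<in> zset {p. ?G dvd p}" "ev D q \<noteq> 0" by (auto simp: van_def)
  have "ev ?G q = 0" using q(1) by (simp add: zset_def del: ev_mp)
  then have "mpeval g q = 0" by simp
  moreover have "grad g q x \<noteq> 0" using q(2) evD by (simp add: grad_def)
  ultimately show ?thesis by (intro exI[of _ q]) (auto simp: fun_eq_iff)
qed

lemma mpderiv_degree:
  assumes F: "\<And>m. m \<in> Poly_Mapping.keys F \<Longrightarrow> (\<Sum>v\<in>UNIV. Poly_Mapping.lookup m v) \<le> Suc N"
    and m: "m \<in> Poly_Mapping.keys (mpderiv (j :: 'v::finite) F)"
  shows "(\<Sum>v\<in>UNIV. Poly_Mapping.lookup m v) \<le> N"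
proof -
  obtain m' where m': "m' \<in> Poly_Mapping.keys F"
    "m \<in> Poly_Mapping.keys (Poly_Mapping.single (m' - Poly_Mapping.single j 1)
      (of_nat (Poly_Mapping.lookup m' j) * Poly_Mapping.lookup F m'))"
    using subsetD[OF keys_sum m[unfolded mpderiv_def]] by auto
  then have "m = m' - Poly_Mapping.single j 1"
    "of_nat (Poly_Mapping.lookup m' j) * Poly_Mapping.lookup F m' \<noteq> 0"
    by (auto split: if_splits)
  note m' = m'(1) this(1)
  have "Poly_Mapping.lookup m' j \<noteq> 0"
    using \<open>of_nat (Poly_Mapping.lookup m' j) * Poly_Mapping.lookup F m' \<noteq> 0\<close> by (intro notI) simp
  have "(\<Sum>v\<in>UNIV. Poly_Mapping.lookup m v) < (\<Sum>v\<in>UNIV. Poly_Mapping.lookup m' v)"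
    by (rule sum_strict_mono_ex1) (use m' \<open>Poly_Mapping.lookup m' j \<noteq> 0\<close> in \<open>auto simp: lookup_minus lookup_single when_def intro!: exI[of _ j]\<close>)
  then show ?thesis using F[OF m'(1)] by simp
qed

text \<open>Differentiating the relation in direction \<open>i\<close> shows that the Hessian matrix
  at \<open>a\<close> kills the gradient of \<open>F\<close> at \<open>grad g a\<close>. So the
  partial derivatives of \<open>F\<close> satisfy the same hypothesis with smaller degree, vanish by
  induction, and \<open>F\<close> is constant along lines.\<close>

lemma hessian_no_relation:
  fixes g :: "('n::finite, 'k::field_char_0) mpoly" and F :: "('n, 'k) mpoly"
  assumes hess: "hessian g \<noteq> 0"
    and deg: "\<And>m. m \<in> Poly_Mapping.keys F \<Longrightarrow> (\<Sum>v\<in>UNIV. Poly_Mapping.lookup m v) \<le> N"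
    and rel: "\<And>a. mpeval F (grad g a) = 0"
  shows "mpeval F y = 0"
  using deg rel
proof (induction N arbitrary: F y)
  case 0
  have "mpeval F y = mpeval F (grad g (\<lambda>_. 0))"
  proof -
    have "Poly_Mapping.lookup m v = 0" if "m \<in> Poly_Mapping.keys F" for m v
      using 0(1)[OF that] by simp
    then show ?thesis unfolding mpeval_finite_vars[OF finite_keys order_refl] by simp
  qed
  then show ?case using 0(2) by simp
next
  case (Suc N)
  have zero: "mpeval (mpderiv j F) y = 0" for j y
  proof (rule Suc.IH)
    show "(\<Sum>v\<in>UNIV. Poly_Mapping.lookup m v) \<le> N" if "m \<in> Poly_Mapping.keys (mpderiv j F)" for m
      using mpderiv_degree[OF Suc.prems(1) that] .
    have H: "H \<noteq> 0 \<Longrightarrow> mpeval (mpderiv j F) (grad g a) = 0" if H: "H = mpeval (hessian g) a" for a H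
    proof -
      assume H0: "H \<noteq> 0"
      let ?A = "(\<chi> i j. mpeval (mpderiv i (mpderiv j g)) a) :: 'k ^ 'n ^ 'n"
      have "det ?A = H" by (simp add: H hessian_def det_def)
      then have inv: "invertible ?A" using H0 by (simp add: invertible_det_nz)
      let ?w = "(\<chi> j. mpeval (mpderiv j F) (grad g a)) :: 'k ^ 'n"
      have "(\<Sum>j\<in>UNIV. mpeval (mpderiv i (mpderiv j g)) a * mpeval (mpderiv j F) (grad g a)) = 0" for i
      proof -
        let ?l = "\<lambda>v. [:a v, if v = i then 1 else 0:]"
        have "\<exists>P. \<forall>t. poly P t = mpeval (mpderiv j g) (\<lambda>v. poly (?l v) t)" for j
          using mpeval_along_curve[of "mpderiv j g" ?l] by fast
        then obtain c where c: "\<And>j t. poly (c j) t = mpeval (mpderiv j g) (\<lambda>v. poly (?l v) t)"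
          using choice[of "\<lambda>j P. \<forall>t. poly P t = mpeval (mpderiv j g) (\<lambda>v. poly (?l v) t)"] by auto
        have "poly (0 :: 'k poly) t = mpeval F (\<lambda>j. poly (c j) t)" for t
          using Suc.prems(2) by (simp only: c grad_def[symmetric] poly_0)
        from chain_rule[OF this, of 0]
        have "(\<Sum>j\<in>UNIV. poly (pderiv (c j)) 0 * mpeval (mpderiv j F) (\<lambda>j. poly (c j) 0)) = 0" by simp
        moreover have "poly (pderiv (c j)) 0 = mpeval (mpderiv i (mpderiv j g)) a" for j
          using chain_rule[OF c, of j 0] by (simp add: pderiv_pCons sum_delta_mult)
        moreover have "(\<lambda>j. poly (c j) 0) = grad g a" by (simp add: c grad_def)
        ultimately show ?thesis by simp
      qed
      then have "?A *v ?w = 0" by (simp add: matrix_vector_mult_def vec_eq_iff)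
      moreover have "\<forall>w. ?A *v w = 0 \<longrightarrow> w = 0"
        unfolding matrix_left_invertible_ker[symmetric] using inv invertible_left_inverse by auto
      ultimately have "?w = 0" by simp
      then show ?thesis by (simp add: vec_eq_iff)
    qed
    \<comment> \<open>Points with zero Hessian determinant are handled by multiplying with the
      determinant and cancelling it in the domain of polynomial functions.\<close>
    have "pcomp (mp (mpderiv j F)) (\<lambda>i. mp (mpderiv i g)) * mp (hessian g) = 0"
      by (rule pfun_eqI) (use H in \<open>auto simp: grad_def\<close>)
    moreover have "mp (hessian g) \<noteq> 0" using hess by (metis mp_0 mp_inject)
    ultimately have "pcomp (mp (mpderiv j F)) (\<lambda>i. mp (mpderiv i g)) = 0" by simp
    then have "ev (pcomp (mp (mpderiv j F)) (\<lambda>i. mp (mpderiv i g))) a = 0" for a by simp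
    then show "mpeval (mpderiv j F) (grad g a) = 0" for a by (simp add: grad_def)
  qed
  \<comment> \<open>Some value of the gradient, so that \<open>F\<close> is known to vanish at the
    start of the line.\<close>
  let ?y = "grad g (\<lambda>_. 0)"
  let ?c = "\<lambda>v. [:?y v, y v - ?y v:]"
  obtain P where P: "\<And>t. poly P t = mpeval F (\<lambda>v. poly (?c v) t)"
    using mpeval_along_curve[of F ?c] by blast
  have "poly (pderiv P) t = 0" for t using chain_rule[OF P] zero by simp
  then have "pderiv P = 0" using poly_all_0_iff_0 by blast
  then obtain k where "P = [:k:]" by (metis pderiv_eq_0_iff degree_eq_zeroE)
  then have "poly P 1 = poly P 0" by simp
  then show ?case using Suc.prems(2)[of "\<lambda>_. 0"] unfolding P by simp
qed

section \<open>The polar image and the dual variety of \<open>f\<close>\<close>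

lemma fvar_UNIV: "UNIV = {FU, FV} \<union> range FX \<union> range FY"
  using fvar.exhaust by blast

instance fvar :: (finite) finite
proof
  show "finite (UNIV :: 'a fvar set)" unfolding fvar_UNIV by simp
qed

lemma fpoint_simps [simp]:
  "fpoint u v x y FU = u" "fpoint u v x y FV = v" "fpoint u v x y (FX i) = x i" "fpoint u v x y (FY i) = y i"
  by (simp_all add: fpoint_def)

lemma fpoint_eta: "fpoint (z FU) (z FV) (\<lambda>i. z (FX i)) (\<lambda>i. z (FY i)) = z"
  by (rule ext) (simp add: fpoint_def split: fvar.split)

lemma fpoint_cases: obtains u v x y where "z = fpoint u v x y"
  using fpoint_eta by metis

lemma mpeval_subst:
  fixes q :: "'v \<Rightarrow> ('w::finite, 'k::comm_ring_1) mpoly"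
  shows "mpeval (mpsubst p q) x = mpeval p (\<lambda>v. mpeval (q v) x)"
  by (simp add: mpsubst_def) (simp add: mpeval_def)

lemma mpeval_f_of:
  fixes g :: "('n::finite, 'k::comm_ring_1) mpoly"
  shows "mpeval (f_of g) p = mpeval g (\<lambda>i. p FU * p (FX i) - p FV * p (FY i))"
  by (simp add: f_of_def mpeval_subst)

text \<open>\<open>c i\<close> expresses the i-th coordinate of u x - v y as a polynomial in the
  single variable \<open>w\<close>; the four kinds of variable in \<open>grad_f_of\<close> differ
  only in this choice.\<close>

lemma partial_f_of:
  fixes g :: "('n::finite, 'k::field_char_0) mpoly"
  assumes "\<And>t i. poly (c i) t = (p(w := t)) FU * (p(w := t)) (FX i) - (p(w := t)) FV * (p(w := t)) (FY i)"
  shows "grad (f_of g) p w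
    = (\<Sum>i\<in>UNIV. poly (pderiv (c i)) (p w) * grad g (\<lambda>i. p FU * p (FX i) - p FV * p (FY i)) i)"
proof -
  obtain P where P: "\<And>t. poly P t = mpeval g (\<lambda>i. poly (c i) t)"
    using mpeval_along_curve[of g c] by blast
  then have "poly P t = mpeval (f_of g) (p(w := t))" for t
    by (simp only: mpeval_f_of assms)
  then have "poly (pderiv P) (p w) = grad (f_of g) p w"
    unfolding grad_def by (rule partial_derivative)
  moreover have "(\<lambda>i. poly (c i) (p w)) = (\<lambda>i. p FU * p (FX i) - p FV * p (FY i))"
    unfolding assms by simp
  ultimately show ?thesis using chain_rule[OF P, of "p w"] by (simp add: grad_def)
qed

lemma grad_f_of:
  fixes g :: "('n::finite, 'k::field_char_0) mpoly"
  defines "q u v x y \<equiv> \<lambda>i. u * x i - v * y i"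
  shows "grad (f_of g) (fpoint u v x y) =
    fpoint (\<Sum>i\<in>UNIV. x i * grad g (q u v x y) i) (- (\<Sum>i\<in>UNIV. y i * grad g (q u v x y) i))
      (\<lambda>i. u * grad g (q u v x y) i) (\<lambda>i. - v * grad g (q u v x y) i)"
proof
  fix w
  let ?p = "fpoint u v x y"
  show "grad (f_of g) ?p w = fpoint (\<Sum>i\<in>UNIV. x i * grad g (q u v x y) i) (- (\<Sum>i\<in>UNIV. y i * grad g (q u v x y) i))
      (\<lambda>i. u * grad g (q u v x y) i) (\<lambda>i. - v * grad g (q u v x y) i) w"
  proof (cases w)
    case FU
    show ?thesis
      using partial_f_of[of "\<lambda>i. [:- (v * y i), x i:]" ?p FU g]
      by (simp add: FU pderiv_pCons q_def)
  next
    case FV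
    show ?thesis
      using partial_f_of[of "\<lambda>i. [:u * x i, - y i:]" ?p FV g]
      by (simp add: FV pderiv_pCons q_def sum_negf)
  next
    case (FX j)
    let ?c = "\<lambda>i. if i = j then [:- (v * y i), u:] else [:u * x i - v * y i:]"
    have d: "poly (pderiv (?c i)) t = (if i = j then 1 else 0) * u" for i t
      by (simp add: pderiv_pCons)
    have "grad (f_of g) ?p (FX j) = (\<Sum>i\<in>UNIV. poly (pderiv (?c i)) (?p (FX j)) *
        grad g (\<lambda>i. ?p FU * ?p (FX i) - ?p FV * ?p (FY i)) i)"
      by (rule partial_f_of) (auto simp: mult.commute)
    then show ?thesis unfolding d mult.assoc sum_delta_mult by (simp add: FX q_def)
  next
    case (FY j)
    let ?c = "\<lambda>i. if i = j then [:u * x i, - v:] else [:u * x i - v * y i:]"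
    have d: "poly (pderiv (?c i)) t = (if i = j then 1 else 0) * (- v)" for i t
      by (simp add: pderiv_pCons)
    have "grad (f_of g) ?p (FY j) = (\<Sum>i\<in>UNIV. poly (pderiv (?c i)) (?p (FY j)) *
        grad g (\<lambda>i. ?p FU * ?p (FX i) - ?p FV * ?p (FY i)) i)"
      by (rule partial_f_of) (auto simp: mult.commute)
    then show ?thesis unfolding d mult.assoc sum_delta_mult by (simp add: FY q_def)
  qed
qed

text \<open>\<open>B\<close> collects the genericity conditions along the curve. Being nonzero, it
  excludes finitely many parameters, and the excluded ones inherit the vanishing.\<close>

lemma vanishing_along_curve:
  assumes B: "B \<noteq> 0" and F: "\<And>t. poly B t \<noteq> 0 \<Longrightarrow> ev F (\<lambda>v. poly (c v) t) = 0"
  shows "ev F (\<lambda>v. poly (c v) t) = 0"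
proof -
  obtain P where P: "\<And>t. ev F (\<lambda>v. poly (c v) t) = poly P t" using ev_along_curve[of F c] by blast
  then have "poly (B * P) t = 0" for t using F[of t] by auto
  then have "B * P = 0" using poly_all_0_iff_0 by blast
  then show ?thesis using B P by simp
qed

section \<open>Zariski closures of cones and of their images\<close>

lemma in_zclosure_iff:
  fixes S :: "('v::finite \<Rightarrow> 'k::field_char_0) set"
  shows "x \<in> zclosure S \<longleftrightarrow> (\<forall>F\<in>van S. ev F x = 0)"
  by (simp add: zclosure_eq_zset zset_def)

lemma zclosure_subset_iff:
  fixes S :: "('v::finite \<Rightarrow> 'k::field_char_0) set"
  assumes "T = zset Q" shows "zclosure S \<subseteq> T \<longleftrightarrow> S \<subseteq> T"
  unfolding zclosure_eq_zset assms by (auto simp: zset_def van_def)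

lemma subset_zclosure:
  fixes S :: "('v::finite \<Rightarrow> 'k::field_char_0) set"
  shows "S \<subseteq> zclosure S"
  by (auto simp: in_zclosure_iff van_def)

lemma van_zclosure [simp]:
  fixes S :: "('v::finite \<Rightarrow> 'k::field_char_0) set"
  shows "van (zclosure S) = van S"
  by (simp add: zclosure_eq_zset)

lemma zclosed_zclosure:
  fixes S :: "('v::finite \<Rightarrow> 'k::field_char_0) set"
  shows "zclosed (zclosure S)"
  unfolding zclosure_eq_zset zclosed_iff_zset by blast

lemma zclosure_image_vanish:
  fixes S :: "('v::finite \<Rightarrow> 'k::field_char_0) set"
  assumes F: "\<And>w. w \<in> S \<Longrightarrow> ev F (\<lambda>v. ev (\<phi> v) w) = 0" and w: "w \<in> zclosure S"
  shows "ev F (\<lambda>v. ev (\<phi> v) w) = 0"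
proof -
  have "pcomp F \<phi> \<in> van S" using F by (auto simp: van_def)
  then have "ev (pcomp F \<phi>) w = 0" using w by (auto simp: in_zclosure_iff)
  then show ?thesis by simp
qed

definition polar_points :: "('v::finite, 'k::field_char_0) mpoly \<Rightarrow> ('v \<Rightarrow> 'k) set" where
  "polar_points h = {(\<lambda>v. c * grad h p v) | c p. p \<noteq> (\<lambda>_. 0) \<and> grad h p \<noteq> (\<lambda>_. 0)}"

definition dual_points :: "('v::finite, 'k::field_char_0) mpoly \<Rightarrow> ('v \<Rightarrow> 'k) set" where
  "dual_points h = {(\<lambda>v. c * grad h p v) | c p. p \<noteq> (\<lambda>_. 0) \<and> mpeval h p = 0 \<and> grad h p \<noteq> (\<lambda>_. 0)}"

lemma polar_image_eq:
  fixes h :: "('v::finite, 'k::field_char_0) mpoly"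
  shows "polar_image h = zclosure (polar_points h)"
  by (simp add: polar_image_def polar_points_def)

lemma dual_variety_eq:
  fixes h :: "('v::finite, 'k::field_char_0) mpoly"
  shows "dual_variety h = zclosure (dual_points h)"
  by (simp add: dual_variety_def dual_points_def)

lemma zclosure_cone:
  fixes S :: "('v::finite \<Rightarrow> 'k::field_char_0) set"
  assumes S: "\<And>w k. w \<in> S \<Longrightarrow> (\<lambda>v. k * w v) \<in> S" and w: "w \<in> zclosure S"
  shows "(\<lambda>v. k * w v) \<in> zclosure S"
  unfolding in_zclosure_iff
proof
  fix F assume F: "F \<in> van S"
  have "ev F (\<lambda>v. ev (cst k * X v) w) = 0"
    by (rule zclosure_image_vanish[OF _ w]) (use F S in \<open>auto simp: van_def\<close>)
  then show "ev F (\<lambda>v. k * w v) = 0" by simp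
qed

lemma polar_image_cone:
  fixes h :: "('v::finite, 'k::field_char_0) mpoly"
  shows "w \<in> polar_image h \<Longrightarrow> (\<lambda>v. k * w v) \<in> polar_image h"
  unfolding polar_image_eq
  by (erule zclosure_cone[rotated]) (auto simp: polar_points_def simp flip: mult.assoc, blast)

lemma dual_variety_cone:
  fixes h :: "('v::finite, 'k::field_char_0) mpoly"
  shows "w \<in> dual_variety h \<Longrightarrow> (\<lambda>v. k * w v) \<in> dual_variety h"
  unfolding dual_variety_eq
  by (erule zclosure_cone[rotated]) (auto simp: dual_points_def simp flip: mult.assoc, blast)

lemma exists_linear_solution:
  fixes a :: "'n::finite \<Rightarrow> 'k::field"
  assumes "a \<noteq> (\<lambda>_. 0)" shows "\<exists>y. (\<Sum>i\<in>UNIV. y i * a i) = r"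
proof -
  obtain j where j: "a j \<noteq> 0" using assms by auto
  have "(\<Sum>i\<in>UNIV. ((if i = j then 1 else 0) * (r / a j)) * a i) = r"
    unfolding mult.assoc sum_delta_mult using j by simp
  then show ?thesis by (intro exI[of _ "\<lambda>i. (if i = j then 1 else 0) * (r / a j)"])
qed

context
  fixes g :: "('n::finite, 'k::field_char_0) mpoly" and d :: nat
  assumes hom: "mp_homogeneous d g" and d: "d \<ge> 2"
begin

text \<open>Take u = s * \<alpha> and v = - s * \<beta>, choose \<open>y\<close> for the second
  entry, and solve u x - v y = q for \<open>x\<close>; the first entry is then forced by Euler's
  identity. The scale \<open>s\<close> stays free because it multiplies the \<alpha> and \<beta>
  blocks but divides the Euler term.\<close>

lemma grad_f_of_prescribed:
  assumes nz: "\<alpha> \<noteq> 0" "s \<noteq> 0" and gr: "grad g q \<noteq> (\<lambda>_. 0)"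
  shows "\<exists>p. p \<noteq> (\<lambda>_. 0) \<and> mpeval (f_of g) p = mpeval g q \<and> grad (f_of g) p \<noteq> (\<lambda>_. 0) \<and>
    grad (f_of g) p = fpoint ((of_nat d * mpeval g q / s - \<beta> * r) / \<alpha>) (- r)
      (\<lambda>i. s * \<alpha> * grad g q i) (\<lambda>i. s * \<beta> * grad g q i)"
proof -
  obtain y where y: "(\<Sum>i\<in>UNIV. y i * grad g q i) = r" using exists_linear_solution[OF gr] by blast
  define x where "x = (\<lambda>i. (q i / s - \<beta> * y i) / \<alpha>)"
  let ?p = "fpoint (s * \<alpha>) (- (s * \<beta>)) x y"
  have q: "(\<lambda>i. s * \<alpha> * x i - (- (s * \<beta>)) * y i) = q"
    using nz by (auto simp: x_def fun_eq_iff field_simps)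
  have "(\<Sum>i\<in>UNIV. x i * grad g q i) = ((\<Sum>i\<in>UNIV. q i * grad g q i) / s - \<beta> * (\<Sum>i\<in>UNIV. y i * grad g q i)) / \<alpha>"
    by (simp add: x_def sum_divide_distrib sum_subtractf[symmetric] sum_distrib_left)
      (intro sum.cong, auto simp: field_simps)
  also have "\<dots> = (of_nat d * mpeval g q / s - \<beta> * r) / \<alpha>" using euler_identity[OF hom] y by simp
  finally have grad: "grad (f_of g) ?p = fpoint ((of_nat d * mpeval g q / s - \<beta> * r) / \<alpha>) (- r)
      (\<lambda>i. s * \<alpha> * grad g q i) (\<lambda>i. s * \<beta> * grad g q i)"
    unfolding grad_f_of q by (simp add: y)
  obtain j where j: "grad g q j \<noteq> 0" using gr by auto
  have "?p FU \<noteq> 0" "grad (f_of g) ?p (FX j) \<noteq> 0" unfolding grad using nz j by simp_all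
  then have "?p \<noteq> (\<lambda>_. 0)" "grad (f_of g) ?p \<noteq> (\<lambda>_. 0)" by metis+
  moreover have "mpeval (f_of g) ?p = mpeval g q" unfolding mpeval_f_of using q by simp
  ultimately show ?thesis using grad by blast
qed

lemma nonzero_grad_imp_nonzero: "grad g q \<noteq> (\<lambda>_. 0) \<Longrightarrow> q \<noteq> (\<lambda>_. 0)"
  using grad_at_0[OF hom d] by metis

lemma grad_f_of_nonzero_imp:
  assumes "grad (f_of g) (fpoint u v x y) \<noteq> (\<lambda>_. 0)"
  shows "grad g (\<lambda>i. u * x i - v * y i) \<noteq> (\<lambda>_. 0)" "(u, v) \<noteq> (0, 0)"
proof -
  show *: "grad g (\<lambda>i. u * x i - v * y i) \<noteq> (\<lambda>_. 0)"
  proof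
    assume "grad g (\<lambda>i. u * x i - v * y i) = (\<lambda>_. 0)"
    then have "grad (f_of g) (fpoint u v x y) = fpoint 0 0 (\<lambda>_. 0) (\<lambda>_. 0)" unfolding grad_f_of by simp
    also have "\<dots> = (\<lambda>_. 0)" by (rule ext) (simp add: fpoint_def split: fvar.split)
    finally show False using assms by simp
  qed
  show "(u, v) \<noteq> (0, 0)" using nonzero_grad_imp_nonzero[OF *] by auto
qed

lemma polar_image_f_of_subset: "polar_image (f_of g) \<subseteq> cone_segre (polar_image g)"
proof -
  let ?S = "{fpoint u' v' (\<lambda>i. \<alpha> * z i) (\<lambda>i. \<beta> * z i) | u' v' \<alpha> \<beta> z.
      (\<alpha>, \<beta>) \<noteq> (0, 0) \<and> z \<in> polar_image g \<and> z \<noteq> (\<lambda>_. 0)}"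
  have "polar_points (f_of g) \<subseteq> zclosure ?S"
  proof
    fix w assume "w \<in> polar_points (f_of g)"
    then obtain c p where w: "w = (\<lambda>v. c * grad (f_of g) p v)" and gr: "grad (f_of g) p \<noteq> (\<lambda>_. 0)"
      by (auto simp: polar_points_def)
    obtain u v x y where p: "p = fpoint u v x y" by (rule fpoint_cases)
    let ?q = "\<lambda>i. u * x i - v * y i"
    note * = grad_f_of_nonzero_imp[OF gr[unfolded p]]
    have mem: "(\<lambda>v. c * grad (f_of g) p v) \<in> ?S" if c: "c \<noteq> 0" for c
    proof -
      let ?z = "\<lambda>i. c * grad g ?q i"
      have "?z \<in> polar_points g"
        unfolding polar_points_def using * nonzero_grad_imp_nonzero[OF *(1)] by blast
      then have "?z \<in> polar_image g" using subset_zclosure polar_image_eq by blast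
      moreover have "?z \<noteq> (\<lambda>_. 0)" using *(1) c by (auto simp: fun_eq_iff)
      moreover have "(\<lambda>v. c * grad (f_of g) p v) = fpoint (c * (\<Sum>i\<in>UNIV. x i * grad g ?q i))
          (c * - (\<Sum>i\<in>UNIV. y i * grad g ?q i)) (\<lambda>i. u * ?z i) (\<lambda>i. - v * ?z i)"
        unfolding p grad_f_of by (rule ext) (simp add: fpoint_def split: fvar.split)
      moreover have "(u, - v) \<noteq> (0, 0)" using *(2) by auto
      ultimately show ?thesis
        by (intro CollectI exI[of _ "c * (\<Sum>i\<in>UNIV. x i * grad g ?q i)"]
          exI[of _ "c * - (\<Sum>i\<in>UNIV. y i * grad g ?q i)"] exI[of _ u] exI[of _ "- v"] exI[of _ ?z]) blast
    qed
    show "w \<in> zclosure ?S"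
      unfolding in_zclosure_iff
    proof
      fix F assume F: "F \<in> van ?S"
      \<comment> \<open>The multiple with \<open>c = 0\<close> is the zero vector, which
        \<open>?S\<close> excludes; it is reached along the line of the other multiples.\<close>
      have "ev F (\<lambda>v. poly [:0, grad (f_of g) p v:] c) = 0"
        by (rule vanishing_along_curve[of "[:0, 1:]"]) (use F mem in \<open>auto simp: van_def\<close>)
      then show "ev F w = 0" by (simp add: w)
    qed
  qed
  then have "zclosure (polar_points (f_of g)) \<subseteq> zclosure ?S"
    by (subst zclosure_subset_iff[OF zclosure_eq_zset])
  then show ?thesis by (simp only: polar_image_eq[of "f_of g"] cone_segre_def)
qed

lemma cone_segre_subset:
  assumes alg: "\<And>p :: 'k poly. degree p > 0 \<Longrightarrow> \<exists>x. poly p x = 0" and g0: "g \<noteq> 0"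
    and smooth: "grad g q1 \<noteq> (\<lambda>_. 0)"
  shows "cone_segre (polar_image g) \<subseteq> polar_image (f_of g)"
proof -
  have generic: "ev F (fpoint u' v' (\<lambda>i. \<alpha> * (k * grad g q i)) (\<lambda>i. \<beta> * (k * grad g q i))) = 0"
    if F: "F \<in> van (polar_points (f_of g))" and nz: "\<alpha> \<noteq> 0" "k \<noteq> 0" "\<alpha> * u' - \<beta> * v' \<noteq> 0"
      "mpeval g q \<noteq> 0" "grad g q \<noteq> (\<lambda>_. 0)" for F u' v' \<alpha> \<beta> k q
  proof -
    let ?D = "of_nat d * mpeval g q"
    \<comment> \<open>After scaling the prescribed gradient by \<open>k / s\<close>, Euler's
      identity reads \<alpha> * u' - \<beta> * v' = k * ?D / (s * s). So \<open>s\<close> has to be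
      a square root of \<open>?w\<close>, which is where algebraic closedness enters.\<close>
    let ?w = "k * ?D / (\<alpha> * u' - \<beta> * v')"
    obtain s where "poly [:- ?w, 0, 1:] s = 0" using alg[of "[:- ?w, 0, 1:]"] by auto
    then have s: "s * s = ?w" by (simp add: algebra_simps)
    have D: "?D \<noteq> 0" using nz d by simp
    then have s0: "s \<noteq> 0" using s nz by auto
    have ss: "k * ?D = (\<alpha> * u' - \<beta> * v') * (s * s)" using nz by (simp add: s)
    obtain p where p: "p \<noteq> (\<lambda>_. 0)" "grad (f_of g) p \<noteq> (\<lambda>_. 0)"
      "grad (f_of g) p = fpoint ((?D / s - \<beta> * (- (v' * s / k))) / \<alpha>) (- (- (v' * s / k)))
        (\<lambda>i. s * \<alpha> * grad g q i) (\<lambda>i. s * \<beta> * grad g q i)"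
      using grad_f_of_prescribed[OF nz(1) s0 nz(5), of \<beta> "- (v' * s / k)"] by blast
    have "k / s * ((?D / s - \<beta> * (- (v' * s / k))) / \<alpha>) = (k * ?D / (s * s) + \<beta> * v') / \<alpha>"
      using nz s0 by (simp add: field_simps)
    also have "\<dots> = u'" using nz(1) s0 unfolding ss by (simp add: field_simps)
    finally have u': "k / s * ((?D / s - \<beta> * (- (v' * s / k))) / \<alpha>) = u'" .
    have "(\<lambda>v. k / s * grad (f_of g) p v)
        = fpoint u' v' (\<lambda>i. \<alpha> * (k * grad g q i)) (\<lambda>i. \<beta> * (k * grad g q i))" (is "?l = ?r")
    proof
      fix w show "?l w = ?r w"
        unfolding p(3) using s0 nz(2) by (cases w) (simp_all only: fpoint_simps u', simp_all)
    qed
    moreover have "(\<lambda>v. k / s * grad (f_of g) p v) \<in> polar_points (f_of g)"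
      unfolding polar_points_def using p(1,2) by blast
    ultimately show ?thesis using F by (simp add: van_def)
  qed
  \<comment> \<open>A single point off the hypersurface at which the gradient is nonzero too; it
    will serve as the generic end of the curve.\<close>
  obtain j where j: "grad g q1 j \<noteq> 0" using smooth by auto
  have "mp (mpderiv j g) \<noteq> 0" using j by (metis ev_0 ev_mp grad_def)
  moreover have "mp g \<noteq> 0" using g0 by (metis mp_0 mp_inject)
  ultimately have "mp g * mp (mpderiv j g) \<noteq> 0" by simp
  then obtain q0 where "ev (mp g * mp (mpderiv j g)) q0 \<noteq> 0" by (rule pfun_neq_0E)
  then have q0: "mpeval g q0 \<noteq> 0" "grad g q0 j \<noteq> 0" by (auto simp: grad_def)
  have all: "ev F (fpoint u' v' (\<lambda>i. \<alpha> * (k * grad g q i)) (\<lambda>i. \<beta> * (k * grad g q i))) = 0"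
    if F: "F \<in> van (polar_points (f_of g))" for F u' v' \<alpha> \<beta> k q
  proof -
    \<comment> \<open>All parameters move linearly from the given values at t = 0 to u' = \<alpha> =
      k = 1, v' = \<beta> = 0 and \<open>q0\<close> at t = 1, where every condition of
      \<open>generic\<close> holds.\<close>
    define cu where "cu = [:u', 1 - u':]"
    define cv where "cv = [:v', - v':]"
    define ca where "ca = [:\<alpha>, 1 - \<alpha>:]"
    define cb where "cb = [:\<beta>, - \<beta>:]"
    define ck where "ck = [:k, 1 - k:]"
    let ?q = "\<lambda>v. [:q v, q0 v - q v:]"
    obtain G where G: "\<And>t. poly G t = mpeval g (\<lambda>v. poly (?q v) t)"
      using mpeval_along_curve[of g ?q] by blast
    have "\<exists>P. \<forall>t. poly P t = grad g (\<lambda>v. poly (?q v) t) i" for i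
      unfolding grad_def using mpeval_along_curve[of "mpderiv i g" ?q] by fast
    then obtain c where c: "\<And>i t. poly (c i) t = grad g (\<lambda>v. poly (?q v) t) i"
      using choice[of "\<lambda>i P. \<forall>t. poly P t = grad g (\<lambda>v. poly (?q v) t) i"] by auto
    define C where "C = fpoint cu cv (\<lambda>i. ca * (ck * c i)) (\<lambda>i. cb * (ck * c i))"
    have evC: "(\<lambda>w. poly (C w) t) = fpoint (poly cu t) (poly cv t)
        (\<lambda>i. poly ca t * (poly ck t * grad g (\<lambda>v. poly (?q v) t) i))
        (\<lambda>i. poly cb t * (poly ck t * grad g (\<lambda>v. poly (?q v) t) i))" for t
      by (rule ext) (simp add: C_def fpoint_def c split: fvar.split)
    let ?B = "ca * ck * (ca * cu - cb * cv) * G * c j"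
    have "poly cu 1 = 1" "poly cv 1 = 0" "poly ca 1 = 1" "poly cb 1 = 0" "poly ck 1 = 1"
      "poly G 1 = mpeval g q0" "poly (c j) 1 = grad g q0 j"
      by (simp_all add: G c ca_def cb_def ck_def cu_def cv_def)
    then have "poly ?B 1 \<noteq> 0" using q0 by simp
    then have B: "?B \<noteq> 0" by (metis poly_0)
    have "ev F (\<lambda>w. poly (C w) 0) = 0"
    proof (rule vanishing_along_curve[OF B])
      fix t assume t: "poly ?B t \<noteq> 0"
      then have "poly (c j) t \<noteq> 0" by simp
      then have "grad g (\<lambda>v. poly (?q v) t) \<noteq> (\<lambda>_. 0)" unfolding c by (metis (full_types))
      moreover have "mpeval g (\<lambda>v. poly (?q v) t) \<noteq> 0" using t unfolding G[symmetric] by simp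
      moreover have "poly ca t \<noteq> 0" "poly ck t \<noteq> 0" "poly ca t * poly cu t - poly cb t * poly cv t \<noteq> 0"
        using t by simp_all
      ultimately show "ev F (\<lambda>w. poly (C w) t) = 0"
        unfolding evC by (intro generic[OF F])
    qed
    then show ?thesis unfolding evC by (simp add: cu_def cv_def ca_def cb_def ck_def)
  qed
  have "fpoint u' v' (\<lambda>i. \<alpha> * z i) (\<lambda>i. \<beta> * z i) \<in> polar_image (f_of g)"
    if z: "z \<in> polar_image g" for u' v' \<alpha> \<beta> z
    unfolding polar_image_eq[of "f_of g"] in_zclosure_iff
  proof
    fix F assume F: "F \<in> van (polar_points (f_of g))"
    \<comment> \<open>The point is polynomial in \<open>z\<close>, so the vanishing passes from
      actual gradients to their closure.\<close>
    let ?\<phi> = "fpoint (cst u') (cst v') (\<lambda>i. cst \<alpha> * X i) (\<lambda>i. cst \<beta> * X i)"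
    have phi: "(\<lambda>w. ev (?\<phi> w) z) = fpoint u' v' (\<lambda>i. \<alpha> * z i) (\<lambda>i. \<beta> * z i)" for z
      by (rule ext) (simp add: fpoint_def split: fvar.split)
    have "ev F (\<lambda>w. ev (?\<phi> w) z) = 0"
    proof (rule zclosure_image_vanish[OF _ z[unfolded polar_image_eq]])
      fix z assume "z \<in> polar_points g"
      then obtain k q where "z = (\<lambda>v. k * grad g q v)" by (auto simp: polar_points_def)
      then show "ev F (\<lambda>w. ev (?\<phi> w) z) = 0" unfolding phi using all[OF F] by simp
    qed
    then show "ev F (fpoint u' v' (\<lambda>i. \<alpha> * z i) (\<lambda>i. \<beta> * z i)) = 0" by (simp only: phi)
  qed
  then have sub: "{fpoint u' v' (\<lambda>i. \<alpha> * z i) (\<lambda>i. \<beta> * z i) | u' v' \<alpha> \<beta> z.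
      (\<alpha>, \<beta>) \<noteq> (0, 0) \<and> z \<in> polar_image g \<and> z \<noteq> (\<lambda>_. 0)} \<subseteq> polar_image (f_of g)"
    by blast
  show ?thesis
    unfolding cone_segre_def using sub
    by (subst zclosure_subset_iff[OF polar_image_eq[of "f_of g", unfolded zclosure_eq_zset]])
qed

text \<open>The Segre cone consists of the rank-one matrices with rows \<open>(v', x')\<close> and \<open>(u', y')\<close> both of
  whose \<open>n\<close>-parts lie in \<open>Y\<close>; this makes closedness visible.\<close>

lemma segre_cone_over_eq:
  fixes Y :: "('n \<Rightarrow> 'k) set"
  assumes cone: "\<And>w k. w \<in> Y \<Longrightarrow> (\<lambda>v. k * w v) \<in> Y"
  shows "segre_cone_over Y = {z. (\<forall>i j. z (FX i) * z (FY j) = z (FX j) * z (FY i)) \<and>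
    (\<forall>i. z FV * z (FY i) = z FU * z (FX i)) \<and> (\<lambda>i. z (FX i)) \<in> Y \<and> (\<lambda>i. z (FY i)) \<in> Y}"
    (is "_ = ?T")
proof (intro set_eqI iffI)
  fix z assume "z \<in> segre_cone_over Y"
  then show "z \<in> ?T" by (auto simp: segre_cone_over_def cone)
next
  fix z assume z: "z \<in> ?T"
  have "\<exists>\<alpha> \<beta> w0 w. w \<in> Y \<and> z FU = \<beta> * w0 \<and> z FV = \<alpha> * w0 \<and> (\<forall>i. z (FX i) = \<alpha> * w i) \<and> (\<forall>i. z (FY i) = \<beta> * w i)"
  \<comment> \<open>If the row of \<open>FV\<close> and \<open>FX\<close> is zero, take \<alpha> = 0
    and \<beta> = 1. Otherwise the other row is a multiple of it, and \<alpha> = 1.\<close>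
  proof (cases "z FV = 0 \<and> (\<forall>i. z (FX i) = 0)")
    case True
    then show ?thesis using z
      by (intro exI[of _ 0] exI[of _ 1] exI[of _ "z FU"] exI[of _ "\<lambda>i. z (FY i)"]) auto
  next
    case False
    have "\<exists>\<beta>. z FU = \<beta> * z FV \<and> (\<forall>i. z (FY i) = \<beta> * z (FX i))"
    proof (cases "z FV = 0")
      case True
      then obtain i where i: "z (FX i) \<noteq> 0" using False by blast
      have "z FU * z (FX i) = 0" using z True by (auto dest: spec[of _ i])
      then have "z FU = z (FY i) / z (FX i) * z FV" using True i by simp
      moreover have "z (FY j) = z (FY i) / z (FX i) * z (FX j)" for j
      proof -
        have "z (FX i) * z (FY j) = z (FX j) * z (FY i)" using z by blast
        then show ?thesis using i by (simp add: field_simps)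
      qed
      ultimately show ?thesis by blast
    next
      case False
      have "z (FY i) = z FU / z FV * z (FX i)" for i
      proof -
        have "z FV * z (FY i) = z FU * z (FX i)" using z by blast
        then show ?thesis using False by (simp add: field_simps)
      qed
      then show ?thesis using False by (intro exI[of _ "z FU / z FV"]) simp
    qed
    then obtain \<beta> where "z FU = \<beta> * z FV" "\<forall>i. z (FY i) = \<beta> * z (FX i)" by blast
    then show ?thesis using z
      by (intro exI[of _ 1] exI[of _ \<beta>] exI[of _ "z FV"] exI[of _ "\<lambda>i. z (FX i)"]) auto
  qed
  then obtain \<alpha> \<beta> w0 w where *: "w \<in> Y" "z FU = \<beta> * w0" "z FV = \<alpha> * w0"
    "\<And>i. z (FX i) = \<alpha> * w i" "\<And>i. z (FY i) = \<beta> * w i" by blast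
  have "z = fpoint (\<beta> * w0) (\<alpha> * w0) (\<lambda>i. \<alpha> * w i) (\<lambda>i. \<beta> * w i)"
    using fpoint_eta[of z] * by simp
  then show "z \<in> segre_cone_over Y" unfolding segre_cone_over_def using *(1) by blast
qed

lemma dual_variety_f_of: "dual_variety (f_of g) = segre_cone_over (dual_variety g)"
proof
  let ?Y = "dual_variety g"
  note cone = dual_variety_cone[of _ g]
  have eq: "segre_cone_over ?Y = {z. (\<forall>i j. z (FX i) * z (FY j) = z (FX j) * z (FY i)) \<and>
      (\<forall>i. z FV * z (FY i) = z FU * z (FX i)) \<and> (\<lambda>i. z (FX i)) \<in> ?Y \<and> (\<lambda>i. z (FY i)) \<in> ?Y}"
    by (rule segre_cone_over_eq) (rule cone)
  \<comment> \<open>The 2 by 2 minors, and the equations of \<open>Y\<close> imposed on each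
    row.\<close>
  let ?E = "(\<Union>i j. {X (FX i) * X (FY j) - X (FX j) * X (FY i)})
    \<union> (\<Union>i. {X FV * X (FY i) - X FU * X (FX i)})
    \<union> (\<lambda>p. pcomp p (\<lambda>i. X (FX i))) ` van ?Y \<union> (\<lambda>p. pcomp p (\<lambda>i. X (FY i))) ` van ?Y
    :: ('n fvar, 'k) pfun set"
  have Y: "w \<in> ?Y \<longleftrightarrow> (\<forall>p\<in>van ?Y. ev p w = 0)" for w
    unfolding dual_variety_eq by (simp add: in_zclosure_iff)
  have zE: "segre_cone_over ?Y = zset ?E"
    unfolding eq by (auto simp: zset_def Y ball_Un)
  have "dual_points (f_of g) \<subseteq> segre_cone_over ?Y"
  proof
    fix w assume "w \<in> dual_points (f_of g)"
    then obtain c p where w: "w = (\<lambda>v. c * grad (f_of g) p v)" and gr: "grad (f_of g) p \<noteq> (\<lambda>_. 0)"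
      and fp: "mpeval (f_of g) p = 0" by (auto simp: dual_points_def)
    obtain u v x y where p: "p = fpoint u v x y" by (rule fpoint_cases)
    let ?q = "\<lambda>i. u * x i - v * y i"
    let ?a = "\<Sum>i\<in>UNIV. x i * grad g ?q i" and ?b = "\<Sum>i\<in>UNIV. y i * grad g ?q i"
    note * = grad_f_of_nonzero_imp[OF gr[unfolded p]]
    have gq: "mpeval g ?q = 0" using fp by (simp add: p mpeval_f_of)
    have "(\<Sum>i\<in>UNIV. ?q i * grad g ?q i) = u * ?a - v * ?b"
      by (simp add: left_diff_distrib sum_subtractf sum_distrib_left mult.assoc)
    \<comment> \<open>With g(q) = 0, Euler's identity becomes precisely the minor that involves
      \<open>FU\<close> and \<open>FV\<close>.\<close>
    then have ab: "u * ?a = v * ?b" using euler_identity[OF hom, of ?q] gq by simp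
    have "(\<lambda>i. c * grad g ?q i) \<in> dual_points g"
      unfolding dual_points_def using * gq nonzero_grad_imp_nonzero[OF *(1)] by blast
    then have Yc: "(\<lambda>i. c * grad g ?q i) \<in> ?Y" using subset_zclosure dual_variety_eq by blast
    have wp: "w = fpoint (c * ?a) (c * - ?b) (\<lambda>i. u * (c * grad g ?q i)) (\<lambda>i. - v * (c * grad g ?q i))"
      unfolding w p grad_f_of by (rule ext) (simp add: fpoint_def split: fvar.split)
    show "w \<in> segre_cone_over ?Y"
      unfolding eq
    proof (intro CollectI conjI allI)
      show "(\<lambda>i. w (FX i)) \<in> ?Y" "(\<lambda>i. w (FY i)) \<in> ?Y"
        unfolding wp fpoint_simps by (rule cone[OF Yc])+
      show "w (FX i) * w (FY j) = w (FX j) * w (FY i)" for i j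
        unfolding wp fpoint_simps by (simp only: mult_ac)
      show "w FV * w (FY i) = w FU * w (FX i)" for i
      proof -
        have "w FV * w (FY i) = (v * ?b) * (c * (c * grad g ?q i))"
          unfolding wp fpoint_simps by (simp add: mult_ac)
        also have "\<dots> = w FU * w (FX i)" unfolding ab[symmetric] wp fpoint_simps by (simp only: mult_ac)
        finally show ?thesis .
      qed
    qed
  qed
  then show "dual_variety (f_of g) \<subseteq> segre_cone_over ?Y"
    unfolding dual_variety_eq[of "f_of g"] by (subst zclosure_subset_iff[OF zE])
  show "segre_cone_over ?Y \<subseteq> dual_variety (f_of g)"
  proof
    fix z assume "z \<in> segre_cone_over ?Y"
    then obtain \<alpha> \<beta> w0 w where z: "z = fpoint (\<beta> * w0) (\<alpha> * w0) (\<lambda>i. \<alpha> * w i) (\<lambda>i. \<beta> * w i)"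
      and w: "w \<in> ?Y" by (auto simp: segre_cone_over_def)
    show "z \<in> dual_variety (f_of g)"
      unfolding dual_variety_eq[of "f_of g"] in_zclosure_iff
    proof
      fix F assume F: "F \<in> van (dual_points (f_of g))"
      let ?\<phi> = "fpoint (cst (\<beta> * w0)) (cst (\<alpha> * w0)) (\<lambda>i. cst \<alpha> * X i) (\<lambda>i. cst \<beta> * X i)"
      have phi: "(\<lambda>v. ev (?\<phi> v) w) = fpoint (\<beta> * w0) (\<alpha> * w0) (\<lambda>i. \<alpha> * w i) (\<lambda>i. \<beta> * w i)" for w
        by (rule ext) (simp add: fpoint_def split: fvar.split)
      have "ev F (\<lambda>v. ev (?\<phi> v) w) = 0"
      proof (rule zclosure_image_vanish[OF _ w[unfolded dual_variety_eq]])
        fix w assume "w \<in> dual_points g"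
        then obtain k q where wq: "w = (\<lambda>v. k * grad g q v)" and gq: "mpeval g q = 0"
          and gr: "grad g q \<noteq> (\<lambda>_. 0)" by (auto simp: dual_points_def)
        \<comment> \<open>\<alpha> and \<open>k\<close> are shifted by \<open>t\<close> because both
          are divided by below.\<close>
        define C where "C = fpoint [:\<beta> * w0:] ([:\<alpha>, 1:] * [:w0:])
          (\<lambda>i. [:\<alpha>, 1:] * ([:k, 1:] * [:grad g q i:])) (\<lambda>i. [:\<beta>:] * ([:k, 1:] * [:grad g q i:]))"
        have evC': "poly (C v) t = fpoint (\<beta> * w0) ((\<alpha> + t) * w0)
          (\<lambda>i. (\<alpha> + t) * ((k + t) * grad g q i)) (\<lambda>i. \<beta> * ((k + t) * grad g q i)) v" for t v
          by (simp add: C_def fpoint_def algebra_simps split: fvar.split)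
        then have evC: "(\<lambda>v. poly (C v) t) = fpoint (\<beta> * w0) ((\<alpha> + t) * w0)
          (\<lambda>i. (\<alpha> + t) * ((k + t) * grad g q i)) (\<lambda>i. \<beta> * ((k + t) * grad g q i))" for t
          by (rule ext)
        have "ev F (\<lambda>v. poly (C v) 0) = 0"
        proof (rule vanishing_along_curve[of "[:\<alpha>, 1:] * [:k, 1:]"])
          fix t assume "poly ([:\<alpha>, 1:] * [:k, 1:]) t \<noteq> 0"
          then have nz: "\<alpha> + t \<noteq> 0" "k + t \<noteq> 0" unfolding poly_mult by simp_all
          \<comment> \<open>Since g(q) = 0, the Euler term is absent and s = 1 serves. The value of
            \<open>r\<close> is chosen so that multiplication by \<open>k + t\<close> turns the
            first two entries into \<beta> * w0 and (\<alpha> + t) * w0.\<close>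
          obtain p where p: "p \<noteq> (\<lambda>_. 0)" "mpeval (f_of g) p = 0" "grad (f_of g) p \<noteq> (\<lambda>_. 0)"
            "grad (f_of g) p = fpoint ((0 - \<beta> * (- ((\<alpha> + t) * w0 / (k + t)))) / (\<alpha> + t)) (- (- ((\<alpha> + t) * w0 / (k + t))))
              (\<lambda>i. 1 * (\<alpha> + t) * grad g q i) (\<lambda>i. 1 * \<beta> * grad g q i)"
            using grad_f_of_prescribed[OF nz(1) one_neq_zero gr, of \<beta> "- ((\<alpha> + t) * w0 / (k + t))"] gq
            by auto
          have "(\<lambda>v. poly (C v) t) = (\<lambda>v. (k + t) * grad (f_of g) p v)" (is "?l = ?r")
          proof
            fix v show "?l v = ?r v"
              unfolding evC' p(4) using nz by (cases v) (simp_all only: fpoint_simps, simp_all)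
          qed
          moreover have "(\<lambda>v. (k + t) * grad (f_of g) p v) \<in> dual_points (f_of g)"
            unfolding dual_points_def using p(1-3) by blast
          ultimately show "ev F (\<lambda>v. poly (C v) t) = 0" using F by (simp add: van_def)
        qed simp
        then show "ev F (\<lambda>v. ev (?\<phi> v) w) = 0" unfolding phi evC wq by simp
      qed
      then show "ev F z = 0" by (simp only: phi z)
    qed
  qed
qed

end

lemma polar_image_UNIV:
  fixes g :: "('n::finite, 'k::field_char_0) mpoly"
  assumes hess: "hessian g \<noteq> 0" and hom: "mp_homogeneous d g" and d: "d \<ge> 2"
    and smooth: "grad g q1 \<noteq> (\<lambda>_. 0)"
  shows "polar_image g = UNIV"
proof -
  obtain j where j: "grad g q1 j \<noteq> 0" using smooth by auto
  have "ev F y = 0" if F: "F \<in> van (polar_points g)" for F y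
  proof -
    obtain F' where F': "mp F' = F" using mp_surj by blast
    \<comment> \<open>\<open>F\<close> is known to vanish only at nonzero gradients; the segment
      towards \<open>q1\<close> extends this to all gradients.\<close>
    have rel: "mpeval F' (grad g a) = 0" for a
    proof -
      let ?c = "\<lambda>v. [:a v, q1 v - a v:]"
      have "\<exists>P. \<forall>t. poly P t = grad g (\<lambda>v. poly (?c v) t) i" for i
        unfolding grad_def using mpeval_along_curve[of "mpderiv i g" ?c] by fast
      then obtain c where c: "\<And>i t. poly (c i) t = grad g (\<lambda>v. poly (?c v) t) i"
        using choice[of "\<lambda>i P. \<forall>t. poly P t = grad g (\<lambda>v. poly (?c v) t) i"] by auto
      have "poly (c j) 1 \<noteq> 0" using j by (simp add: c)
      then have cj: "c j \<noteq> 0" by (metis poly_0)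
      have "ev F (\<lambda>i. poly (c i) 0) = 0"
      proof (rule vanishing_along_curve[OF cj])
        fix t assume t: "poly (c j) t \<noteq> 0"
        let ?q = "\<lambda>v. poly (?c v) t"
        have gq: "grad g ?q \<noteq> (\<lambda>_. 0)" using t unfolding c by (metis (full_types))
        then have "(\<lambda>v. 1 * grad g ?q v) \<in> polar_points g"
          unfolding polar_points_def using nonzero_grad_imp_nonzero[OF hom d gq] by blast
        then show "ev F (\<lambda>i. poly (c i) t) = 0" unfolding c using F by (simp add: van_def)
      qed
      then show ?thesis unfolding c F'[symmetric] by simp
    qed
    let ?N = "Max (insert 0 ((\<lambda>m. \<Sum>v\<in>UNIV. Poly_Mapping.lookup m v) ` Poly_Mapping.keys F'))"
    have "mpeval F' y = 0"
      by (rule hessian_no_relation[OF hess _ rel, where N = ?N]) (auto intro!: Max_ge)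
    then show ?thesis using F' by auto
  qed
  then show ?thesis unfolding polar_image_eq by (auto simp: in_zclosure_iff)
qed

section \<open>Dimensions of the Segre cones\<close>

text \<open>On the line through \<open>w\<close> the coordinate \<open>i\<close> takes every value.
  This yields dimension at least 1, hence a nonempty coordinate basis.\<close>

lemma cone_indep_singleton:
  fixes S :: "('v::finite \<Rightarrow> 'k::field_char_0) set"
  assumes cone: "\<And>w k. w \<in> S \<Longrightarrow> (\<lambda>v. k * w v) \<in> S" and w: "w \<in> S" "w i \<noteq> 0"
  shows "indep (van S) X {i}"
  unfolding indep_X
proof (safe, rule pfun_eqI)
  fix F a assume F: "F \<in> van S" "F \<in> pfun_in {i}"
  have "ev F a = ev F (\<lambda>v. a i / w i * w v)" by (rule ev_pfun_in_cong[OF F(2)]) (use w in auto)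
  also have "\<dots> = 0" using F(1) cone[OF w(1), of "a i / w i"] unfolding van_def by blast
  finally show "ev F a = ev 0 a" by simp
qed

context alg_closed_field
begin

text \<open>The upper bound for images: \<phi> is a parametrisation by \<open>Y\<close> times an
  affine space with coordinates \<open>Inr\<close>. A coordinate basis of the product splits into a
  part independent on \<open>Y\<close> and at most \<open>CARD('e)\<close> further
  coordinates.\<close>

lemma indep_card_le_product:
  fixes Y :: "('n::finite \<Rightarrow> 'k) set" and \<phi> :: "'w \<Rightarrow> ('n + 'e::finite, 'k) pfun"
  assumes Y: "zclosed Y" "Y \<noteq> {}" and I: "finite I"
    and indep: "indep (van {a. (\<lambda>i. a (Inl i)) \<in> Y}) \<phi> I"
  shows "card I \<le> kdim Y + CARD('e)"
proof -
  let ?T = "{a :: 'n + 'e \<Rightarrow> 'k. (\<lambda>i. a (Inl i)) \<in> Y}"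
  have Ymem: "y \<in> Y \<longleftrightarrow> (\<forall>p\<in>van Y. ev p y = 0)" for y
    using Y(1) unfolding zclosed_iff zset_def by blast
  have "?T = zset ((\<lambda>p. pcomp p (\<lambda>i. X (Inl i))) ` van Y)"
    by (auto simp: zset_def Ymem)
  then have T: "zclosed ?T" unfolding zclosed_iff_zset by blast
  have ext: "\<exists>a :: 'n + 'e \<Rightarrow> 'k. (\<lambda>i. a (Inl i)) = y" for y
    by (intro exI[of _ "case_sum y (\<lambda>_. 0)"]) simp
  obtain y where "y \<in> Y" using Y(2) by blast
  moreover obtain a :: "'n + 'e \<Rightarrow> 'k" where "(\<lambda>i. a (Inl i)) = y" using ext by blast
  ultimately have T0: "?T \<noteq> {}" by blast
  obtain B :: "('n + 'e) set" where B: "indep (van ?T) X B" "card B = kdim ?T"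
    using kdim_witness[OF T T0] by blast
  let ?B = "Inl -` B"
  have "indep (van Y) X ?B"
    unfolding indep_X
  proof (safe)
    fix F assume F: "F \<in> van Y" "F \<in> pfun_in ?B"
    let ?F = "pcomp F (\<lambda>i. X (Inl i)) :: ('n + 'e, 'k) pfun"
    have "?F \<in> pfun_in B"
      using F(2) by (induction rule: pfun_in.induct) (auto simp: pcomp_add pcomp_mult intro: pfun_in.intros)
    moreover have "?F \<in> van ?T" using F(1) by (auto simp: van_def)
    ultimately have F0: "?F = 0" using B(1) by (auto simp: indep_X)
    show "F = 0"
    proof (rule pfun_eqI)
      fix y
      obtain a :: "'n + 'e \<Rightarrow> 'k" where "(\<lambda>i. a (Inl i)) = y" using ext by blast
      then have "ev F y = ev ?F a" by simp
      then show "ev F y = ev 0 y" using F0 by simp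
    qed
  qed
  then have le: "card ?B \<le> kdim Y" by (intro indep_card_le_kdim[OF Y]) auto
  have "B \<subseteq> Inl ` ?B \<union> range Inr"
  proof
    fix x assume "x \<in> B"
    then show "x \<in> Inl ` ?B \<union> range Inr" by (cases x) auto
  qed
  then have "card B \<le> card (Inl ` ?B \<union> range (Inr :: 'e \<Rightarrow> 'n + 'e))" by (intro card_mono) auto
  also have "\<dots> \<le> card (Inl ` ?B :: ('n + 'e) set) + card (range (Inr :: 'e \<Rightarrow> 'n + 'e))" by (rule card_Un_le)
  also have "card (Inl ` ?B :: ('n + 'e) set) = card ?B" by (rule card_image) simp
  also have "card (range (Inr :: 'e \<Rightarrow> 'n + 'e)) = CARD('e)" by (rule card_image) simp
  finally have "kdim ?T \<le> kdim Y + CARD('e)" using le B(2) by simp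
  moreover have "card I \<le> kdim ?T" by (rule indep_card_le_kdim[OF T T0 I indep])
  ultimately show ?thesis by simp
qed

text \<open>Free coordinates on \<open>S\<close>: a basis of \<open>Y\<close> in the
  \<open>FX\<close> block, the single entry \<open>FY b\<close>, which sets the ratio of the two
  blocks as long as the entry \<open>FX b\<close> is nonzero, and the entries in
  \<open>E\<close>.\<close>

lemma kdim_fvar_lower_bound:
  fixes Y :: "('n::finite \<Rightarrow> 'k) set" and S :: "('n fvar \<Rightarrow> 'k) set"
  assumes B: "indep (van Y) X B" "b \<in> B" and S: "zclosed S" "S \<noteq> {}" and E: "E \<subseteq> {FU, FV}"
    and lift: "\<And>z. (\<lambda>i. z (FX i)) \<in> Y \<Longrightarrow> z (FX b) \<noteq> 0 \<Longrightarrow>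
      \<exists>p\<in>S. (\<forall>i. p (FX i) = z (FX i)) \<and> p (FY b) = z (FY b) \<and> (\<forall>e\<in>E. p e = z e)"
  shows "card B + 1 + card E \<le> kdim S"
proof -
  let ?B = "FX ` B \<union> insert (FY b) E"
  have "indep (van S) X ?B"
    unfolding indep_X
  proof (safe, rule pfun_eqI)
    fix F and z :: "'n fvar \<Rightarrow> 'k" assume F: "F \<in> van S" "F \<in> pfun_in ?B"
    \<comment> \<open>Freezes everything outside the \<open>FX\<close> block at its value in
      \<open>z\<close>, so that independence on \<open>Y\<close> can be applied to what is
      left.\<close>
    define \<psi> where "\<psi> = case_fvar (cst (z FU)) (cst (z FV)) X (\<lambda>i. cst (z (FY i)))"
    let ?G = "pcomp F \<psi>"
    have "?G \<in> pfun_in B"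
      using F(2)
    proof (induction rule: pfun_in.induct)
      case (var v)
      then show ?case using E by (cases v) (auto simp: \<psi>_def intro: pfun_in.intros)
    qed (auto simp: pcomp_add pcomp_mult intro: pfun_in.intros)
    \<comment> \<open>Points lift only where coordinate \<open>b\<close> is nonzero; the factor
      \<open>X b\<close> takes care of the others and is cancelled afterwards.\<close>
    then have "?G * X b \<in> pfun_in B" using B(2) by (intro pfun_in.mult pfun_in.var)
    moreover have "ev (?G * X b) w = 0" if w: "w \<in> Y" for w
    proof (cases "w b = 0")
      case False
      let ?z = "\<lambda>v. case v of FX i \<Rightarrow> w i | _ \<Rightarrow> z v"
      obtain p where p: "p \<in> S" "\<forall>i. p (FX i) = ?z (FX i)" "p (FY b) = ?z (FY b)" "\<forall>e\<in>E. p e = ?z e"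
        using lift[of ?z] w False by auto
      have "(\<lambda>v. ev (\<psi> v) w) = ?z" by (rule ext) (simp add: \<psi>_def split: fvar.split)
      then have "ev ?G w = ev F ?z" by simp
      also have "\<dots> = ev F p" by (rule ev_pfun_in_cong[OF F(2)]) (use p in auto)
      also have "\<dots> = 0" using F(1) p(1) by (auto simp: van_def)
      finally show ?thesis by simp
    qed simp
    then have "?G * X b \<in> van Y" by (simp add: van_def)
    ultimately have "?G * X b = 0" using B(1) by (auto simp: indep_X)
    moreover have "X b \<noteq> (0 :: ('n, 'k) pfun)"
    proof
      assume "X b = (0 :: ('n, 'k) pfun)"
      then have "ev (X b) (\<lambda>_. 1) = (0 :: 'k)" by simp
      then show False by simp
    qed
    ultimately have "?G = 0" by simp
    then have "ev ?G (\<lambda>i. z (FX i)) = 0" by simp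
    moreover have "(\<lambda>v. ev (\<psi> v) (\<lambda>i. z (FX i))) = z"
      by (rule ext) (simp add: \<psi>_def split: fvar.split)
    ultimately show "ev F z = ev 0 z" by simp
  qed
  then have "card ?B \<le> kdim S" by (intro indep_card_le_kdim[OF S]) auto
  moreover have "card ?B = card (FX ` B) + card (insert (FY b) E)"
    using E by (intro card_Un_disjoint) (auto intro: finite_subset)
  moreover have "card (insert (FY b) E) = Suc (card E)"
    using E by (intro card_insert_disjoint) (auto intro: finite_subset)
  moreover have "card (FX ` B) = card B" by (simp add: card_image inj_on_def)
  ultimately show ?thesis by simp
qed

lemma kdim_segre_cone_over:
  fixes Y :: "('n::finite \<Rightarrow> 'k) set"
  assumes Y: "zclosed Y" and cone: "\<And>w k. w \<in> Y \<Longrightarrow> (\<lambda>v. k * w v) \<in> Y"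
    and w: "w \<in> Y" "w i \<noteq> 0" and S: "zclosed (segre_cone_over Y)"
  shows "kdim (segre_cone_over Y) = kdim Y + 2"
proof (rule antisym)
  let ?S = "segre_cone_over Y"
  have mem: "fpoint (\<beta> * w0) (\<alpha> * w0) (\<lambda>i. \<alpha> * w i) (\<lambda>i. \<beta> * w i) \<in> ?S" if "w \<in> Y" for \<alpha> \<beta> w0 w
    using that unfolding segre_cone_over_def by blast
  have Y0: "Y \<noteq> {}" and S0: "?S \<noteq> {}" using w mem by blast+
  obtain B where B: "indep (van Y) X B" "card B = kdim Y" using kdim_witness[OF Y Y0] by blast
  have "indep (van Y) X {i}" by (rule cone_indep_singleton[OF _ w]) (rule cone)
  then have "card {i} \<le> kdim Y" by (intro indep_card_le_kdim[OF Y Y0]) auto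
  then obtain b where b: "b \<in> B" using B(2) by fastforce
  \<comment> \<open>Once \<open>FY b\<close> has fixed the ratio, \<open>FU\<close> is that ratio
    times \<open>FV\<close>, so only \<open>FV\<close> is free.\<close>
  have "card B + 1 + card {FV :: 'n fvar} \<le> kdim ?S"
  proof (rule kdim_fvar_lower_bound[OF B(1) b S S0])
    fix z :: "'n fvar \<Rightarrow> 'k" assume z: "(\<lambda>i. z (FX i)) \<in> Y" "z (FX b) \<noteq> 0"
    let ?\<beta> = "z (FY b) / z (FX b)"
    have "fpoint (?\<beta> * z FV) (1 * z FV) (\<lambda>i. 1 * z (FX i)) (\<lambda>i. ?\<beta> * z (FX i)) \<in> ?S"
      by (rule mem[OF z(1)])
    then show "\<exists>p\<in>?S. (\<forall>i. p (FX i) = z (FX i)) \<and> p (FY b) = z (FY b) \<and> (\<forall>e\<in>{FV}. p e = z e)"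
      by (rule bexI[rotated]) (use z in simp)
  qed auto
  then show "kdim Y + 2 \<le> kdim ?S" using B(2) by simp
  obtain B' where B': "indep (van ?S) X B'" "card B' = kdim ?S" using kdim_witness[OF S S0] by blast
  \<comment> \<open>The chart \<alpha> = 1, with two parameters beside \<open>Y\<close>:
    \<open>Inr False\<close> is \<beta> and \<open>Inr True\<close> is \<open>w0\<close>.\<close>
  let ?\<phi> = "fpoint (X (Inr False) * X (Inr True)) (X (Inr True)) (\<lambda>i. X (Inl i))
      (\<lambda>i. X (Inr False) * X (Inl i)) :: 'n fvar \<Rightarrow> ('n + bool, 'k) pfun"
  have "indep (van {a. (\<lambda>i. a (Inl i)) \<in> Y}) ?\<phi> B'"
    unfolding indep_def
  proof (intro ballI impI)
    fix F assume F: "F \<in> pfun_in B'" "pcomp F ?\<phi> \<in> van {a. (\<lambda>i. a (Inl i)) \<in> Y}"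
    have chart: "ev F (fpoint (\<beta> * w0) w0 w (\<lambda>i. \<beta> * w i)) = 0" if w: "w \<in> Y" for \<beta> w0 w
    proof -
      let ?a = "case_sum w (\<lambda>c. if c then w0 else \<beta>)"
      have "(\<lambda>v. ev (?\<phi> v) ?a) = fpoint (\<beta> * w0) w0 w (\<lambda>i. \<beta> * w i)"
        by (rule ext) (simp add: fpoint_def split: fvar.split)
      moreover have "ev (pcomp F ?\<phi>) ?a = 0" using F(2) w by (auto simp: van_def simp del: ev_pcomp)
      ultimately show ?thesis by simp
    qed
    have "F \<in> van ?S"
      unfolding van_def
    proof (intro CollectI ballI)
      fix z assume "z \<in> ?S"
      then obtain \<alpha> \<beta> w0 w where z: "z = fpoint (\<beta> * w0) (\<alpha> * w0) (\<lambda>i. \<alpha> * w i) (\<lambda>i. \<beta> * w i)"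
        and w: "w \<in> Y" by (auto simp: segre_cone_over_def)
      \<comment> \<open>Shifting \<alpha> by \<open>t\<close> makes it nonzero, after which it is
        absorbed into \<open>w\<close> and \<open>w0\<close>, \<open>Y\<close> being a cone; the
        point then lies in the chart.\<close>
      let ?C = "fpoint [:\<beta> * w0:] [:\<alpha> * w0, w0:] (\<lambda>i. [:\<alpha> * w i, w i:]) (\<lambda>i. [:\<beta> * w i:])"
      have C: "(\<lambda>v. poly (?C v) t) = fpoint (\<beta> * w0) ((\<alpha> + t) * w0) (\<lambda>i. (\<alpha> + t) * w i) (\<lambda>i. \<beta> * w i)" for t
        by (rule ext) (simp add: fpoint_def algebra_simps split: fvar.split)
      have "ev F (\<lambda>v. poly (?C v) 0) = 0"
      proof (rule vanishing_along_curve[of "[:\<alpha>, 1:]"])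
        fix t assume "poly [:\<alpha>, 1:] t \<noteq> 0"
        then have "fpoint (\<beta> * w0) ((\<alpha> + t) * w0) (\<lambda>i. (\<alpha> + t) * w i) (\<lambda>i. \<beta> * w i)
            = fpoint (\<beta> / (\<alpha> + t) * ((\<alpha> + t) * w0)) ((\<alpha> + t) * w0) (\<lambda>i. (\<alpha> + t) * w i)
              (\<lambda>i. \<beta> / (\<alpha> + t) * ((\<alpha> + t) * w i))"
          by simp
        then show "ev F (\<lambda>v. poly (?C v) t) = 0"
          unfolding C by (simp only: chart[OF cone[OF w]])
      qed simp
      then show "ev F z = 0" unfolding C z by simp
    qed
    then show "F = 0" using B'(1) F(1) by (auto simp: indep_X)
  qed
  then have "card B' \<le> kdim Y + CARD(bool)" by (intro indep_card_le_product[OF Y Y0]) auto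
  then show "kdim ?S \<le> kdim Y + 2" using B'(2) by simp
qed

lemma kdim_cone_segre:
  fixes Z :: "('n::finite \<Rightarrow> 'k) set"
  assumes Z: "zclosed Z" and cone: "\<And>w k. w \<in> Z \<Longrightarrow> (\<lambda>v. k * w v) \<in> Z"
    and w: "w \<in> Z" "w i \<noteq> 0"
  shows "kdim (cone_segre Z) = kdim Z + 3"
proof (rule antisym)
  let ?S = "cone_segre Z"
  define S where "S = {fpoint u' v' (\<lambda>i. \<alpha> * z i) (\<lambda>i. \<beta> * z i) | u' v' \<alpha> \<beta> z.
      (\<alpha>, \<beta>) \<noteq> (0, 0) \<and> z \<in> Z \<and> z \<noteq> (\<lambda>_. 0)}"
  have S_eq: "?S = zclosure S" by (simp add: cone_segre_def S_def)
  have Sc: "zclosed ?S" unfolding S_eq by (rule zclosed_zclosure)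
  have mem: "fpoint u' v' (\<lambda>i. 1 * z i) (\<lambda>i. \<beta> * z i) \<in> ?S" if "z \<in> Z" "z \<noteq> (\<lambda>_. 0)" for u' v' \<beta> z
  proof -
    have "(1 :: 'k, \<beta>) \<noteq> (0, 0)" by simp
    then have "fpoint u' v' (\<lambda>i. 1 * z i) (\<lambda>i. \<beta> * z i) \<in> S" unfolding S_def using that by blast
    then show ?thesis unfolding S_eq using subset_zclosure by blast
  qed
  have "w \<noteq> (\<lambda>_. 0)" using w(2) by auto
  then have Z0: "Z \<noteq> {}" and S0: "?S \<noteq> {}" using w(1) mem by blast+
  obtain B where B: "indep (van Z) X B" "card B = kdim Z" using kdim_witness[OF Z Z0] by blast
  have "indep (van Z) X {i}" by (rule cone_indep_singleton[OF _ w]) (rule cone)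
  then have "card {i} \<le> kdim Z" by (intro indep_card_le_kdim[OF Z Z0]) auto
  then obtain b where b: "b \<in> B" using B(2) by fastforce
  have "card B + 1 + card {FU, FV :: 'n fvar} \<le> kdim ?S"
  proof (rule kdim_fvar_lower_bound[OF B(1) b Sc S0])
    fix z :: "'n fvar \<Rightarrow> 'k" assume z: "(\<lambda>i. z (FX i)) \<in> Z" "z (FX b) \<noteq> 0"
    then have "(\<lambda>i. z (FX i)) \<noteq> (\<lambda>_. 0)" by metis
    then have "fpoint (z FU) (z FV) (\<lambda>i. 1 * z (FX i)) (\<lambda>i. z (FY b) / z (FX b) * z (FX i)) \<in> ?S"
      by (rule mem[OF z(1)])
    then show "\<exists>p\<in>?S. (\<forall>i. p (FX i) = z (FX i)) \<and> p (FY b) = z (FY b) \<and> (\<forall>e\<in>{FU, FV}. p e = z e)"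
      by (rule bexI[rotated]) (use z in simp)
  qed auto
  then show "kdim Z + 3 \<le> kdim ?S" using B(2) by simp
  obtain B' where B': "indep (van ?S) X B'" "card B' = kdim ?S" using kdim_witness[OF Sc S0] by blast
  \<comment> \<open>Again the chart \<alpha> = 1, now with three parameters: \<open>None\<close> is
    \<beta>, the two \<open>Some\<close> indices are \<open>u'\<close> and \<open>v'\<close>, which
    are independent of the rest.\<close>
  let ?\<phi> = "fpoint (X (Inr (Some False))) (X (Inr (Some True))) (\<lambda>i. X (Inl i))
      (\<lambda>i. X (Inr None) * X (Inl i)) :: 'n fvar \<Rightarrow> ('n + bool option, 'k) pfun"
  have "indep (van {a. (\<lambda>i. a (Inl i)) \<in> Z}) ?\<phi> B'"
    unfolding indep_def
  proof (intro ballI impI)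
    fix F assume F: "F \<in> pfun_in B'" "pcomp F ?\<phi> \<in> van {a. (\<lambda>i. a (Inl i)) \<in> Z}"
    have chart: "ev F (fpoint u' v' z (\<lambda>i. \<beta> * z i)) = 0" if z: "z \<in> Z" for u' v' \<beta> z
    proof -
      let ?a = "case_sum z (case_option \<beta> (\<lambda>c. if c then v' else u'))"
      have "(\<lambda>v. ev (?\<phi> v) ?a) = fpoint u' v' z (\<lambda>i. \<beta> * z i)"
        by (rule ext) (simp add: fpoint_def split: fvar.split)
      moreover have "ev (pcomp F ?\<phi>) ?a = 0" using F(2) z by (auto simp: van_def simp del: ev_pcomp)
      ultimately show ?thesis by simp
    qed
    have "F \<in> van S"
      unfolding van_def
    proof (intro CollectI ballI)
      fix p assume "p \<in> S"
      then obtain u' v' \<alpha> \<beta> z where p: "p = fpoint u' v' (\<lambda>i. \<alpha> * z i) (\<lambda>i. \<beta> * z i)"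
        and z: "z \<in> Z" by (auto simp: S_def)
      let ?C = "fpoint [:u':] [:v':] (\<lambda>i. [:\<alpha> * z i, z i:]) (\<lambda>i. [:\<beta> * z i:])"
      have C: "(\<lambda>v. poly (?C v) t) = fpoint u' v' (\<lambda>i. (\<alpha> + t) * z i) (\<lambda>i. \<beta> * z i)" for t
        by (rule ext) (simp add: fpoint_def algebra_simps split: fvar.split)
      have "ev F (\<lambda>v. poly (?C v) 0) = 0"
      proof (rule vanishing_along_curve[of "[:\<alpha>, 1:]"])
        fix t assume "poly [:\<alpha>, 1:] t \<noteq> 0"
        then have "fpoint u' v' (\<lambda>i. (\<alpha> + t) * z i) (\<lambda>i. \<beta> * z i)
            = fpoint u' v' (\<lambda>i. (\<alpha> + t) * z i) (\<lambda>i. \<beta> / (\<alpha> + t) * ((\<alpha> + t) * z i))"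
          by simp
        then show "ev F (\<lambda>v. poly (?C v) t) = 0"
          unfolding C by (simp only: chart[OF cone[OF z]])
      qed simp
      then show "ev F p = 0" unfolding C p by simp
    qed
    then have "F \<in> van ?S" unfolding S_eq by simp
    then show "F = 0" using B'(1) F(1) by (auto simp: indep_X)
  qed
  then have "card B' \<le> kdim Z + CARD(bool option)" by (intro indep_card_le_product[OF Z Z0]) auto
  then show "kdim ?S \<le> kdim Z + 3" using B'(2) by simp
qed

end

theorem theorem2p1:
  fixes g :: "('n::finite, 'k::field_char_0) mpoly" and d :: nat
  assumes alg_closed: "\<forall>p :: 'k poly. degree p > 0 \<longrightarrow> (\<exists>x. poly p x = 0)"
    and n_ge: "CARD('n) \<ge> 2"
    and irr: "irreducible g"
    and hom: "mp_homogeneous d g"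
    and not_cone: "\<not> hypersurface_is_cone g"
  shows "polar_image (f_of g) = cone_segre (polar_image g)
       \<and> dual_variety (f_of g) = segre_cone_over (dual_variety g)
       \<and> codim (dual_variety (f_of g)) (polar_image (f_of g))
           = codim (dual_variety g) (polar_image g) + 1
       \<and> (hessian g \<noteq> 0 \<longrightarrow>
            polar_image g = UNIV
          \<and> codim (dual_variety (f_of g)) (polar_image (f_of g))
              = codim (dual_variety g) UNIV + 1)"
proof -
  interpret alg_closed_field "TYPE('k)"
    using alg_closed by unfold_locales blast
  have d: "d \<ge> 2" by (rule degree_ge_2[OF n_ge irr hom not_cone])
  obtain q where q: "mpeval g q = 0" "grad g q \<noteq> (\<lambda>_. 0)" using exists_smooth_point[OF irr] by blast
  have q0: "q \<noteq> (\<lambda>_. 0)" by (rule nonzero_grad_imp_nonzero[OF hom d q(2)])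
  have g0: "g \<noteq> 0" using irr by auto
  have i: "polar_image (f_of g) = cone_segre (polar_image g)"
    using polar_image_f_of_subset[OF hom d] cone_segre_subset[OF hom d root_exists g0 q(2)] by blast
  have ii: "dual_variety (f_of g) = segre_cone_over (dual_variety g)"
    by (rule dual_variety_f_of[OF hom d])
  obtain j where j: "grad g q j \<noteq> 0" using q(2) by auto
  have "(\<lambda>v. 1 * grad g q v) \<in> polar_points g" "(\<lambda>v. 1 * grad g q v) \<in> dual_points g"
    unfolding polar_points_def dual_points_def using q q0 by blast+
  then have mem: "grad g q \<in> polar_image g" "grad g q \<in> dual_variety g"
    unfolding polar_image_eq dual_variety_eq using subset_zclosure by auto
  have closed: "zclosed (polar_image g)" "zclosed (dual_variety g)" "zclosed (segre_cone_over (dual_variety g))"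
    unfolding ii[symmetric] unfolding polar_image_eq dual_variety_eq by (rule zclosed_zclosure)+
  \<comment> \<open>Passing to affine cones raises both dimensions of a codimension by one, so the
    gains 3 and 2 computed on cones give the projective difference of 1.\<close>
  have "kdim (cone_segre (polar_image g)) = kdim (polar_image g) + 3"
    by (rule kdim_cone_segre[OF closed(1) polar_image_cone mem(1) j])
  moreover have "kdim (segre_cone_over (dual_variety g)) = kdim (dual_variety g) + 2"
    by (rule kdim_segre_cone_over[OF closed(2) dual_variety_cone mem(2) j closed(3)])
  ultimately have iii: "codim (dual_variety (f_of g)) (polar_image (f_of g))
      = codim (dual_variety g) (polar_image g) + 1"
    unfolding i ii codim_def by simp
  show ?thesis
    using i ii iii polar_image_UNIV[OF _ hom d q(2)] by auto
qed

end
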